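(* There is a distributional quantumly-accessible classical oracle $\mathcal F$ relative to which $\mathsf{QMA}\neq\mathsf{QCMA}$; i.e., there is a language $\mathcal L$ with $\mathcal L\in\mathsf{QMA}^{\mathcal F}$ and $\mathcal L\notin\mathsf{QCMA}^{\mathcal F}$.
   Context: A distributional quantumly-accessible classical oracle is specified by a distribution $\mathcal F$ over classical functions $f$: at the start of an algorithm's execution $f\leftarrow\mathcal F$ is sampled, and the algorithm then has quantum access to $f$ (the unitary $|x\rangle|y\rangle\mapsto|x\rangle|y\oplus f(x)\rangle$) throughout. $\mathcal L\in\mathsf{QMA}^{\mathcal F}$ if there are a QPT machine $V$ with quantum access to its oracle and a polynomial $p$ such that: for every $x\in\mathcal L$ there is a $p(|x|)$-qubit state $|w\rangle$ with $\Pr_{f\leftarrow\mathcal F}[V^f(x,|w\rangle)=1]\ge2/3$; and for every $x\notin\mathcal L$ and every $p(|x|)$-qubit $|w\rangle$, $\Pr_{f\leftarrow\mathcal F}[V^f(x,|w\rangle)=1]\le1/3$. (The witness depends only on $\mathcal F$ and $x$, not on the sampled $f$.) $\mathsf{QCMA}^{\mathcal F}$ is defined the same way with classical $p(|x|)$-bit witnesses. *)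

theory Defs
  imports "HOL-Probability.Probability" "HOL-Computational_Algebra.Polynomial"
begin

datatype sym = Blk | Zero | One
datatype dir = Lft | Rgt | Stay

text \<open>A TM has states 0..<tm_states; state 0 is the start state, state 1 the halting state.\<close>
datatype tm = TM (tm_states: nat) (tm_trans: "nat \<Rightarrow> sym \<Rightarrow> nat \<times> sym \<times> dir")

definition wf_tm :: "tm \<Rightarrow> bool" where
  "wf_tm M \<longleftrightarrow> 2 \<le> tm_states M \<and>
     (\<forall>s<tm_states M. \<forall>a. fst (tm_trans M s a) < tm_states M)"

type_synonym config = "nat \<times> sym list \<times> sym list"  \<comment> \<open>state, reversed left part, head and right part\<close>

definition tape_head :: "sym list \<Rightarrow> sym" where
  "tape_head r = (case r of [] \<Rightarrow> Blk | a # _ \<Rightarrow> a)"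

definition tm_step :: "tm \<Rightarrow> config \<Rightarrow> config" where
  "tm_step M c = (case c of (s, l, r) \<Rightarrow>
     if s = 1 then (s, l, r) else
     (case tm_trans M s (tape_head r) of (s', w, d) \<Rightarrow>
       (case d of
          Stay \<Rightarrow> (s', l, w # tl r)
        | Rgt \<Rightarrow> (s', w # l, tl r)
        | Lft \<Rightarrow> (case l of [] \<Rightarrow> (s', [], w # tl r) | a # l' \<Rightarrow> (s', l', a # w # tl r)))))"

definition sym_of_bool :: "bool \<Rightarrow> sym" where
  "sym_of_bool b = (if b then One else Zero)"

definition tm_run :: "tm \<Rightarrow> bool list \<Rightarrow> nat \<Rightarrow> config" where
  "tm_run M x n = (tm_step M ^^ n) (0, [], map sym_of_bool x)"

definition tm_halts_within :: "tm \<Rightarrow> bool list \<Rightarrow> nat \<Rightarrow> bool" where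
  "tm_halts_within M x t \<longleftrightarrow> fst (tm_run M x t) = 1"

definition tm_output :: "config \<Rightarrow> bool list" where
  "tm_output c = map (\<lambda>a. a = One) (takeWhile (\<lambda>a. a \<noteq> Blk) (snd (snd c)))"

datatype gate = Hg nat | Tg nat | CNOTg nat nat | Orc "nat list" "nat list"

text \<open>Encoding of circuits as bit strings: a list of natural numbers in unary
  (n encoded as n Trues followed by a False); first number = number of qubits,
  then gate codes.\<close>
fun unary_nats :: "nat \<Rightarrow> bool list \<Rightarrow> nat list" where
  "unary_nats k [] = []"
| "unary_nats k (True # bs) = unary_nats (Suc k) bs"
| "unary_nats k (False # bs) = k # unary_nats 0 bs"

function (sequential) decode_gates :: "nat list \<Rightarrow> gate list" where
  "decode_gates (0 # i # rest) = Hg i # decode_gates rest"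
| "decode_gates (Suc 0 # i # rest) = Tg i # decode_gates rest"
| "decode_gates (Suc (Suc 0) # i # j # rest) = CNOTg i j # decode_gates rest"
| "decode_gates (Suc (Suc (Suc 0)) # n # m # rest) =
     Orc (take n rest) (take m (drop n rest)) # decode_gates (drop (n + m) rest)"
| "decode_gates _ = []"
  by pat_completeness auto
termination by (relation "Wellfounded.measure length") auto

definition decode_circuit :: "bool list \<Rightarrow> nat \<times> gate list" where
  "decode_circuit bs = (case unary_nats 0 bs of [] \<Rightarrow> (0, []) | q # rest \<Rightarrow> (q, decode_gates rest))"

type_synonym qstate = "bool list \<Rightarrow> complex"  \<comment> \<open>amplitudes, supported on bit strings of length q\<close>

definition valid_gate :: "nat \<Rightarrow> gate \<Rightarrow> bool" where
  "valid_gate q g = (case g of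
      Hg i \<Rightarrow> i < q
    | Tg i \<Rightarrow> i < q
    | CNOTg i j \<Rightarrow> i < q \<and> j < q \<and> i \<noteq> j
    | Orc ins outs \<Rightarrow> distinct ins \<and> distinct outs \<and> set ins \<inter> set outs = {} \<and>
                     (\<forall>i \<in> set ins \<union> set outs. i < q))"

text \<open>The oracle gate |x>|y> -> |x>|y xor f(x)> on the input wires ins and output
  wires outs (the k-th output wire is XORed with the k-th bit of f(x), if present).\<close>
definition oracle_perm :: "(bool list \<Rightarrow> bool list) \<Rightarrow> nat list \<Rightarrow> nat list \<Rightarrow> bool list \<Rightarrow> bool list" where
  "oracle_perm f ins outs b =
     (let y = f (map (\<lambda>i. b ! i) ins) in
      map (\<lambda>j. b ! j \<noteq> (\<exists>k<length outs. outs ! k = j \<and> k < length y \<and> y ! k)) [0..<length b])"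

definition apply_gate :: "(bool list \<Rightarrow> bool list) \<Rightarrow> nat \<Rightarrow> gate \<Rightarrow> qstate \<Rightarrow> qstate" where
  "apply_gate f q g \<psi> = (if \<not> valid_gate q g then \<psi> else
     (case g of
        Hg i \<Rightarrow> (\<lambda>b. (\<psi> (b[i := False]) + (if b ! i then -1 else 1) * \<psi> (b[i := True]))
                     / complex_of_real (sqrt 2))
      | Tg i \<Rightarrow> (\<lambda>b. (if b ! i then cis (pi / 4) else 1) * \<psi> b)
      | CNOTg i j \<Rightarrow> (\<lambda>b. \<psi> (b[j := (b ! j \<noteq> b ! i)]))
      | Orc ins outs \<Rightarrow> (\<lambda>b. \<psi> (oracle_perm f ins outs b))))"

definition run_circuit :: "(bool list \<Rightarrow> bool list) \<Rightarrow> nat \<Rightarrow> gate list \<Rightarrow> qstate \<Rightarrow> qstate" where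
  "run_circuit f q gs \<psi> = fold (apply_gate f q) gs \<psi>"

definition init_state :: "nat \<Rightarrow> nat \<Rightarrow> qstate \<Rightarrow> qstate" where
  "init_state p q w = (\<lambda>b. if length b = q \<and> p \<le> q \<and> (\<forall>i\<in>{p..<q}. \<not> b ! i)
                            then w (take p b) else 0)"

definition acc_prob :: "nat \<Rightarrow> qstate \<Rightarrow> real" where
  "acc_prob q \<psi> = (\<Sum>b\<in>{b. length b = q \<and> b \<noteq> [] \<and> hd b}. (cmod (\<psi> b))\<^sup>2)"

definition is_qstate :: "nat \<Rightarrow> qstate \<Rightarrow> bool" where
  "is_qstate n w \<longleftrightarrow> (\<forall>b. length b \<noteq> n \<longrightarrow> w b = 0) \<and>
                     (\<Sum>b\<in>{b. length b = n}. (cmod (w b))\<^sup>2) = 1"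

definition basis_state :: "bool list \<Rightarrow> qstate" where
  "basis_state y = (\<lambda>b. if b = y then 1 else 0)"

definition dist_oracle :: "(bool list \<Rightarrow> bool list) measure \<Rightarrow> bool" where
  "dist_oracle F \<longleftrightarrow> prob_space F \<and>
     sets F = sets (Pi\<^sub>M UNIV (\<lambda>_. count_space (UNIV :: bool list set)))"

definition verifier_acc ::
  "(bool list \<Rightarrow> bool list) measure \<Rightarrow> tm \<Rightarrow> (nat \<Rightarrow> nat) \<Rightarrow> nat \<Rightarrow> bool list \<Rightarrow> qstate \<Rightarrow> real" where
  "verifier_acc F M T p x w =
     (case decode_circuit (tm_output (tm_run M x (T (length x)))) of (q, gs) \<Rightarrow>
        \<integral>f. acc_prob q (run_circuit f q gs (init_state p q w)) \<partial>F)"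

definition QMA_F :: "(bool list \<Rightarrow> bool list) measure \<Rightarrow> bool list set set" where
  "QMA_F F = {L. \<exists>M (c::nat) (k::nat) (p::nat poly).
     wf_tm M \<and> (\<forall>x. tm_halts_within M x (c * (length x + 1) ^ k)) \<and>
     (\<forall>x\<in>L. \<exists>w. is_qstate (poly p (length x)) w \<and>
        verifier_acc F M (\<lambda>n. c * (n + 1) ^ k) (poly p (length x)) x w \<ge> 2/3) \<and>
     (\<forall>x. x \<notin> L \<longrightarrow> (\<forall>w. is_qstate (poly p (length x)) w \<longrightarrow>
        verifier_acc F M (\<lambda>n. c * (n + 1) ^ k) (poly p (length x)) x w \<le> 1/3))}"

definition QCMA_F :: "(bool list \<Rightarrow> bool list) measure \<Rightarrow> bool list set set" where
  "QCMA_F F = {L. \<exists>M (c::nat) (k::nat) (p::nat poly).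
     wf_tm M \<and> (\<forall>x. tm_halts_within M x (c * (length x + 1) ^ k)) \<and>
     (\<forall>x\<in>L. \<exists>y. length y = poly p (length x) \<and>
        verifier_acc F M (\<lambda>n. c * (n + 1) ^ k) (poly p (length x)) x (basis_state y) \<ge> 2/3) \<and>
     (\<forall>x. x \<notin> L \<longrightarrow> (\<forall>y. length y = poly p (length x) \<longrightarrow>
        verifier_acc F M (\<lambda>n. c * (n + 1) ^ k) (poly p (length x)) x (basis_state y) \<le> 1/3))}"

end

theory Submission
  imports Defs "HOL-Combinatorics.Permutations" "HOL-Real_Asymp.Real_Asymp"
begin

text \<open>
  The separation comes from the Boolean hidden matching problem.  Let \<open>V\<close> be the set of \<open>n\<close>-bit
  strings, \<open>N = 2 ^ n\<close>, and let \<open>X\<close> be a hidden set of vertices of \<open>bool \<times> V\<close>.  The sampled function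
  describes a uniformly random perfect matching \<open>(False, z) - (True, \<pi> z)\<close> with a label on every edge: in
  a yes-instance the label tells whether \<open>X\<close> separates the two endpoints, in a no-instance the labels
  are uniformly random of even parity.  The quantum witness is the uniform superposition of all vertices
  with signs given by \<open>X\<close>; measuring the two endpoints of each edge in the basis determined by its label
  accepts it with certainty, while random labels make every state pass with probability at most \<open>1/2\<close>,
  since a labelling and its complement have complementary tests.  A further random bit, part of the sampled function,
  scales \<open>1\<close> and \<open>1/2\<close> down to \<open>2/3\<close> and \<open>1/3\<close>.

  A classical witness of \<open>p\<close> bits fails even against unbounded access to the sampled function.  It fixes a
  family \<open>A\<close> of hidden sets of density about \<open>2 ^ -p\<close>, and by Parseval the squared distance between the
  label distributions is controlled by Fourier weights of \<open>A\<close> at level \<open>2 k\<close>, each divided by the number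
  \<open>N choose k\<close> of images of a \<open>k\<close>-set under \<open>\<pi>\<close>.  Hypercontractivity bounds these weights by a power \<open>2 k\<close> of a multiple of \<open>p\<close>.
  The blocks for different lengths are independent, so a diagonalization over all machines
  along a sparse sequence of lengths gives the language.
\<close>

section \<open>Characters and hypercontractivity\<close>

text \<open>The obstacle is global parity. With a perfect matching the product of all edge labels is
  the parity of \<open>X\<close>, whatever \<pi> is, and this Fourier coefficient is divided only by
  \<open>N choose N\<close>, which is 1. Yet all vertices should be matched, so that the sampled map
  is an involution on basis states and two queries apply it in place. The cure is to make everything
  even: the hidden sets used against a classical witness and the random labels. The coefficient at
  level N then cancels, and the levels above N / 2 mirror those below, so the binomial is a strong
  divisor at every remaining level. Low levels need hypercontractivity with exponent p; from level p
  + 8 on Parseval with the factor 2 ^ p is enough, since the binomial is at least 2 ^ k up to N / 2.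
  So N need only exceed a cubic polynomial in p, whereas it is exponential in the input length. On
  the quantum side, the conjunction of two measured qubits is taken from the same query that reads
  the random bit, which spares building a Toffoli gate from T gates.\<close>

definition chi :: "'a set \<Rightarrow> 'a set \<Rightarrow> real" where
  "chi B X = (\<Prod>x\<in>B. if x \<in> X then -1 else 1)"

lemma chi_empty [simp]: "chi {} X = 1"
  by (simp add: chi_def)

lemma chi_mult_self [simp]: "chi B X * chi B X = 1"
  unfolding chi_def by (simp add: prod.distrib[symmetric] if_distrib cong: if_cong)

lemma chi_cases: "chi B X = 1 \<or> chi B X = -1"
  using chi_mult_self[of B X] by (simp add: square_eq_1_iff del: chi_mult_self)

lemma chi_insert:
  assumes "finite B" "a \<notin> B"
  shows "chi (insert a B) X = (if a \<in> X then - chi B X else chi B X)"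
  using assms by (simp add: chi_def)

lemma chi_insert_right: "a \<notin> B \<Longrightarrow> chi B (insert a X) = chi B X"
  unfolding chi_def by (rule prod.cong) auto

lemma chi_Un:
  assumes "finite B" "finite C" "B \<inter> C = {}"
  shows "chi (B \<union> C) X = chi B X * chi C X"
  unfolding chi_def using assms by (rule prod.union_disjoint)

lemma chi_image: "inj_on f B \<Longrightarrow> chi (f ` B) X = chi B (f -` X)"
  unfolding chi_def by (simp add: prod.reindex)

lemma chi_diff_right:
  assumes "finite V" "B \<subseteq> V"
  shows "chi B (V - S) = (-1) ^ card B * chi B S"
proof -
  have "chi B (V - S) = (\<Prod>x\<in>B. -1 * (if x \<in> S then -1 else 1))"
    unfolding chi_def using assms by (intro prod.cong) auto
  also have "\<dots> = (\<Prod>x\<in>B. -1) * chi B S"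
    unfolding chi_def by (rule prod.distrib)
  finally show ?thesis by simp
qed

lemma sum_Pow_insert:
  fixes f :: "'a set \<Rightarrow> 'b::comm_monoid_add"
  assumes "finite I" "a \<notin> I"
  shows "sum f (Pow (insert a I)) = (\<Sum>B\<in>Pow I. f B + f (insert a B))"
proof -
  have inj: "inj_on (insert a) (Pow I)"
    using assms(2) by (auto simp: inj_on_def)
  have "sum f (Pow (insert a I)) = sum f (Pow I) + sum f (insert a ` Pow I)"
    unfolding Pow_insert using assms by (intro sum.union_disjoint) auto
  then show ?thesis
    using inj by (simp add: sum.reindex sum.distrib)
qed

lemma sum_Pow_prod:
  fixes c :: "'a \<Rightarrow> real"
  assumes "finite V"
  shows "(\<Sum>B\<in>Pow V. \<Prod>x\<in>B. c x) = (\<Prod>x\<in>V. 1 + c x)"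
  using assms
proof (induction V rule: finite_induct)
  case empty
  then show ?case by simp
next
  case (insert a V)
  have "(\<Sum>B\<in>Pow (insert a V). \<Prod>x\<in>B. c x) = (\<Sum>B\<in>Pow V. (1 + c a) * (\<Prod>x\<in>B. c x))"
    unfolding sum_Pow_insert[OF insert(1,2)]
  proof (intro sum.cong refl)
    fix B assume "B \<in> Pow V"
    then have "a \<notin> B" "finite B"
      using insert finite_subset by auto
    then show "prod c B + prod c (insert a B) = (1 + c a) * prod c B"
      by (simp add: algebra_simps)
  qed
  then show ?case
    using insert by (simp add: sum_distrib_left[symmetric])
qed

text \<open>The sum factors over the points of \<open>V\<close>, and a point where \<open>S\<close>
  and \<open>S'\<close> differ contributes the factor 1 - 1.\<close>

lemma chi_orthogonal:
  assumes "finite V" "S \<subseteq> V" "S' \<subseteq> V"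
  shows "(\<Sum>B\<in>Pow V. chi B S * chi B S') = (if S = S' then 2 ^ card V else 0)"
proof -
  define c where "c x = (if x \<in> S then -1 else 1) * (if x \<in> S' then -1 else (1::real))" for x
  have "(\<Sum>B\<in>Pow V. chi B S * chi B S') = (\<Sum>B\<in>Pow V. \<Prod>x\<in>B. c x)"
    unfolding chi_def c_def by (simp add: prod.distrib)
  also have "\<dots> = (\<Prod>x\<in>V. 1 + c x)"
    using assms(1) by (rule sum_Pow_prod)
  also have "\<dots> = (if S = S' then 2 ^ card V else 0)"
  proof (cases "S = S'")
    case True
    then have "1 + c x = 2" for x
      by (simp add: c_def)
    then show ?thesis using True by simp
  next
    case False
    then obtain x where "x \<in> V" "(x \<in> S) \<noteq> (x \<in> S')"
      using assms by blast
    then have "x \<in> V" "1 + c x = 0"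
      unfolding c_def by auto
    then show ?thesis using False assms(1) prod_zero_iff by auto
  qed
  finally show ?thesis .
qed


lemma parseval:
  assumes "finite V"
  shows "(\<Sum>B\<in>Pow V. (\<Sum>S\<in>Pow V. u S * chi B S)\<^sup>2) = 2 ^ card V * (\<Sum>S\<in>Pow V. (u S)\<^sup>2)"
proof -
  have "(\<Sum>B\<in>Pow V. (\<Sum>S\<in>Pow V. u S * chi B S)\<^sup>2)
      = (\<Sum>B\<in>Pow V. \<Sum>S\<in>Pow V. \<Sum>S'\<in>Pow V. u S * u S' * (chi B S * chi B S'))"
    by (simp add: power2_eq_square sum_product mult_ac)
  also have "\<dots> = (\<Sum>S\<in>Pow V. \<Sum>B\<in>Pow V. \<Sum>S'\<in>Pow V. u S * u S' * (chi B S * chi B S'))"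
    by (rule sum.swap)
  also have "\<dots> = (\<Sum>S\<in>Pow V. \<Sum>S'\<in>Pow V. \<Sum>B\<in>Pow V. u S * u S' * (chi B S * chi B S'))"
    by (intro sum.cong refl sum.swap)
  also have "\<dots> = (\<Sum>S\<in>Pow V. \<Sum>S'\<in>Pow V. u S * u S' * (if S = S' then 2 ^ card V else 0))"
    by (intro sum.cong refl)
       (simp only: sum_distrib_left[symmetric] chi_orthogonal[OF assms] Pow_iff)
  also have "\<dots> = (\<Sum>S\<in>Pow V. 2 ^ card V * (u S)\<^sup>2)"
    using assms by (intro sum.cong refl) (simp add: if_distrib power2_eq_square sum.delta cong: if_cong)
  finally show ?thesis
    by (simp add: sum_distrib_left)
qed

section \<open>Hypercontractivity for even integer exponents\<close>

lemma sum_even_terms: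
  fixes f :: "nat \<Rightarrow> real"
  assumes "\<And>i. odd i \<Longrightarrow> f i = 0"
  shows "sum f {..2 * m} = (\<Sum>j\<le>m. f (2 * j))"
  by (induction m) (use assms in simp_all)

text \<open>Compares successive quotients: from j to j + 1 the left side grows by the quotient of
  the right side times (2m - 2j - 1) / ((2j + 1)(2m - 1)), which is at most 1.\<close>

lemma even_binomial_le:
  assumes "j \<le> m"
  shows "real ((2 * m) choose (2 * j)) \<le> real (m choose j) * (2 * real m - 1) ^ j"
  using assms
proof (induction j)
  case 0
  then show ?case by simp
next
  case (Suc j)
  let ?C = "real ((2 * m) choose (2 * j))" and ?C2 = "real ((2 * m) choose (2 * Suc j))"
  let ?c = "real (m choose j)" and ?c1 = "real (m choose Suc j)"
  have jm: "j < m" using Suc by simp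
  have absorb: "real (Suc k) * real (n choose Suc k) = (real n - real k) * real (n choose k)"
    if "k \<le> n" for n k
    using that binomial_absorb_comp[of n k] binomial_absorption[of k n]
    by (metis of_nat_diff of_nat_mult)
  have 1: "?c1 * real (Suc j) = ?c * (real m - real j)"
    using absorb[of j m] jm by (simp add: mult_ac)
  have a: "real (Suc (2*j)) * real ((2*m) choose Suc (2*j)) = (real (2*m) - real (2*j)) * ?C"
    using absorb[of "2*j" "2*m"] jm by simp
  have b: "real (Suc (Suc (2*j))) * ?C2 = (real (2*m) - real (Suc (2*j))) * real ((2*m) choose Suc (2*j))"
    using absorb[of "Suc (2*j)" "2*m"] jm by simp
  have "real (Suc (Suc (2*j))) * (real (Suc (2*j)) * ?C2)
      = (real (2*m) - real (Suc (2*j))) * ((real (2*m) - real (2*j)) * ?C)"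
    using a b by (metis mult.left_commute)
  then have 2: "real (Suc j) * (real (Suc (2*j)) * ?C2) = (2 * real m - 2 * real j - 1) * (real m - real j) * ?C"
    by (simp add: algebra_simps)
  have "1 * ?C2 \<le> real (Suc (2*j)) * ?C2"
    by (rule mult_right_mono) simp_all
  then have "real (Suc j) * ?C2 \<le> real (Suc j) * (real (Suc (2*j)) * ?C2)"
    by (intro mult_left_mono) simp_all
  also have "\<dots> \<le> (2 * real m - 1) * (real m - real j) * ?C"
    unfolding 2 using jm by (intro mult_right_mono) auto
  also have "\<dots> \<le> (2 * real m - 1) * (real m - real j) * (?c * (2 * real m - 1) ^ j)"
    using jm Suc by (intro mult_left_mono) auto
  also have "\<dots> = (2 * real m - 1) ^ Suc j * (?c1 * real (Suc j))"
    unfolding 1 by simp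
  finally have "real (Suc j) * ?C2 \<le> real (Suc j) * (?c1 * (2 * real m - 1) ^ Suc j)"
    by (simp add: mult_ac)
  then show ?case
    by (simp only: mult_le_cancel_left_pos of_nat_0_less_iff zero_less_Suc)
qed

text \<open>The odd binomial terms cancel, and the even ones are compared one by one with the
  expansion of the right side. The condition on \<open>r\<close> pays for the factor (2m - 1) ^
  j.\<close>

lemma two_point_inequality:
  fixes x y r :: real
  assumes "r\<^sup>2 * (2 * real m - 1) \<le> 1" "1 \<le> m"
  shows "(x + r * y) ^ (2 * m) + (x - r * y) ^ (2 * m) \<le> 2 * (x\<^sup>2 + y\<^sup>2) ^ m"
proof -
  have "(x + r * y) ^ (2 * m) + (x - r * y) ^ (2 * m)
      = (\<Sum>i\<le>2 * m. real ((2 * m) choose i) * (r * y) ^ i * x ^ (2 * m - i)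
                  + real ((2 * m) choose i) * (- (r * y)) ^ i * x ^ (2 * m - i))"
    using binomial_ring[of "r * y" x "2 * m"] binomial_ring[of "- (r * y)" x "2 * m"]
    by (simp add: sum.distrib add.commute)
  also have "\<dots> = (\<Sum>j\<le>m. 2 * (real ((2 * m) choose (2 * j)) * (r * y) ^ (2 * j) * x ^ (2 * m - 2 * j)))"
    by (subst sum_even_terms) (auto intro!: sum.cong)
  also have "\<dots> \<le> (\<Sum>j\<le>m. 2 * (real (m choose j) * (y\<^sup>2) ^ j * (x\<^sup>2) ^ (m - j)))"
  proof (rule sum_mono)
    fix j assume "j \<in> {..m}"
    then have j: "j \<le> m" by simp
    have e: "(r * y) ^ (2 * j) = (r\<^sup>2) ^ j * (y\<^sup>2) ^ j" "x ^ (2 * m - 2 * j) = (x\<^sup>2) ^ (m - j)"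
      by (simp_all add: power_mult power_mult_distrib diff_mult_distrib2[symmetric])
    have "real ((2 * m) choose (2 * j)) * (r\<^sup>2) ^ j \<le> real (m choose j) * ((2 * real m - 1) ^ j * (r\<^sup>2) ^ j)"
      using mult_right_mono[OF even_binomial_le[OF j], of "(r\<^sup>2) ^ j"] by (simp add: mult_ac)
    also have "\<dots> \<le> real (m choose j) * 1"
      unfolding power_mult_distrib[symmetric]
      using assms by (intro mult_left_mono power_le_one) (auto simp: mult_ac)
    finally have "real ((2 * m) choose (2 * j)) * (r\<^sup>2) ^ j \<le> real (m choose j)"
      by simp
    then have "real ((2 * m) choose (2 * j)) * (r\<^sup>2) ^ j * ((y\<^sup>2) ^ j * (x\<^sup>2) ^ (m - j))
        \<le> real (m choose j) * ((y\<^sup>2) ^ j * (x\<^sup>2) ^ (m - j))"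
      by (intro mult_right_mono) auto
    then show "2 * (real ((2 * m) choose (2 * j)) * (r * y) ^ (2 * j) * x ^ (2 * m - 2 * j))
        \<le> 2 * (real (m choose j) * (y\<^sup>2) ^ j * (x\<^sup>2) ^ (m - j))"
      unfolding e by (simp add: mult_ac)
  qed
  also have "\<dots> = 2 * (x\<^sup>2 + y\<^sup>2) ^ m"
    using binomial_ring[of "y\<^sup>2" "x\<^sup>2" m] by (simp add: sum_distrib_left add.commute)
  finally show ?thesis .
qed

text \<open>Convexity of the m-th power with the weights s / (s + t) and t / (s + t). In the
  induction for hypercontractivity it does the work of Minkowski's inequality for the
  m-norm.\<close>

lemma power_sum_le_convex:
  fixes a b s t :: real
  assumes "0 \<le> a" "0 \<le> b" "0 < s" "0 < t" "1 \<le> m"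
  shows "(a + b) ^ m \<le> (s + t) ^ m * (s / (s + t) * (a / s) ^ m + t / (s + t) * (b / t) ^ m)"
proof -
  have cvx: "convex_on {0..} (\<lambda>x::real. x ^ m)"
    by (rule convex_on_realI[where f' = "\<lambda>x. real m * x ^ (m - 1)"])
       (auto intro!: derivative_eq_intros mult_left_mono power_mono)
  have "((1 - t / (s + t)) *\<^sub>R (a / s) + (t / (s + t)) *\<^sub>R (b / t)) ^ m
      \<le> (1 - t / (s + t)) * (a / s) ^ m + (t / (s + t)) * (b / t) ^ m"
    using assms by (intro convex_onD[OF cvx]) auto
  moreover have "1 - t / (s + t) = s / (s + t)"
    using assms by (simp add: field_simps)
  moreover have "(s / (s + t)) *\<^sub>R (a / s) + (t / (s + t)) *\<^sub>R (b / t) = (a + b) / (s + t)"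
    using assms by (simp add: add_divide_distrib)
  ultimately have "((a + b) / (s + t)) ^ m \<le> s / (s + t) * (a / s) ^ m + t / (s + t) * (b / t) ^ m"
    by simp
  then have "(s + t) ^ m * ((a + b) / (s + t)) ^ m
      \<le> (s + t) ^ m * (s / (s + t) * (a / s) ^ m + t / (s + t) * (b / t) ^ m)"
    using assms by (intro mult_left_mono) auto
  then show ?thesis
    using assms by (simp add: power_divide)
qed

text \<open>Bonami's inequality from the 2-norm to the 2m-norm for the noise operator of rate
  \<open>r\<close>. Splitting off a point \<open>a\<close> writes the function as u + r v on sets
  without \<open>a\<close> and as u - r v on sets with \<open>a\<close>, so the two-point inequality
  disposes of \<open>a\<close>.\<close>

lemma hypercontractive:
  fixes c :: "'a set \<Rightarrow> real"
  assumes "finite I" and m: "1 \<le> m" and r: "r\<^sup>2 * (2 * real m - 1) \<le> 1"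
  shows "(\<Sum>X\<in>Pow I. (\<Sum>B\<in>Pow I. c B * r ^ card B * chi B X) ^ (2 * m))
     \<le> 2 ^ card I * (\<Sum>B\<in>Pow I. (c B)\<^sup>2) ^ m"
  using assms(1)
proof (induction I arbitrary: c rule: finite_induct)
  case empty
  then show ?case by (simp add: power_mult)
next
  case (insert a I)
  define c' where "c' B = c (insert a B)" for B
  define u where "u X = (\<Sum>B\<in>Pow I. c B * r ^ card B * chi B X)" for X
  define v where "v X = (\<Sum>B\<in>Pow I. c' B * r ^ card B * chi B X)" for X
  define s where "s = (\<Sum>B\<in>Pow I. (c B)\<^sup>2)"
  define t where "t = (\<Sum>B\<in>Pow I. (c' B)\<^sup>2)"
  have fin: "finite B" "a \<notin> B" if "B \<in> Pow I" for B
    using that insert finite_subset by auto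
  have P1: "(\<Sum>B\<in>Pow (insert a I). c B * r ^ card B * chi B X) = u X + r * v X"
    if "X \<in> Pow I" for X
  proof -
    have "(\<Sum>B\<in>Pow (insert a I). c B * r ^ card B * chi B X)
      = (\<Sum>B\<in>Pow I. c B * r ^ card B * chi B X + r * (c' B * r ^ card B * chi B X))"
      unfolding sum_Pow_insert[OF insert(1,2)]
      using fin fin(2)[OF that] by (intro sum.cong refl) (simp add: chi_insert c'_def)
    then show ?thesis by (simp add: u_def v_def sum.distrib sum_distrib_left)
  qed
  have P2: "(\<Sum>B\<in>Pow (insert a I). c B * r ^ card B * chi B (insert a X)) = u X - r * v X"
    if "X \<in> Pow I" for X
  proof -
    have "(\<Sum>B\<in>Pow (insert a I). c B * r ^ card B * chi B (insert a X))
      = (\<Sum>B\<in>Pow I. c B * r ^ card B * chi B X - r * (c' B * r ^ card B * chi B X))"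
      unfolding sum_Pow_insert[OF insert(1,2)]
      using fin fin(2)[OF that] by (intro sum.cong refl) (simp add: chi_insert chi_insert_right c'_def)
    then show ?thesis by (simp add: u_def v_def sum_subtractf sum_distrib_left)
  qed
  have IHu: "(\<Sum>X\<in>Pow I. (u X) ^ (2 * m)) \<le> 2 ^ card I * s ^ m"
    unfolding u_def s_def by (rule insert.IH)
  have IHv: "(\<Sum>X\<in>Pow I. (v X) ^ (2 * m)) \<le> 2 ^ card I * t ^ m"
    unfolding v_def t_def by (rule insert.IH)
  have st: "0 \<le> s" "0 \<le> t" by (auto simp: s_def t_def intro: sum_nonneg)
  have zero: "\<forall>X\<in>Pow I. w X = 0"
    if "(\<Sum>X\<in>Pow I. (w X) ^ (2 * m)) \<le> 2 ^ card I * 0 ^ m" for w :: "'a set \<Rightarrow> real"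
  proof -
    have "(\<Sum>X\<in>Pow I. (w X) ^ (2 * m)) = 0"
      using that m by (intro antisym sum_nonneg) (simp_all add: power_0_left)
    then have "\<forall>X\<in>Pow I. (w X) ^ (2 * m) = 0"
      using insert(1) by (subst (asm) sum_nonneg_eq_0_iff) auto
    then show ?thesis by auto
  qed
  \<comment> \<open>The convexity argument divides by \<open>s\<close> and by \<open>t\<close>; when
    one of them is 0, the corresponding function vanishes on every set.\<close>
  have key: "(\<Sum>X\<in>Pow I. ((u X)\<^sup>2 + (v X)\<^sup>2) ^ m) \<le> 2 ^ card I * (s + t) ^ m"
  proof (cases "s = 0 \<or> t = 0")
    case True
    then consider "s = 0" | "t = 0" by auto
    then show ?thesis
    proof cases
      case 1
      then have "\<forall>X\<in>Pow I. u X = 0" using zero[of u] IHu by simp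
      then show ?thesis using IHv 1 by (simp add: power_mult)
    next
      case 2
      then have "\<forall>X\<in>Pow I. v X = 0" using zero[of v] IHv by simp
      then show ?thesis using IHu 2 by (simp add: power_mult)
    qed
  next
    case False
    then have p: "0 < s" "0 < t" using st by auto
    have "(\<Sum>X\<in>Pow I. ((u X)\<^sup>2 + (v X)\<^sup>2) ^ m)
      \<le> (\<Sum>X\<in>Pow I. (s + t) ^ m * (s / (s + t) * ((u X)\<^sup>2 / s) ^ m + t / (s + t) * ((v X)\<^sup>2 / t) ^ m))"
      using p m by (intro sum_mono power_sum_le_convex) auto
    also have "\<dots> = (s + t) ^ m * (s / (s + t) * ((\<Sum>X\<in>Pow I. (u X) ^ (2 * m)) / s ^ m)
        + t / (s + t) * ((\<Sum>X\<in>Pow I. (v X) ^ (2 * m)) / t ^ m))"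
      by (simp add: sum_distrib_left[symmetric] sum.distrib power_divide sum_divide_distrib[symmetric] power_mult)
    also have "\<dots> \<le> (s + t) ^ m * (s / (s + t) * 2 ^ card I + t / (s + t) * 2 ^ card I)"
      using p IHu IHv by (intro mult_left_mono add_mono) (auto simp: divide_le_eq)
    also have "s / (s + t) * 2 ^ card I + t / (s + t) * 2 ^ card I = (2::real) ^ card I"
      unfolding distrib_right[symmetric] using p by (simp add: add_divide_distrib[symmetric])
    finally show ?thesis by (simp add: mult.commute)
  qed
  have "(\<Sum>X\<in>Pow (insert a I). (\<Sum>B\<in>Pow (insert a I). c B * r ^ card B * chi B X) ^ (2 * m))
      = (\<Sum>X\<in>Pow I. (u X + r * v X) ^ (2 * m) + (u X - r * v X) ^ (2 * m))"
    unfolding sum_Pow_insert[OF insert(1,2), of "\<lambda>X. (\<Sum>B\<in>Pow (insert a I). c B * r ^ card B * chi B X) ^ (2 * m)"]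
    by (intro sum.cong refl) (simp only: P1 P2)
  also have "\<dots> \<le> (\<Sum>X\<in>Pow I. 2 * ((u X)\<^sup>2 + (v X)\<^sup>2) ^ m)"
    by (intro sum_mono two_point_inequality m r)
  also have "\<dots> \<le> 2 * (2 ^ card I * (s + t) ^ m)"
    using key by (simp add: sum_distrib_left[symmetric])
  also have "s + t = (\<Sum>B\<in>Pow (insert a I). (c B)\<^sup>2)"
    unfolding sum_Pow_insert[OF insert(1,2)] by (simp add: s_def t_def c'_def sum.distrib)
  finally show ?case using insert by simp
qed

section \<open>Hidden matchings\<close>

lemma chi_commute:
  assumes "finite B" "finite X"
  shows "chi B X = chi X B"
  unfolding chi_def prod.inter_restrict[OF assms(1), symmetric] prod.inter_restrict[OF assms(2), symmetric]
  by (simp add: Int_commute)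

lemma chi_diff_left:
  assumes "finite I" "D \<subseteq> I"
  shows "chi (I - D) X = chi I X * chi D X"
proof -
  have "chi I X = chi (I - D) X * chi D X"
    using chi_Un[of "I - D" D X] assms finite_subset[OF assms(2,1)] by (simp add: Un_absorb2 Diff_Int_distrib2)
  then show ?thesis by simp
qed

section \<open>Fourier weights of a dense family\<close>

definition fourier :: "'a set set \<Rightarrow> 'a set \<Rightarrow> real" where
  "fourier A D = (\<Sum>X\<in>A. chi D X) / card A"

lemma mean_power_le:
  fixes z :: "'a \<Rightarrow> real"
  assumes "finite A" "A \<noteq> {}" "1 \<le> m" "\<And>x. x \<in> A \<Longrightarrow> 0 \<le> z x"
  shows "((\<Sum>x\<in>A. z x) / card A) ^ m \<le> (\<Sum>x\<in>A. z x ^ m) / card A"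
proof -
  have cvx: "convex_on {0..} (\<lambda>x::real. x ^ m)"
    by (rule convex_on_realI[where f' = "\<lambda>x. real m * x ^ (m - 1)"])
       (auto intro!: derivative_eq_intros mult_left_mono power_mono)
  have "(\<Sum>x\<in>A. (1 / card A) *\<^sub>R z x) ^ m \<le> (\<Sum>x\<in>A. (1 / card A) * z x ^ m)"
    using assms by (intro convex_on_sum[OF _ _ cvx]) (auto simp: card_gt_0_iff)
  then show ?thesis
    by (simp add: sum_divide_distrib)
qed

text \<open>A duality argument. The sum \<open>W\<close> is itself the mean over \<open>A\<close> of
  the smoothed function \<open>Z\<close>, so W ^ (2 m) is at most the mean of Z ^ (2 m) over
  \<open>A\<close>. Extending that mean from \<open>A\<close> to all sets costs the density factor 2
  ^ p, and hypercontractivity bounds the result by 2 ^ p * W ^ m. Cancelling W ^ m leaves the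
  claim.\<close>

lemma level_inequality:
  fixes A :: "'a set set"
  assumes I: "finite I" and A: "A \<subseteq> Pow I" "A \<noteq> {}" and dens: "2 ^ card I \<le> 2 ^ p * real (card A)"
    and m: "1 \<le> m" and r: "r\<^sup>2 * (2 * real m - 1) \<le> 1"
  shows "(\<Sum>D\<in>Pow I. (r ^ card D * fourier A D)\<^sup>2) ^ m \<le> 2 ^ p"
proof -
  define W where "W = (\<Sum>D\<in>Pow I. (r ^ card D * fourier A D)\<^sup>2)"
  define Z where "Z X = (\<Sum>D\<in>Pow I. (r ^ card D * fourier A D) * r ^ card D * chi D X)" for X
  have finA: "finite A" using A I finite_subset by blast
  then have cA: "real (card A) > 0" using A by (simp add: card_gt_0_iff)
  have W0: "0 \<le> W" unfolding W_def by (intro sum_nonneg) auto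
  have "(\<Sum>X\<in>A. Z X) / card A = (\<Sum>D\<in>Pow I. (r ^ card D * fourier A D) * r ^ card D * fourier A D)"
    unfolding Z_def
    by (subst sum.swap) (simp add: sum_distrib_left[symmetric] sum_divide_distrib[symmetric] fourier_def)
  then have WZ: "W = (\<Sum>X\<in>A. Z X) / card A"
    by (simp add: W_def power2_eq_square mult_ac)
  also have "\<dots> \<le> (\<Sum>X\<in>A. \<bar>Z X\<bar>) / card A"
    using cA by (intro divide_right_mono sum_mono) auto
  finally have "W ^ (2 * m) \<le> ((\<Sum>X\<in>A. \<bar>Z X\<bar>) / card A) ^ (2 * m)"
    using W0 by (intro power_mono)
  also have "\<dots> \<le> (\<Sum>X\<in>A. \<bar>Z X\<bar> ^ (2 * m)) / card A"
    using finA A m by (intro mean_power_le) auto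
  also have "\<dots> \<le> (\<Sum>X\<in>Pow I. Z X ^ (2 * m)) / card A"
    using I A by (intro divide_right_mono) (auto simp: power_even_abs intro!: sum_mono2)
  also have "\<dots> \<le> 2 ^ card I * W ^ m / card A"
    unfolding Z_def W_def using hypercontractive[OF I m r] by (intro divide_right_mono) auto
  also have "\<dots> \<le> 2 ^ p * W ^ m"
    using mult_right_mono[OF dens, of "W ^ m"] W0 cA by (simp add: divide_le_eq mult_ac)
  finally have *: "W ^ m * W ^ m \<le> 2 ^ p * W ^ m"
    by (simp add: mult_2 power_add)
  have "W ^ m \<le> 2 ^ p"
  proof (cases "W = 0")
    case True
    then show ?thesis using m by (simp add: power_0_left)
  next
    case False
    then have "W ^ m > 0" using W0 by simp
    then show ?thesis using * by simp
  qed
  then show ?thesis by (simp add: W_def)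
qed

section \<open>Images of a set under a random permutation\<close>

lemma ex_permutes_image:
  assumes "finite V" "C \<subseteq> V" "C' \<subseteq> V" "card C = card C'"
  shows "\<exists>\<sigma>. \<sigma> permutes V \<and> \<sigma> ` C = C'"
proof -
  have fin: "finite C" "finite C'" using assms finite_subset by auto
  obtain f where f: "bij_betw f C C'"
    using finite_same_card_bij[OF fin assms(4)] by blast
  have "card (V - C) = card (V - C')"
    using assms fin by (simp add: card_Diff_subset)
  then obtain g where g: "bij_betw g (V - C) (V - C')"
    using finite_same_card_bij[of "V - C" "V - C'"] assms(1) by blast
  define \<sigma> where "\<sigma> x = (if x \<in> C then f x else if x \<in> V then g x else x)" for x
  have 1: "bij_betw \<sigma> C C'"
    using f by (rule bij_betw_cong[THEN iffD1, rotated]) (simp add: \<sigma>_def)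
  have 2: "bij_betw \<sigma> (V - C) (V - C')"
    using g by (rule bij_betw_cong[THEN iffD1, rotated]) (simp add: \<sigma>_def)
  have "bij_betw \<sigma> (C \<union> (V - C)) (C' \<union> (V - C'))"
    by (rule bij_betw_combine[OF 1 2]) auto
  then have "bij_betw \<sigma> V V" using assms by (simp add: Un_absorb1)
  then have "\<sigma> permutes V"
    using assms(2) by (intro bij_imp_permutes) (auto simp: \<sigma>_def)
  with 1 show ?thesis by (auto simp: bij_betw_def)
qed

lemma permutes_image_in:
  assumes "\<pi> permutes V" "B \<subseteq> V"
  shows "\<pi> ` B \<subseteq> V" "card (\<pi> ` B) = card B"
  using image_mono[OF assms(2), of \<pi>] permutes_image[OF assms(1)]
  by (simp_all add: card_image inj_on_subset[OF permutes_inj[OF assms(1)] subset_UNIV])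

text \<open>The permutations split into classes by the image of \<open>B\<close>. Composition with a
  permutation that carries one image to another embeds one class into the other, so all classes have
  equal size.\<close>

lemma card_permutes_image:
  assumes "finite V" "B \<subseteq> V" "C \<subseteq> V" "card B = card C"
  shows "card {\<pi>. \<pi> permutes V \<and> \<pi> ` B = C} * (card V choose card B) = fact (card V)"
proof -
  define n where "n C = card {\<pi>. \<pi> permutes V \<and> \<pi> ` B = C}" for C
  have finP: "finite {\<pi>. \<pi> permutes V}" using assms(1) by (rule finite_permutations)
  have le: "n C1 \<le> n C2" if C12: "C1 \<subseteq> V" "C2 \<subseteq> V" "card C1 = card C2" for C1 C2
  proof -
    obtain \<sigma> where \<sigma>: "\<sigma> permutes V" "\<sigma> ` C1 = C2"
      using ex_permutes_image[OF assms(1) C12] by blast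
    have "inj_on ((\<circ>) \<sigma>) {\<pi>. \<pi> permutes V \<and> \<pi> ` B = C1}"
      using inj_on_subset[OF fun.inj_map[OF permutes_inj[OF \<sigma>(1)]] subset_UNIV] .
    moreover have "((\<circ>) \<sigma>) ` {\<pi>. \<pi> permutes V \<and> \<pi> ` B = C1} \<subseteq> {\<pi>. \<pi> permutes V \<and> \<pi> ` B = C2}"
    proof (clarify, intro conjI)
      fix \<pi> assume "\<pi> permutes V" "C1 = \<pi> ` B"
      then show "\<sigma> \<circ> \<pi> permutes V" "(\<sigma> \<circ> \<pi>) ` B = C2"
        using \<sigma> permutes_compose by (auto simp: image_comp[symmetric])
    qed
    moreover have "finite {\<pi>. \<pi> permutes V \<and> \<pi> ` B = C2}"
      by (rule finite_subset[OF _ finP]) auto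
    ultimately show ?thesis
      unfolding n_def by (rule card_inj_on_le)
  qed
  define S where "S = {C'. C' \<subseteq> V \<and> card C' = card B}"
  have "fact (card V) = card {\<pi>. \<pi> permutes V}"
    using card_permutations[OF refl assms(1)] by simp
  also have "{\<pi>. \<pi> permutes V} = (\<Union>C'\<in>S. {\<pi>. \<pi> permutes V \<and> \<pi> ` B = C'})"
  proof (intro equalityI subsetI)
    fix \<pi> assume "\<pi> \<in> {\<pi>. \<pi> permutes V}"
    then have "\<pi> permutes V" "\<pi> ` B \<in> S"
      using permutes_image_in[OF _ assms(2)] by (simp_all add: S_def)
    then show "\<pi> \<in> (\<Union>C'\<in>S. {\<pi>. \<pi> permutes V \<and> \<pi> ` B = C'})"
      by (intro UN_I[of "\<pi> ` B"]) simp_all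
  qed simp
  also have "card \<dots> = (\<Sum>C'\<in>S. n C')"
    unfolding n_def
    by (intro card_UN_disjoint) (auto simp: S_def assms(1) intro: finite_subset[OF _ finP])
  also have "\<dots> = (\<Sum>C'\<in>S. n C)"
    using assms by (intro sum.cong refl antisym le) (auto simp: S_def)
  also have "\<dots> = (card V choose card B) * n C"
    using n_subsets[OF assms(1)] by (simp add: S_def)
  finally show ?thesis by (simp add: n_def mult.commute)
qed

text \<open>A k-set is sent to every k-set equally often. The randomness of the matching enters the
  lower bound through this division by a binomial.\<close>

lemma sum_permutes_image:
  fixes h :: "'a set \<Rightarrow> 'a set \<Rightarrow> real"
  assumes "finite V"
  shows "(\<Sum>\<pi>\<in>{\<pi>. \<pi> permutes V}. \<Sum>B\<in>{B. B \<subseteq> V \<and> card B = k}. h B (\<pi> ` B)) / fact (card V)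
     = (\<Sum>B\<in>{B. B \<subseteq> V \<and> card B = k}. \<Sum>C\<in>{C. C \<subseteq> V \<and> card C = k}. h B C) / (card V choose k)"
proof -
  define P where "P = {\<pi>. \<pi> permutes V}"
  define S where "S = {B. B \<subseteq> V \<and> card B = k}"
  have fin: "finite P" "finite S"
    using assms by (auto simp: P_def S_def finite_permutations)
  have "(\<Sum>\<pi>\<in>P. h B (\<pi> ` B)) = (\<Sum>C\<in>S. h B C * (fact (card V) / (card V choose k)))"
    if B: "B \<in> S" for B
  proof -
    have im: "\<pi> ` B \<in> S" if "\<pi> \<in> P" for \<pi>
      using B that permutes_image_in[of \<pi> V B] by (auto simp: S_def P_def)
    have "(\<Sum>\<pi>\<in>P. h B (\<pi> ` B)) = (\<Sum>C\<in>S. \<Sum>\<pi>\<in>{\<pi>\<in>P. \<pi> ` B = C}. h B (\<pi> ` B))"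
      by (rule sum.group[symmetric]) (use fin im in auto)
    also have "\<dots> = (\<Sum>C\<in>S. h B C * card {\<pi>\<in>P. \<pi> ` B = C})"
      by (intro sum.cong refl) simp
    also have "\<dots> = (\<Sum>C\<in>S. h B C * (fact (card V) / (card V choose k)))"
    proof (intro sum.cong refl)
      fix C assume C: "C \<in> S"
      have kV: "k \<le> card V" using B card_mono[OF assms] by (auto simp: S_def)
      have "card {\<pi>\<in>P. \<pi> ` B = C} * (card V choose k) = fact (card V)"
        using card_permutes_image[OF assms, of B C] B C by (auto simp: S_def P_def)
      then have "real (card {\<pi>\<in>P. \<pi> ` B = C}) * (card V choose k) = fact (card V)"
        by (metis of_nat_fact of_nat_mult)
      then show "h B C * card {\<pi>\<in>P. \<pi> ` B = C} = h B C * (fact (card V) / (card V choose k))"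
        using kV by (simp add: eq_divide_eq)
    qed
    finally show ?thesis .
  qed
  then have "(\<Sum>B\<in>S. \<Sum>\<pi>\<in>P. h B (\<pi> ` B)) = (\<Sum>B\<in>S. \<Sum>C\<in>S. h B C) * (fact (card V) / (card V choose k))"
    by (simp add: sum_distrib_right del: times_divide_eq_right)
  then show ?thesis
    unfolding P_def[symmetric] S_def[symmetric] by (subst sum.swap) simp
qed

section \<open>Labels of a matching as functions of the hidden set\<close>

definition lift :: "'a set \<Rightarrow> 'a set \<Rightarrow> (bool \<times> 'a) set" where
  "lift B C = Pair False ` B \<union> Pair True ` C"

definition labels :: "'a set \<Rightarrow> (bool \<times> 'a) set \<Rightarrow> ('a \<Rightarrow> 'a) \<Rightarrow> 'a set" where
  "labels V X \<pi> = {x \<in> V. ((False, x) \<in> X) \<noteq> ((True, \<pi> x) \<in> X)}"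

lemma chi_lift:
  assumes "finite B" "finite C"
  shows "chi (lift B C) X = chi B (Pair False -` X) * chi C (Pair True -` X)"
  unfolding lift_def using assms
  by (subst chi_Un) (auto simp: chi_image inj_on_def)

text \<open>A label is the XOR of the bits of \<open>X\<close> at the two ends of its edge, so a
  character of the labels is the character of \<open>X\<close> on all endpoints of the chosen
  edges.\<close>

lemma chi_labels:
  assumes "finite B" "B \<subseteq> V" "inj \<pi>"
  shows "chi B (labels V X \<pi>) = chi (lift B (\<pi> ` B)) X"
proof -
  have "chi (\<pi> ` B) (Pair True -` X) = chi B (\<pi> -` Pair True -` X)"
    using assms(3) by (intro chi_image) (auto simp: inj_on_def)
  then have "chi (lift B (\<pi> ` B)) X = chi B (Pair False -` X) * chi B (\<pi> -` Pair True -` X)"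
    using assms(1) by (simp add: chi_lift)
  also have "\<dots> = chi B (labels V X \<pi>)"
    unfolding chi_def labels_def using assms(2)
    by (subst prod.distrib[symmetric]) (auto intro!: prod.cong)
  finally show ?thesis by simp
qed

lemma card_lift: "finite B \<Longrightarrow> finite C \<Longrightarrow> card (lift B C) = card B + card C"
  unfolding lift_def by (subst card_Un_disjoint) (auto simp: card_image inj_on_def)

lemma lift_subset: "B \<subseteq> V \<Longrightarrow> C \<subseteq> V \<Longrightarrow> lift B C \<subseteq> UNIV \<times> V"
  by (auto simp: lift_def)

lemma lift_full: "lift V V = UNIV \<times> V"
  by (auto simp: lift_def image_iff)

lemma lift_diff: "lift (V - B) (V - C) = (UNIV \<times> V) - lift B C"
  by (auto simp: lift_def image_iff)

lemma inj_lift: "inj_on (\<lambda>(B, C). lift B C) S"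
proof (rule inj_onI, clarify)
  fix B C B' C' :: "'a set"
  assume eq: "lift B C = lift B' C'"
  have "Pair False -` lift B C = B" "Pair True -` lift B C = C" for B C :: "'a set"
    by (auto simp: lift_def)
  then show "B = B' \<and> C = C'" by (metis eq)
qed

text \<open>Subsets of even size, phrased by the character so that on subsets of \<open>V\<close>
  the indicator is \<open>(1 + chi V S) / 2\<close>.\<close>

definition even_sets :: "'a set \<Rightarrow> 'a set set" where
  "even_sets V = {S \<in> Pow V. chi V S = 1}"

text \<open>Replacing the restriction to even sets by the factor 1 + chi V leaves two orthogonality
  relations, with the characters of \<open>{}\<close> and of \<open>V\<close>.\<close>

lemma sum_even_sets:
  assumes "finite V" "B \<subseteq> V"
  shows "2 * (\<Sum>S\<in>even_sets V. chi B S) = (if B = {} then 2 ^ card V else 0) + (if B = V then 2 ^ card V else 0)"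
proof -
  have fin: "finite S" if "S \<in> Pow V" for S
    using that assms finite_subset by auto
  have orth: "(\<Sum>S\<in>Pow V. chi B S * chi C S) = (if B = C then 2 ^ card V else 0)" if "C \<subseteq> V" for C
  proof -
    have "(\<Sum>S\<in>Pow V. chi B S * chi C S) = (\<Sum>S\<in>Pow V. chi S B * chi S C)"
      using fin that assms(2) by (intro sum.cong refl arg_cong2[where f = "(*)"] chi_commute) auto
    then show ?thesis using chi_orthogonal[OF assms that] by simp
  qed
  have "2 * (\<Sum>S\<in>even_sets V. chi B S) = (\<Sum>S\<in>Pow V. chi B S * (1 + chi V S))"
  proof -
    have "(\<Sum>S\<in>Pow V. chi B S * (1 + chi V S)) = (\<Sum>S\<in>even_sets V. chi B S * (1 + chi V S))"
    proof (intro sum.mono_neutral_right ballI)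
      fix S assume "S \<in> Pow V - even_sets V"
      then have "chi V S = -1" using chi_cases[of V S] by (auto simp: even_sets_def)
      then show "chi B S * (1 + chi V S) = 0" by simp
    qed (auto simp: even_sets_def assms(1))
    also have "\<dots> = (\<Sum>S\<in>even_sets V. 2 * chi B S)"
      by (intro sum.cong) (auto simp: even_sets_def)
    finally show ?thesis by (simp add: sum_distrib_left)
  qed
  also have "\<dots> = (\<Sum>S\<in>Pow V. chi B S * chi {} S) + (\<Sum>S\<in>Pow V. chi B S * chi V S)"
    by (simp add: distrib_left sum.distrib)
  finally show ?thesis
    using orth[of "{}"] orth[of V] by simp
qed

lemma card_even_sets:
  assumes "finite V" "V \<noteq> {}"
  shows "2 * real (card (even_sets V)) = 2 ^ card V"
  using sum_even_sets[OF assms(1), of "{}"] assms(2) by auto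

text \<open>Cauchy-Schwarz against the bounded \<open>\<phi>\<close>, then Parseval for the
  difference \<open>u\<close> of the two label distributions. Both have coefficient 1 at
  \<open>{}\<close> and, everything being even, also at \<open>V\<close>. All other coefficients of
  the uniform even labels are 0, so only those coming from \<open>A\<close> remain.\<close>

lemma labels_bias:
  fixes V :: "'a set" and \<phi> :: "'a set \<Rightarrow> real"
  assumes V: "finite V" "V \<noteq> {}" and \<pi>: "\<pi> permutes V"
    and A: "A \<subseteq> even_sets (UNIV \<times> V)" "A \<noteq> {}"
    and \<phi>: "\<And>S. \<bar>\<phi> S\<bar> \<le> 1"
  shows "((\<Sum>X\<in>A. \<phi> (labels V X \<pi>)) / card A - (\<Sum>S\<in>even_sets V. \<phi> S) / card (even_sets V))\<^sup>2
    \<le> (\<Sum>B\<in>Pow V - {{}, V}. (fourier A (lift B (\<pi> ` B)))\<^sup>2)"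
proof -
  define u where "u S = card {X \<in> A. labels V X \<pi> = S} / card A
      - (if S \<in> even_sets V then 1 / card (even_sets V) else 0)" for S
  have finI: "finite (UNIV \<times> V :: (bool \<times> 'a) set)" using V by simp
  have finA: "finite A"
    by (rule finite_subset[OF A(1)]) (use finI in \<open>auto simp: even_sets_def\<close>)
  have cA: "real (card A) > 0" using A finA by (simp add: card_gt_0_iff)
  have cE: "real (card (even_sets V)) > 0" using card_even_sets[OF V] by (metis zero_less_power zero_less_mult_pos zero_less_numeral)
  have sub: "even_sets V \<subseteq> Pow V" by (auto simp: even_sets_def)
  have inj: "inj \<pi>" using \<pi> by (rule permutes_inj)
  have mix: "(\<Sum>S\<in>Pow V. u S * f S)
      = (\<Sum>X\<in>A. f (labels V X \<pi>)) / card A - (\<Sum>S\<in>even_sets V. f S) / card (even_sets V)"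
    for f :: "'a set \<Rightarrow> real"
  proof -
    have "(\<Sum>X\<in>A. f (labels V X \<pi>)) = (\<Sum>S\<in>Pow V. \<Sum>X\<in>{X\<in>A. labels V X \<pi> = S}. f (labels V X \<pi>))"
      by (rule sum.group[symmetric]) (use finA V in \<open>auto simp: labels_def\<close>)
    also have "\<dots> = (\<Sum>S\<in>Pow V. card {X\<in>A. labels V X \<pi> = S} * f S)"
      by (intro sum.cong refl) simp
    finally have 1: "(\<Sum>X\<in>A. f (labels V X \<pi>)) / card A = (\<Sum>S\<in>Pow V. card {X\<in>A. labels V X \<pi> = S} / card A * f S)"
      by (simp add: sum_divide_distrib)
    have "(\<Sum>S\<in>Pow V. (if S \<in> even_sets V then 1 / card (even_sets V) else 0) * f S)
       = (\<Sum>S\<in>even_sets V. (if S \<in> even_sets V then 1 / card (even_sets V) else 0) * f S)"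
      using V sub by (intro sum.mono_neutral_right) auto
    then have 2: "(\<Sum>S\<in>even_sets V. f S) / card (even_sets V)
       = (\<Sum>S\<in>Pow V. (if S \<in> even_sets V then 1 / card (even_sets V) else 0) * f S)"
      by (simp add: sum_divide_distrib)
    show ?thesis
      unfolding 1 2 u_def by (simp add: left_diff_distrib sum_subtractf)
  qed
  have uhat: "(\<Sum>S\<in>Pow V. u S * chi B S) = (if B \<in> {{}, V} then 0 else fourier A (lift B (\<pi> ` B)))"
    if B: "B \<in> Pow V" for B
  proof -
    have "finite B" using B V finite_subset by auto
    then have f: "(\<Sum>X\<in>A. chi B (labels V X \<pi>)) / card A = fourier A (lift B (\<pi> ` B))"
      unfolding fourier_def using B inj by (simp add: chi_labels)
    have "fourier A (lift B (\<pi> ` B)) = 1" if "B \<in> {{}, V}"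
    proof -
      have "chi (lift B (\<pi> ` B)) X = 1" if "X \<in> A" for X
      proof -
        have "lift B (\<pi> ` B) = {} \<or> lift B (\<pi> ` B) = UNIV \<times> V"
          using \<open>B \<in> {{}, V}\<close> permutes_image[OF \<pi>] by (auto simp: lift_full lift_def)
        then show ?thesis
          using that A(1) by (auto simp: even_sets_def)
      qed
      then show ?thesis using cA by (simp add: fourier_def)
    qed
    moreover have "(\<Sum>S\<in>even_sets V. chi B S) = (if B \<in> {{}, V} then card (even_sets V) else 0)"
      using sum_even_sets[OF V(1), of B] card_even_sets[OF V] B V(2)
      by (cases "B = {}"; cases "B = V") simp_all
    ultimately show ?thesis
      unfolding mix f using cE by auto
  qed
  have "(\<Sum>S\<in>Pow V. u S * \<phi> S)\<^sup>2 \<le> (\<Sum>S\<in>Pow V. (u S)\<^sup>2) * (\<Sum>S\<in>Pow V. (\<phi> S)\<^sup>2)"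
    by (rule Cauchy_Schwarz_ineq_sum)
  also have "\<dots> \<le> (\<Sum>S\<in>Pow V. (u S)\<^sup>2) * (\<Sum>S\<in>Pow V. 1)"
    using \<phi> by (intro mult_left_mono sum_mono sum_nonneg) (auto simp: abs_square_le_1)
  also have "\<dots> = (\<Sum>B\<in>Pow V. (\<Sum>S\<in>Pow V. u S * chi B S)\<^sup>2)"
    using V by (simp add: parseval card_Pow)
  also have "\<dots> = (\<Sum>B\<in>Pow V - {{}, V}. (fourier A (lift B (\<pi> ` B)))\<^sup>2)"
    using V by (intro sum.mono_neutral_cong_right) (auto simp: uhat)
  finally show ?thesis unfolding mix .
qed

text \<open>Distinct pairs of k-sets lift to distinct sets of size 2 k, so the sum is a part of
  level 2 k in the level inequality. The parameters \<open>r\<close> and \<open>m\<close> stay free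
  because two different choices are needed.\<close>

lemma matching_level_sum:
  fixes V :: "'a set"
  assumes V: "finite V" and A: "A \<subseteq> Pow (UNIV \<times> V)" "A \<noteq> {}"
    and dens: "2 ^ (2 * card V) \<le> 2 ^ p * real (card A)"
    and m: "1 \<le> m" and r: "r\<^sup>2 * (2 * real m - 1) \<le> 1"
  shows "((r\<^sup>2) ^ (2 * k) * (\<Sum>B\<in>{B. B \<subseteq> V \<and> card B = k}. \<Sum>C\<in>{C. C \<subseteq> V \<and> card C = k}.
      (fourier A (lift B C))\<^sup>2)) ^ m \<le> 2 ^ p"
proof -
  define I :: "(bool \<times> 'a) set" where "I = UNIV \<times> V"
  define S where "S = {B. B \<subseteq> V \<and> card B = k}"
  have fin: "finite I" "finite S" using V by (auto simp: I_def S_def)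
  have cI: "card I = 2 * card V" by (simp add: I_def card_cartesian_product)
  have finB: "finite B" if "B \<in> S" for B
    using that V finite_subset by (auto simp: S_def)
  have "(r\<^sup>2) ^ (2 * k) * (\<Sum>B\<in>S. \<Sum>C\<in>S. (fourier A (lift B C))\<^sup>2)
      = (\<Sum>(B, C)\<in>S \<times> S. (r ^ card (lift B C) * fourier A (lift B C))\<^sup>2)"
    unfolding sum.cartesian_product sum_distrib_left
  proof (intro sum.cong refl, clarify)
    fix B C assume BC: "B \<in> S" "C \<in> S"
    then have "card B = k" "card C = k" by (simp_all add: S_def)
    then have c: "card (lift B C) = 2 * k"
      using finB BC by (simp add: card_lift)
    have "(r\<^sup>2) ^ (2 * k) = (r ^ (2 * k))\<^sup>2"
      by (simp only: power_mult[symmetric] mult.commute)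
    then show "(r\<^sup>2) ^ (2 * k) * (fourier A (lift B C))\<^sup>2 = (r ^ card (lift B C) * fourier A (lift B C))\<^sup>2"
      unfolding c by (simp only: power_mult_distrib)
  qed
  also have "\<dots> = (\<Sum>D\<in>(\<lambda>(B, C). lift B C) ` (S \<times> S). (r ^ card D * fourier A D)\<^sup>2)"
    using inj_lift by (subst sum.reindex) (auto simp: case_prod_unfold)
  also have "\<dots> \<le> (\<Sum>D\<in>Pow I. (r ^ card D * fourier A D)\<^sup>2)"
    using fin lift_subset by (intro sum_mono2) (auto simp: S_def I_def)
  finally have "((r\<^sup>2) ^ (2 * k) * (\<Sum>B\<in>S. \<Sum>C\<in>S. (fourier A (lift B C))\<^sup>2)) ^ m
      \<le> (\<Sum>D\<in>Pow I. (r ^ card D * fourier A D)\<^sup>2) ^ m"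
    by (intro power_mono mult_nonneg_nonneg sum_nonneg) auto
  also have "\<dots> \<le> 2 ^ p"
    using A dens m r by (intro level_inequality fin) (auto simp: I_def[symmetric] cI)
  finally show ?thesis by (simp add: S_def)
qed

lemma sum_half_powers_le: "(\<Sum>k\<in>{K..<n}. (1 / 2 :: real) ^ k) \<le> 2 * (1 / 2) ^ K"
proof (cases "K \<le> n")
  case True
  then have "(\<Sum>k\<in>{K..<n}. (1 / 2 :: real) ^ k) = 2 * (1 / 2) ^ K - 2 * (1 / 2) ^ n"
    by (induction n rule: dec_induct) simp_all
  then show ?thesis by simp
qed simp

text \<open>By Jensen the mean bias is at most the root of the mean squared bias, which is at most
  the sum over levels of \<open>a k\<close>, the Fourier weight divided by the binomial. It has to
  stay below 1 / 9, as 1 / 3 is the gap that a verifier must leave between the two kinds of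
  instances.\<close>

theorem hidden_matching_bound:
  fixes V :: "'a set" and \<phi> :: "('a \<Rightarrow> 'a) \<Rightarrow> 'a set \<Rightarrow> real"
  assumes V: "finite V" and A: "A \<subseteq> even_sets (UNIV \<times> V)"
    and p: "1 \<le> p" and dens: "2 ^ (2 * card V) \<le> 2 ^ p * real (card A)"
    and large: "800 * p\<^sup>2 * (p + 8) \<le> card V"
    and \<phi>: "\<And>\<pi> S. \<bar>\<phi> \<pi> S\<bar> \<le> 1"
  shows "\<bar>(\<Sum>\<pi>\<in>{\<pi>. \<pi> permutes V}. (\<Sum>X\<in>A. \<phi> \<pi> (labels V X \<pi>)) / card A) / fact (card V)
    - (\<Sum>\<pi>\<in>{\<pi>. \<pi> permutes V}. (\<Sum>S\<in>even_sets V. \<phi> \<pi> S) / card (even_sets V)) / fact (card V)\<bar> < 1 / 3"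
proof -
  define N where "N = card V"
  define P where "P = {\<pi>. \<pi> permutes V}"
  define d where "d \<pi> = (\<Sum>X\<in>A. \<phi> \<pi> (labels V X \<pi>)) / card A
      - (\<Sum>S\<in>even_sets V. \<phi> \<pi> S) / card (even_sets V)" for \<pi>
  define W where "W k = (\<Sum>B\<in>{B. B \<subseteq> V \<and> card B = k}. \<Sum>C\<in>{C. C \<subseteq> V \<and> card C = k}.
      (fourier A (lift B C))\<^sup>2)" for k
  define a where "a k = W k / (N choose k)" for k
  define b where "b k = 1 / 50 * (1 / 2) ^ k + (if p + 8 \<le> k then 2 ^ p * (1 / 2) ^ k else 0 :: real)" for k
  have "(0::real) < 2 ^ (2 * card V)" by (rule zero_less_power) simp
  then have "0 < 2 ^ p * real (card A)" using dens by (rule less_le_trans)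
  then have A0: "A \<noteq> {}" by auto
  have AP: "A \<subseteq> Pow (UNIV \<times> V)" using A by (auto simp: even_sets_def)
  have "0 < 800 * p\<^sup>2 * (p + 8)" using p by simp
  then have N0: "0 < N" using large unfolding N_def by (rule less_le_trans)
  then have V0: "V \<noteq> {}" by (auto simp: N_def)
  have finP: "finite P" and cP: "card P = fact N"
    using V finite_permutations card_permutations by (auto simp: P_def N_def)
  have P0: "P \<noteq> {}" using permutes_id[of V] unfolding P_def by blast
  have W0: "0 \<le> W k" for k unfolding W_def by (intro sum_nonneg) auto
  \<comment> \<open>Exponent 1 without noise, which is Parseval.\<close>
  have W1: "W k \<le> 2 ^ p" for k
    using matching_level_sum[OF V AP A0 dens, of 1 1 k] by (simp add: W_def)
  \<comment> \<open>With exponent p the root of the density factor 2 ^ p is just 2; the price is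
    that \<open>r\<close> squared has to be 1 / (2 p - 1).\<close>
  have W2: "W k \<le> 2 * ((2 * real p - 1)\<^sup>2) ^ k" for k
  proof -
    define q where "q = 2 * real p - 1"
    have q: "1 \<le> q" using p by (simp add: q_def)
    define r where "r = 1 / sqrt q"
    have r: "r\<^sup>2 = 1 / q" using q by (simp add: r_def power_divide)
    then have "r\<^sup>2 * (2 * real p - 1) \<le> 1" using q by (simp add: q_def)
    from matching_level_sum[OF V AP A0 dens p this, of k]
    have "((1 / q) ^ (2 * k) * W k) ^ p \<le> 2 ^ p" by (simp add: W_def r)
    then have "(1 / q) ^ (2 * k) * W k \<le> 2"
      using W0[of k] q p by (subst (asm) power_mono_iff) auto
    then have "W k \<le> 2 * q ^ (2 * k)"
      using q by (simp add: power_divide divide_le_eq)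
    then show ?thesis by (simp add: q_def power_mult)
  qed
  \<comment> \<open>From level p + 8 on, \<open>W1\<close> meets a binomial of at least 2 ^ k. Below
    it, \<open>W2\<close> is used, and \<open>large\<close> makes the ratio \<open>e\<close> at most
    1 / 200: the constant 800 is 4 * 200, with the 4 from bounding (2 p - 1) squared by (2 p)
    squared.\<close>
  have half: "a k \<le> b k" if k: "1 \<le> k" "2 * k \<le> N" for k
  proof (cases "p + 8 \<le> k")
    case True
    have "(2::real) ^ k \<le> (real N / real k) ^ k"
      using k by (intro power_mono) (auto simp: le_divide_eq)
    also have "\<dots> \<le> real (N choose k)"
      using k by (intro binomial_ge_n_over_k_pow_k) auto
    finally have "a k \<le> 2 ^ p / 2 ^ k"
      unfolding a_def using W0 W1 by (intro frac_le) auto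
    moreover have "0 \<le> 1 / 50 * (1 / 2 :: real) ^ k" by simp
    ultimately have "a k \<le> 1 / 50 * (1 / 2) ^ k + 2 ^ p / 2 ^ k" by linarith
    then show ?thesis using True by (simp add: b_def power_divide)
  next
    case False
    define e where "e = (2 * real p - 1)\<^sup>2 * real k / real N"
    have "200 * ((2 * real p - 1)\<^sup>2 * real k) \<le> 200 * ((2 * real p)\<^sup>2 * (real p + 8))"
      using False p by (intro mult_left_mono mult_mono power_mono) auto
    also have "\<dots> = real (800 * p\<^sup>2 * (p + 8))" by (simp add: power_mult_distrib)
    also have "\<dots> \<le> real N" using large by (simp only: N_def of_nat_le_iff)
    finally have e: "0 \<le> e" "e \<le> 1 / 200" using N0 by (auto simp: e_def divide_le_eq)
    have pos: "0 < (real N / real k) ^ k" using k N0 by simp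
    have "a k \<le> 2 * ((2 * real p - 1)\<^sup>2) ^ k / (real N / real k) ^ k"
      unfolding a_def using W0 W2 k pos
      by (intro frac_le binomial_ge_n_over_k_pow_k) auto
    also have "\<dots> = 2 * e ^ k"
      using k N0 by (simp add: e_def power_divide power_mult_distrib)
    also have "\<dots> \<le> 2 * (1 / 200 * (1 / 2) ^ (k - 1))"
    proof -
      have "e ^ k = e * e ^ (k - 1)" using k by (simp add: power_eq_if)
      also have "\<dots> \<le> 1 / 200 * (1 / 2) ^ (k - 1)"
        using e by (intro mult_mono power_mono) auto
      finally show ?thesis by simp
    qed
    also have "\<dots> = 1 / 50 * (1 / 2) ^ k"
      using k by (simp add: power_eq_if)
    also have "\<dots> \<le> b k" by (simp add: b_def)
    finally show ?thesis .
  qed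
  \<comment> \<open>Complementing both sets multiplies the character by that of the whole vertex
    set, which is 1 on the even sets of \<open>A\<close>.\<close>
  have sym: "a (N - k) = a k" if k: "k \<le> N" for k
  proof -
    have fin: "finite B" if "B \<subseteq> V" for B using that V finite_subset by auto
    define S where "S k = {B. B \<subseteq> V \<and> card B = k}" for k
    have bij: "bij_betw (\<lambda>B. V - B) (S k) (S (N - k))"
      by (rule bij_betwI[where g = "\<lambda>B. V - B"])
         (use k in \<open>auto simp: S_def N_def card_Diff_subset fin double_diff\<close>)
    have *: "fourier A (lift (V - B) (V - C)) = fourier A (lift B C)" if "B \<in> S k" "C \<in> S k" for B C
    proof -
      have "chi (lift (V - B) (V - C)) X = chi (lift B C) X" if "X \<in> A" for X
      proof -
        have "lift B C \<subseteq> UNIV \<times> V"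
          using \<open>B \<in> S k\<close> \<open>C \<in> S k\<close> by (intro lift_subset) (auto simp: S_def)
        then show ?thesis
          unfolding lift_diff using chi_diff_left[of "UNIV \<times> V" "lift B C" X] V that A
          by (auto simp: even_sets_def)
      qed
      then show ?thesis by (simp add: fourier_def)
    qed
    have "W (N - k) = (\<Sum>B\<in>S (N - k). \<Sum>C\<in>S (N - k). (fourier A (lift B C))\<^sup>2)"
      by (simp add: W_def S_def)
    also have "\<dots> = (\<Sum>B\<in>S k. \<Sum>C\<in>S k. (fourier A (lift (V - B) (V - C)))\<^sup>2)"
      by (simp add: sum.reindex_bij_betw[OF bij, symmetric])
    also have "\<dots> = W k"
      unfolding W_def S_def[symmetric] by (intro sum.cong refl) (simp add: *)
    finally show ?thesis
      using k by (simp add: a_def binomial_symmetric[symmetric])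
  qed
  have b0: "0 \<le> b k" for k by (simp add: b_def)
  have ab: "a k \<le> b k + b (N - k)" if k: "k \<in> {1..<N}" for k
  proof (cases "2 * k \<le> N")
    case True
    then show ?thesis using half[of k] b0[of "N - k"] k by simp
  next
    case False
    then have "a (N - k) \<le> b (N - k)" using k by (intro half) auto
    then show ?thesis using sym[of k] b0[of k] k by simp
  qed
  \<comment> \<open>Geometric series: the first summand of \<open>b\<close> contributes at most 1 /
    50, the far levels at most 2 ^ p * 2 / 2 ^ (p + 8) = 1 / 128. The mirrored levels double the
    total.\<close>
  have "(\<Sum>k\<in>{1..<N}. b k) = 1 / 50 * (\<Sum>k\<in>{1..<N}. (1 / 2) ^ k)
      + 2 ^ p * (\<Sum>k\<in>{1..<N}. if p + 8 \<le> k then (1 / 2) ^ k else 0)"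
    unfolding b_def sum.distrib sum_distrib_left by (simp add: if_distrib cong: if_cong)
  also have "(\<Sum>k\<in>{1..<N}. if p + 8 \<le> k then (1 / 2 :: real) ^ k else 0) = (\<Sum>k\<in>{p + 8..<N}. (1 / 2) ^ k)"
    by (rule sum.mono_neutral_cong_right) auto
  also have "1 / 50 * (\<Sum>k\<in>{1..<N}. (1 / 2) ^ k) + 2 ^ p * (\<Sum>k\<in>{p + 8..<N}. (1 / 2 :: real) ^ k)
      \<le> 1 / 50 * (2 * (1 / 2) ^ 1) + 2 ^ p * (2 * (1 / 2) ^ (p + 8))"
    by (intro add_mono mult_left_mono sum_half_powers_le) auto
  also have "2 ^ p * (2 * (1 / 2 :: real) ^ (p + 8)) = 1 / 128"
    by (simp add: power_add power_divide)
  finally have sb: "(\<Sum>k\<in>{1..<N}. b k) \<le> 1 / 50 + 1 / 128" by simp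
  have rev: "(\<Sum>k\<in>{1..<N}. b (N - k)) = (\<Sum>k\<in>{1..<N}. b k)"
    by (rule sum.reindex_bij_witness[where i = "\<lambda>k. N - k" and j = "\<lambda>k. N - k"]) auto
  have "(\<Sum>k\<in>{1..<N}. a k) \<le> (\<Sum>k\<in>{1..<N}. b k + b (N - k))"
    using ab by (rule sum_mono)
  also have "\<dots> \<le> 2 * (1 / 50 + 1 / 128)"
    unfolding sum.distrib rev using sb by simp
  also have "\<dots> < (1 / 3)\<^sup>2" by (simp add: power2_eq_square)
  finally have sa: "(\<Sum>k\<in>{1..<N}. a k) < (1 / 3)\<^sup>2" .
  have "((\<Sum>\<pi>\<in>P. \<bar>d \<pi>\<bar>) / card P)\<^sup>2 \<le> (\<Sum>\<pi>\<in>P. \<bar>d \<pi>\<bar>\<^sup>2) / card P"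
    using finP P0 by (intro mean_power_le) auto
  also have "\<dots> \<le> (\<Sum>\<pi>\<in>P. \<Sum>B\<in>Pow V - {{}, V}. (fourier A (lift B (\<pi> ` B)))\<^sup>2) / card P"
    unfolding d_def power2_abs
    by (intro divide_right_mono sum_mono labels_bias V V0 A A0 \<phi>) (auto simp: P_def)
  also have "\<dots> = (\<Sum>\<pi>\<in>P. \<Sum>k\<in>{1..<N}. \<Sum>B\<in>{B. B \<subseteq> V \<and> card B = k}. (fourier A (lift B (\<pi> ` B)))\<^sup>2) / card P"
  proof -
    have "(\<Sum>B\<in>Pow V - {{}, V}. f B) = (\<Sum>k\<in>{1..<N}. \<Sum>B\<in>{B. B \<subseteq> V \<and> card B = k}. f B)"
      for f :: "'a set \<Rightarrow> real"
    proof -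
      have c: "card B \<in> {1..<N}" if "B \<in> Pow V - {{}, V}" for B
      proof -
        have "B \<subset> V" "B \<noteq> {}" "finite B" using that V finite_subset by auto
        then show ?thesis using psubset_card_mono[OF V] by (simp add: N_def card_gt_0_iff Suc_le_eq)
      qed
      have "(\<Sum>B\<in>Pow V - {{}, V}. f B) = (\<Sum>k\<in>{1..<N}. \<Sum>B\<in>{B \<in> Pow V - {{}, V}. card B = k}. f B)"
        using V c by (intro sum.group[symmetric] image_subsetI) simp_all
      also have "\<dots> = (\<Sum>k\<in>{1..<N}. \<Sum>B\<in>{B. B \<subseteq> V \<and> card B = k}. f B)"
      proof (intro sum.cong refl )
        fix k assume k: "k \<in> {1..<N}"
        have "{B \<in> Pow V - {{}, V}. card B = k} = {B. B \<subseteq> V \<and> card B = k}"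
          using k by (auto simp: N_def)
        then show "{B \<in> Pow V - {{}, V}. card B = k} = {B. B \<subseteq> V \<and> card B = k}" .
      qed
      finally show ?thesis .
    qed
    then show ?thesis by simp
  qed
  also have "\<dots> = (\<Sum>k\<in>{1..<N}. (\<Sum>\<pi>\<in>P. \<Sum>B\<in>{B. B \<subseteq> V \<and> card B = k}. (fourier A (lift B (\<pi> ` B)))\<^sup>2) / fact N)"
    by (subst sum.swap) (simp add: sum_divide_distrib cP)
  also have "\<dots> = (\<Sum>k\<in>{1..<N}. a k)"
    unfolding a_def W_def N_def P_def by (intro sum.cong refl sum_permutes_image V)
  also have "\<dots> < (1 / 3)\<^sup>2" by (rule sa)
  finally have "(\<Sum>\<pi>\<in>P. \<bar>d \<pi>\<bar>) / card P < 1 / 3"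
    by (rule power_less_imp_less_base) simp
  moreover have "\<bar>(\<Sum>\<pi>\<in>P. d \<pi>) / fact N\<bar> \<le> (\<Sum>\<pi>\<in>P. \<bar>d \<pi>\<bar>) / card P"
    unfolding abs_divide cP by (simp add: divide_right_mono)
  ultimately have "\<bar>(\<Sum>\<pi>\<in>P. d \<pi>) / fact N\<bar> < 1 / 3" by linarith
  then show ?thesis
    by (simp add: d_def P_def N_def sum_subtractf diff_divide_distrib)
qed

section \<open>Quantum circuits\<close>

definition sqnorm :: "nat \<Rightarrow> qstate \<Rightarrow> real" where
  "sqnorm q \<psi> = (\<Sum>b\<in>{b. length b = q}. (cmod (\<psi> b))\<^sup>2)"

lemma finite_bits [simp]: "finite {b :: bool list. length b = q}"
  using finite_lists_length_eq[of "UNIV :: bool set" q] by simp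

lemma card_bits: "card {b :: bool list. length b = q} = 2 ^ q"
  using card_lists_length_eq[of "UNIV :: bool set" q] by simp

lemma length_oracle_perm [simp]: "length (oracle_perm f ins outs b) = length b"
  by (simp add: oracle_perm_def Let_def)

lemma oracle_perm_nth:
  "j < length b \<Longrightarrow> oracle_perm f ins outs b ! j
     = (b ! j \<noteq> (\<exists>k<length outs. outs ! k = j \<and> k < length (f (map ((!) b) ins)) \<and> f (map ((!) b) ins) ! k))"
  by (simp add: oracle_perm_def Let_def)

text \<open>Input and output wires are disjoint, so the second application reads the same query and
  XORs the same answer again.\<close>

lemma oracle_perm_involution:
  assumes "valid_gate q (Orc ins outs)" "length b = q"
  shows "oracle_perm f ins outs (oracle_perm f ins outs b) = b"
proof -
  let ?b = "oracle_perm f ins outs b"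
  have "?b ! i = b ! i" if "i \<in> set ins" for i
  proof -
    have "i < length b" "i \<notin> set outs"
      using assms that by (auto simp: valid_gate_def)
    then show ?thesis by (auto simp: oracle_perm_nth)
  qed
  then have eq: "map ((!) ?b) ins = map ((!) b) ins" by simp
  show ?thesis
    by (intro nth_equalityI) (simp_all only: oracle_perm_nth length_oracle_perm eq, blast)
qed

lemma sum_involution:
  assumes "\<And>b. b \<in> S \<Longrightarrow> g b \<in> S" "\<And>b. b \<in> S \<Longrightarrow> g (g b) = b"
  shows "(\<Sum>b\<in>S. h (g b)) = (\<Sum>b\<in>S. h b)"
  by (rule sum.reindex_bij_witness[where i = g and j = g]) (use assms in auto)

text \<open>Each string is paired with its flip at wire \<open>i\<close>; on a pair the gate is the
  Hadamard matrix and the parallelogram law applies.\<close>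

lemma sqnorm_Hadamard:
  assumes "i < q"
  shows "(\<Sum>b\<in>{b. length b = q}. (cmod ((\<psi> (b[i := False]) + (if b ! i then -1 else 1) * \<psi> (b[i := True]))
            / complex_of_real (sqrt 2)))\<^sup>2) = sqnorm q \<psi>"
proof -
  define fl where "fl b = b[i := \<not> b ! i]" for b :: "bool list"
  define h where "h b = (cmod ((\<psi> (b[i := False]) + (if b ! i then -1 else 1) * \<psi> (b[i := True]))
            / complex_of_real (sqrt 2)))\<^sup>2" for b
  have par: "(cmod ((x + y) / complex_of_real (sqrt 2)))\<^sup>2 + (cmod ((x - y) / complex_of_real (sqrt 2)))\<^sup>2
      = (cmod x)\<^sup>2 + (cmod y)\<^sup>2" for x y
    by (simp add: norm_divide power_divide cmod_power2) (simp add: power2_eq_square field_simps)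
  have pair: "h b + h (fl b) = (cmod (\<psi> b))\<^sup>2 + (cmod (\<psi> (fl b)))\<^sup>2" if "length b = q" for b
  proof (cases "b ! i")
    case True
    then have "b[i := True] = b" by (metis list_update_id)
    then show ?thesis
      using True assms that par[of "\<psi> (b[i := False])" "\<psi> b"] by (simp add: h_def fl_def)
  next
    case False
    then have "b[i := False] = b" by (metis list_update_id)
    then show ?thesis
      using False assms that par[of "\<psi> b" "\<psi> (b[i := True])"] by (simp add: h_def fl_def)
  qed
  have inv: "(\<Sum>b\<in>{b. length b = q}. k (fl b)) = (\<Sum>b\<in>{b. length b = q}. k b)" for k :: "bool list \<Rightarrow> real"
    using assms by (intro sum_involution) (auto simp: fl_def)
  have "2 * (\<Sum>b\<in>{b. length b = q}. h b) = (\<Sum>b\<in>{b. length b = q}. h b + h (fl b))"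
    by (simp add: sum.distrib inv)
  also have "\<dots> = (\<Sum>b\<in>{b. length b = q}. (cmod (\<psi> b))\<^sup>2 + (cmod (\<psi> (fl b)))\<^sup>2)"
    by (intro sum.cong refl pair) simp
  also have "\<dots> = 2 * sqnorm q \<psi>"
    using inv[of "\<lambda>b. (cmod (\<psi> b))\<^sup>2"] by (simp add: sum.distrib sqnorm_def)
  finally show ?thesis by (simp add: h_def)
qed

lemma sqnorm_apply_gate: "sqnorm q (apply_gate f q g \<psi>) = sqnorm q \<psi>"
proof (cases "valid_gate q g")
  case False
  then show ?thesis by (simp add: apply_gate_def)
next
  case True
  show ?thesis
  proof (cases g)
    case (Hg i)
    then show ?thesis
      using True sqnorm_Hadamard[of i q \<psi>] by (simp add: apply_gate_def valid_gate_def sqnorm_def)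
  next
    case (Tg i)
    then show ?thesis
      using True by (auto simp: apply_gate_def sqnorm_def norm_mult intro!: sum.cong)
  next
    case (CNOTg i j)
    have "(\<Sum>b\<in>{b. length b = q}. (cmod (\<psi> (b[j := (b ! j \<noteq> b ! i)])))\<^sup>2) = sqnorm q \<psi>"
      unfolding sqnorm_def
    proof (rule sum_involution)
      fix b :: "bool list" assume "b \<in> {b. length b = q}"
      moreover have "((b ! j \<noteq> b ! i) \<noteq> b ! i) = b ! j" by blast
      ultimately show "b[j := b ! j \<noteq> b ! i, j := b[j := b ! j \<noteq> b ! i] ! j \<noteq> b[j := b ! j \<noteq> b ! i] ! i] = b"
        using True CNOTg by (simp add: valid_gate_def del: not_iff)
    qed simp
    then show ?thesis using True CNOTg by (simp add: apply_gate_def sqnorm_def)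
  next
    case (Orc ins outs)
    have "(\<Sum>b\<in>{b. length b = q}. (cmod (\<psi> (oracle_perm f ins outs b)))\<^sup>2) = sqnorm q \<psi>"
      unfolding sqnorm_def
      by (rule sum_involution) (use True Orc oracle_perm_involution in auto)
    then show ?thesis using True Orc by (simp add: apply_gate_def sqnorm_def)
  qed
qed

lemma sqnorm_run_circuit: "sqnorm q (run_circuit f q gs \<psi>) = sqnorm q \<psi>"
  unfolding run_circuit_def by (induction gs arbitrary: \<psi>) (simp_all add: sqnorm_apply_gate)

lemma acc_prob_nonneg: "0 \<le> acc_prob q \<psi>"
  unfolding acc_prob_def by (intro sum_nonneg) auto

lemma acc_prob_le_sqnorm: "acc_prob q \<psi> \<le> sqnorm q \<psi>"
  unfolding acc_prob_def sqnorm_def by (intro sum_mono2) auto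

text \<open>Only an inequality, because the initial state is 0 when the circuit has fewer than
  \<open>p\<close> wires or \<open>y\<close> does not have length \<open>p\<close>.\<close>

lemma sqnorm_init_basis: "sqnorm q (init_state p q (basis_state y)) \<le> 1"
proof -
  let ?B = "{b. length b = q}" and ?y = "y @ replicate (q - p) False"
  have "(cmod (init_state p q (basis_state y) b))\<^sup>2 \<le> (if b = ?y then 1 else 0)" if "b \<in> ?B" for b
  proof (cases "init_state p q (basis_state y) b = 0")
    case False
    then have b: "length b = q" "p \<le> q" "\<forall>i\<in>{p..<q}. \<not> b ! i" "take p b = y"
      by (auto simp: init_state_def basis_state_def split: if_splits)
    have "drop p b = replicate (q - p) False"
      using b by (intro nth_equalityI) auto
    then have "b = ?y" using b(4) by (metis append_take_drop_id)
    then show ?thesis by (simp add: init_state_def basis_state_def)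
  qed simp
  then have "sqnorm q (init_state p q (basis_state y)) \<le> (\<Sum>b\<in>?B. if b = ?y then 1 else 0)"
    unfolding sqnorm_def by (rule sum_mono)
  also have "\<dots> \<le> 1" by (simp add: sum.delta)
  finally show ?thesis .
qed

lemma acc_prob_basis_le_1: "acc_prob q (run_circuit f q gs (init_state p q (basis_state y))) \<le> 1"
  using acc_prob_le_sqnorm sqnorm_init_basis sqnorm_run_circuit by (metis order_trans)

fun gate_in_length :: "gate \<Rightarrow> nat" where
  "gate_in_length (Orc ins outs) = length ins"
| "gate_in_length _ = 0"

text \<open>A circuit sees the function only on strings as long as the input part of one of its
  oracle gates. Since the random blocks are separated by query length, it depends on finitely many
  of them.\<close>

lemma run_circuit_cong:
  assumes "\<And>u. length u \<le> B \<Longrightarrow> f u = f' u" "\<And>g. g \<in> set gs \<Longrightarrow> gate_in_length g \<le> B"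
  shows "run_circuit f q gs \<psi> = run_circuit f' q gs \<psi>"
proof -
  have "apply_gate f q g = apply_gate f' q g" if "gate_in_length g \<le> B" for g
    using that assms(1) by (cases g) (auto simp: apply_gate_def oracle_perm_def fun_eq_iff)
  then show ?thesis
    unfolding run_circuit_def using assms(2) by (induction gs arbitrary: \<psi>) auto
qed

text \<open>The witness occupies the first \<open>m\<close> wires, the others start at 0. The first
  query writes f(a) next to a, and the second XORs f(f(a)) = a onto the first register and clears
  it, so that the involution f has been applied in place. The Hadamard gates then turn the wanted
  state |->|-> of the side and phase qubits into |1>|1>. The last query has length 2; it takes the
  conjunction of both qubits with the random bit and writes it to the output wire 0.\<close>

definition verifier_gates :: "nat \<Rightarrow> gate list" where
  "verifier_gates m = [Orc [0..<m] [m..<2 * m], Orc [m..<2 * m] [0..<m], Hg m, Hg (Suc m), Orc [m, Suc m] [0]]"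

definition xor :: "bool list \<Rightarrow> bool list \<Rightarrow> bool list" where
  "xor u v = map2 (\<noteq>) u v"

lemma length_xor [simp]: "length (xor u v) = min (length u) (length v)"
  by (simp add: xor_def)

lemma nth_xor: "i < length u \<Longrightarrow> i < length v \<Longrightarrow> xor u v ! i = (u ! i \<noteq> v ! i)"
  by (simp add: xor_def)

lemma map_nth_append1: "length a = m \<Longrightarrow> map ((!) (a @ b)) [0..<m] = a"
  by (intro nth_equalityI) (auto simp: nth_append)

lemma map_nth_append2: "length a = m \<Longrightarrow> length b = m \<Longrightarrow> map ((!) (a @ b)) [m..<2 * m] = b"
  by (intro nth_equalityI) (auto simp: nth_append)

lemma oracle_perm_write_right:
  assumes "length a = m" "length b = m" "length (f a) = m"
  shows "oracle_perm f [0..<m] [m..<2 * m] (a @ b) = a @ xor b (f a)"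
  by (intro nth_equalityI)
     (use assms in \<open>auto simp: oracle_perm_nth map_nth_append1 nth_append nth_xor mult_2\<close>)

lemma oracle_perm_write_left:
  assumes "length a = m" "length b = m" "length (f b) = m"
  shows "oracle_perm f [m..<2 * m] [0..<m] (a @ b) = xor a (f b) @ b"
  by (intro nth_equalityI)
     (use assms in \<open>auto simp: oracle_perm_nth map_nth_append2 nth_append nth_xor\<close>)

lemma xor_eq_zero: "length a = m \<Longrightarrow> length b = m \<Longrightarrow> xor a b = replicate m False \<longleftrightarrow> a = b"
  by (auto simp: list_eq_iff_nth_eq nth_xor)

lemma xor_eq_right: "length a = m \<Longrightarrow> length b = m \<Longrightarrow> xor a b = b \<longleftrightarrow> a = replicate m False"
  by (auto simp: list_eq_iff_nth_eq nth_xor)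

lemma init_state_append:
  assumes "length a = m" "length b = m"
  shows "init_state m (2 * m) w (a @ b) = (if b = replicate m False then w a else 0)"
proof -
  have "(\<forall>i\<in>{m..<2 * m}. \<not> (a @ b) ! i) \<longleftrightarrow> b = replicate m False"
  proof
    assume *: "\<forall>i\<in>{m..<2 * m}. \<not> (a @ b) ! i"
    show "b = replicate m False"
    proof (intro nth_equalityI)
      fix i assume "i < length b"
      then show "b ! i = replicate m False ! i"
        using assms *[rule_format, of "m + i"] by (simp add: nth_append)
    qed (use assms in simp)
  qed (use assms in \<open>auto simp: nth_append\<close>)
  then show ?thesis using assms by (simp add: init_state_def)
qed

text \<open>Twice the amplitude of |->|-> on the first two qubits, with \<open>r\<close> on the
  others, after \<open>f\<close> has been applied in place to \<open>w\<close>.\<close>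

definition flip_amp :: "(bool list \<Rightarrow> bool list) \<Rightarrow> qstate \<Rightarrow> bool list \<Rightarrow> complex" where
  "flip_amp f w r = w (f (False # False # r)) - w (f (False # True # r))
     - w (f (True # False # r)) + w (f (True # True # r))"

lemma verifier_acceptance:
  fixes f :: "bool list \<Rightarrow> bool list"
  assumes m: "2 \<le> m"
    and inv: "\<And>u. length u = m \<Longrightarrow> length (f u) = m" "\<And>u. length u = m \<Longrightarrow> f (f u) = u"
    and coin: "\<And>j k. f [j, k] = [c \<and> j \<and> k]"
  shows "acc_prob (2 * m) (run_circuit f (2 * m) (verifier_gates m) (init_state m (2 * m) w))
    = (if c then (\<Sum>r\<in>{r. length r = m - 2}. (cmod (flip_amp f w r))\<^sup>2 / 4) else 0)"
proof -
  define zero where "zero = replicate m False"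
  have lz: "length zero = m" by (simp add: zero_def)
  let ?q = "2 * m"
  define s1 where "s1 = apply_gate f ?q (Orc [0..<m] [m..<2 * m]) (init_state m ?q w)"
  define s2 where "s2 = apply_gate f ?q (Orc [m..<2 * m] [0..<m]) s1"
  define s3 where "s3 = apply_gate f ?q (Hg m) s2"
  define s4 where "s4 = apply_gate f ?q (Hg (Suc m)) s3"
  define s5 where "s5 = apply_gate f ?q (Orc [m, Suc m] [0]) s4"
  have run: "run_circuit f ?q (verifier_gates m) (init_state m ?q w) = s5"
    by (simp add: run_circuit_def verifier_gates_def s1_def s2_def s3_def s4_def s5_def)
  have valid: "valid_gate ?q (Orc [0..<m] [m..<2 * m])" "valid_gate ?q (Orc [m..<2 * m] [0..<m])"
    by (auto simp: valid_gate_def)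
  have s1: "s1 (a @ b) = (if b = f a then w a else 0)" if "length a = m" "length b = m" for a b
    using that m inv(1)
    by (simp add: s1_def apply_gate_def valid oracle_perm_write_right init_state_append xor_eq_zero)
  have s2: "s2 (a @ b) = (if a = zero then w (f b) else 0)" if ab: "length a = m" "length b = m" for a b
  proof -
    have l: "length (f b) = m" "length (xor a (f b)) = m" using ab inv(1) by auto
    have "s2 (a @ b) = s1 (xor a (f b) @ b)"
      using ab m l by (simp add: s2_def apply_gate_def valid oracle_perm_write_left)
    also have "\<dots> = (if b = f (xor a (f b)) then w (xor a (f b)) else 0)"
      using ab l by (intro s1)
    also have "b = f (xor a (f b)) \<longleftrightarrow> xor a (f b) = f b"
      using inv(2) ab(2) l(2) by metis
    also have "\<dots> \<longleftrightarrow> a = zero" unfolding zero_def using ab(1) l(1) by (rule xor_eq_right)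
    finally show ?thesis
      using xor_eq_right[OF ab(1) l(1)] by (cases "a = zero") (simp_all only: zero_def if_True if_False simp_thms)
  qed
  have s3: "s3 (a @ j # k # r) = (if a = zero then (w (f (False # k # r)) + (if j then -1 else 1) * w (f (True # k # r)))
      / complex_of_real (sqrt 2) else 0)" if "length a = m" "length r = m - 2" for a j k r
    using that m by (auto simp: s3_def apply_gate_def valid_gate_def list_update_append nth_append s2)
  have s4: "s4 (a @ j # k # r) = (if a = zero then
       (w (f (False # False # r)) + (if j then -1 else 1) * w (f (True # False # r))
      + (if k then -1 else 1) * (w (f (False # True # r)) + (if j then -1 else 1) * w (f (True # True # r)))) / 2 else 0)"
    if "length a = m" "length r = m - 2" for a j k r
  proof -
    define e where "e = complex_of_real (sqrt 2)"
    have "e * e = 2" by (simp add: e_def of_real_mult[symmetric] del: of_real_mult)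
    then have d: "(x / e + c * (y / e)) / e = (x + c * y) / 2" for x y c
      by (simp add: add_divide_distrib)
    have "s4 (a @ j # k # r) = (s3 (a @ j # False # r) + (if k then -1 else 1) * s3 (a @ j # True # r)) / e"
      unfolding e_def using that m by (simp add: s4_def apply_gate_def valid_gate_def list_update_append nth_append)
    then show ?thesis
      unfolding s3[OF that] by (cases "a = zero") (simp_all only: e_def[symmetric] d if_True if_False mult_zero_right add_0 div_0 simp_thms)
  qed
  have s5: "s5 (a0 # a @ j # k # r) = s4 ((a0 \<noteq> (c \<and> j \<and> k)) # a @ j # k # r)"
    if "length a = m - 1" "length r = m - 2" for a0 a j k r
  proof -
    have "(a0 # a @ j # k # r) ! m = j" "(a0 # a @ j # k # r) ! Suc m = k"
      using that m by (auto simp: nth_append nth_Cons split: nat.splits)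
    then have "oracle_perm f [m, Suc m] [0] (a0 # a @ j # k # r) = (a0 \<noteq> (c \<and> j \<and> k)) # a @ j # k # r"
      by (intro nth_equalityI) (auto simp: oracle_perm_nth coin nth_Cons split: nat.splits)
    then show ?thesis
      using m by (simp add: s5_def apply_gate_def valid_gate_def)
  qed
  define emb where "emb r = True # replicate (m - 1) False @ True # True # r" for r
  have zero: "zero = False # replicate (m - 1) False"
    using m by (cases m) (auto simp: zero_def)
  have s5': "s5 (True # a @ j # k # r) = (if c \<and> j \<and> k \<and> a = replicate (m - 1) False then flip_amp f w r / 2 else 0)"
    if "length a = m - 1" "length r = m - 2" for a j k r
    using that m s4[of "(\<not> (c \<and> j \<and> k)) # a" r j k] s5[of a r True j k]
    by (auto simp: zero flip_amp_def)
  \<comment> \<open>Before the last query the first register is 0, so wire 0 can only have been set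
    by \<open>c\<close>, \<open>j\<close> and \<open>k\<close> being true together. The strings
    \<open>emb r\<close> are the ones that remain.\<close>
  have "acc_prob ?q s5 = (\<Sum>b\<in>emb ` {r. length r = m - 2}. (cmod (s5 b))\<^sup>2)"
    unfolding acc_prob_def
  proof (rule sum.mono_neutral_right)
    show "finite {b. length b = ?q \<and> b \<noteq> [] \<and> hd b}"
      by (rule finite_subset[OF _ finite_bits[of ?q]]) auto
    show "emb ` {r. length r = m - 2} \<subseteq> {b. length b = ?q \<and> b \<noteq> [] \<and> hd b}"
      using m by (auto simp: emb_def)
    show "\<forall>b\<in>{b. length b = ?q \<and> b \<noteq> [] \<and> hd b} - emb ` {r. length r = m - 2}. (cmod (s5 b))\<^sup>2 = 0"
    proof
      fix b assume b: "b \<in> {b. length b = ?q \<and> b \<noteq> [] \<and> hd b} - emb ` {r. length r = m - 2}"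
      define a where "a = take (m - 1) (tl b)"
      define d where "d = drop m b"
      have "length d = m" using b by (simp add: d_def)
      then obtain j k r where d: "d = j # k # r" "length r = m - 2"
        using m by (cases d; cases "tl d") auto
      have la: "length a = m - 1" using b m by (simp add: a_def)
      have "b = True # tl b" using b by (cases b) auto
      moreover have "tl b = a @ d"
      proof -
        have "drop m b = drop (m - 1) (tl b)" using m by (cases m) (auto simp: drop_Suc)
        then show ?thesis by (simp add: a_def d_def)
      qed
      ultimately have eq: "b = True # a @ j # k # r" using d by simp
      moreover have "b \<noteq> emb r" using b d by auto
      ultimately have "\<not> (j \<and> k \<and> a = replicate (m - 1) False)" by (auto simp: emb_def)
      then show "(cmod (s5 b))\<^sup>2 = 0" unfolding eq using s5'[OF la d(2)] by auto
    qed
  qed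
  also have "\<dots> = (\<Sum>r\<in>{r. length r = m - 2}. (cmod (s5 (emb r)))\<^sup>2)"
    by (subst sum.reindex) (auto simp: inj_on_def emb_def)
  also have "\<dots> = (if c then (\<Sum>r\<in>{r. length r = m - 2}. (cmod (flip_amp f w r))\<^sup>2 / 4) else 0)"
    by (auto simp: emb_def s5' norm_divide power_divide)
  finally show ?thesis by (simp add: run)
qed

section \<open>The random blocks\<close>

definition bits :: "nat \<Rightarrow> bool list set" where
  "bits n = {z. length z = n}"

lemma finite_bits' [simp]: "finite (bits n)"
  by (simp add: bits_def)

lemma card_bits' [simp]: "card (bits n) = 2 ^ n"
  by (simp add: bits_def card_bits)

text \<open>A query string is \<open>j # k # t # z\<close>: side of the matching, phase qubit, direction tag, vertex.
  With tag \<open>True\<close> the vertex on side \<open>j\<close> is replaced by its partner index and vice versa, and the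
  label of a matching edge toggles \<open>k\<close> on side \<open>j = True\<close>; a phase qubit in the state
  \<open>|0> - |1>\<close> turns this into the sign of the edge.\<close>

fun block :: "(bool list \<Rightarrow> bool list) \<Rightarrow> bool list set \<Rightarrow> bool list \<Rightarrow> bool list" where
  "block \<pi> S (j # k # t # z) =
     (if t then j # (k \<noteq> (j \<and> z \<in> S)) # False # (if j then \<pi> z else z)
      else let x = (if j then inv \<pi> z else z) in j # (k \<noteq> (j \<and> x \<in> S)) # True # x)"
| "block \<pi> S u = u"

text \<open>Every application flips the tag, so the rule for the other tag undoes the move. The
  label is looked up under the same edge index both times, so the two toggles of the phase qubit
  cancel.\<close>

lemma block_properties:
  assumes "\<pi> permutes bits n" "length u = n + 3"
  shows "length (block \<pi> S u) = n + 3" "block \<pi> S (block \<pi> S u) = u"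
proof -
  obtain j k t z where u: "u = j # k # t # z" "length z = n"
    using assms(2) by (auto simp: length_Suc_conv numeral_3_eq_3)
  have "\<pi> z \<in> bits n" "inv \<pi> z \<in> bits n"
    using permutes_in_image[OF assms(1)] permutes_in_image[OF permutes_inv[OF assms(1)]] u by (auto simp: bits_def)
  then show "length (block \<pi> S u) = n + 3" "block \<pi> S (block \<pi> S u) = u"
    using permutes_inverses[OF assms(1)] u by (auto simp: bits_def Let_def)
qed

lemma bits_Suc: "bits (Suc n) = (#) False ` bits n \<union> (#) True ` bits n"
  unfolding bits_def by (auto simp: length_Suc_conv image_iff)

lemma sum_bits_Suc:
  fixes g :: "bool list \<Rightarrow> real"
  shows "(\<Sum>u\<in>bits (Suc n). g u) = (\<Sum>r\<in>bits n. g (False # r) + g (True # r))"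
  unfolding bits_Suc by (subst sum.union_disjoint) (auto simp: sum.reindex sum.distrib inj_on_def)

text \<open>The acceptance probability of the verifier once the random bit is 1.\<close>

definition acceptance :: "nat \<Rightarrow> (bool list \<Rightarrow> bool list) \<Rightarrow> qstate \<Rightarrow> real" where
  "acceptance m f w = (\<Sum>r\<in>bits (m - 2). (cmod (flip_amp f w r))\<^sup>2 / 4)"

lemma parallelogram: "(cmod (x - y))\<^sup>2 + (cmod (x + y))\<^sup>2 = 2 * (cmod x)\<^sup>2 + 2 * (cmod y)\<^sup>2"
  by (simp add: cmod_power2) (simp add: power2_eq_square algebra_simps)

text \<open>Complementing the labels toggles the phase qubit once more on side \<open>True\<close>,
  which changes the sign of the contribution \<open>y\<close> of that side. The amplitudes x - y and
  x + y share their total weight by the parallelogram law.\<close>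

lemma acceptance_complement:
  assumes \<pi>: "\<pi> permutes bits n"
  shows "acceptance (n + 3) (block \<pi> S) w + acceptance (n + 3) (block \<pi> (bits n - S)) w \<le> sqnorm (n + 3) w"
proof -
  let ?f = "block \<pi> S" and ?f' = "block \<pi> (bits n - S)"
  have b: "(cmod (flip_amp ?f w r))\<^sup>2 / 4 + (cmod (flip_amp ?f' w r))\<^sup>2 / 4
      \<le> (cmod (w (?f (False # False # r))))\<^sup>2 + (cmod (w (?f (False # True # r))))\<^sup>2
        + ((cmod (w (?f (True # False # r))))\<^sup>2 + (cmod (w (?f (True # True # r))))\<^sup>2)"
    if r: "r \<in> bits (Suc n)" for r
  proof -
    obtain t z where rz: "r = t # z" "length z = n"
      using r by (auto simp: bits_def length_Suc_conv)
    have z: "z \<in> bits n" "inv \<pi> z \<in> bits n"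
      using permutes_in_image[OF permutes_inv[OF \<pi>]] rz by (auto simp: bits_def)
    have f': "?f' (False # k # r) = ?f (False # k # r)" "?f' (True # k # r) = ?f (True # (\<not> k) # r)" for k
      using z rz by (auto simp: Let_def)
    define x where "x = w (?f (False # False # r)) - w (?f (False # True # r))"
    define y where "y = w (?f (True # False # r)) - w (?f (True # True # r))"
    have amp: "flip_amp ?f w r = x - y" "flip_amp ?f' w r = x + y"
      by (simp_all add: flip_amp_def f' x_def y_def)
    have d: "(cmod (p - q))\<^sup>2 \<le> 2 * (cmod p)\<^sup>2 + 2 * (cmod q)\<^sup>2" for p q
      using parallelogram[of p q] zero_le_power2[of "cmod (p + q)"] by linarith
    show ?thesis
      unfolding amp using parallelogram[of x y]
        d[of "w (?f (False # False # r))" "w (?f (False # True # r))"]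
        d[of "w (?f (True # False # r))" "w (?f (True # True # r))"]
      by (simp add: x_def[symmetric] y_def[symmetric])
  qed
  have "acceptance (n + 3) ?f w + acceptance (n + 3) ?f' w
      = (\<Sum>r\<in>bits (Suc n). (cmod (flip_amp ?f w r))\<^sup>2 / 4 + (cmod (flip_amp ?f' w r))\<^sup>2 / 4)"
    by (simp add: acceptance_def sum.distrib)
  also have "\<dots> \<le> (\<Sum>r\<in>bits (Suc n). (cmod (w (?f (False # False # r))))\<^sup>2 + (cmod (w (?f (False # True # r))))\<^sup>2
        + ((cmod (w (?f (True # False # r))))\<^sup>2 + (cmod (w (?f (True # True # r))))\<^sup>2))"
    by (intro sum_mono b)
  also have "\<dots> = (\<Sum>u\<in>bits (n + 3). (cmod (w (?f u)))\<^sup>2)"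
    by (simp add: numeral_3_eq_3 sum_bits_Suc[of _ "Suc (Suc n)"] sum_bits_Suc[of _ "Suc n"] sum.distrib)
  also have "\<dots> = (\<Sum>u\<in>bits (n + 3). (cmod (w u))\<^sup>2)"
    using block_properties[OF \<pi>] by (intro sum_involution[where h = "\<lambda>u. (cmod (w u))\<^sup>2"]) (auto simp: bits_def)
  finally show ?thesis by (simp add: sqnorm_def bits_def)
qed

text \<open>The number of edges must be even. For n = 0 there is one edge and complementing changes
  the parity, which is why the empty input is kept out of the language.\<close>

lemma even_sets_complement:
  assumes "n \<ge> 1" "S \<in> even_sets (bits n)"
  shows "bits n - S \<in> even_sets (bits n)"
  using assms chi_diff_right[of "bits n" "bits n" S] by (auto simp: even_sets_def)

lemma finite_even_sets [simp]: "finite V \<Longrightarrow> finite (even_sets V)"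
  by (rule finite_subset[of _ "Pow V"]) (auto simp: even_sets_def)

lemma acceptance_random_labels:
  assumes \<pi>: "\<pi> permutes bits n" and n: "1 \<le> n" and w: "sqnorm (n + 3) w = 1"
  shows "2 * (\<Sum>S\<in>even_sets (bits n). acceptance (n + 3) (block \<pi> S) w) \<le> card (even_sets (bits n))"
proof -
  let ?E = "even_sets (bits n)"
  have "(\<Sum>S\<in>?E. acceptance (n + 3) (block \<pi> (bits n - S)) w) = (\<Sum>S\<in>?E. acceptance (n + 3) (block \<pi> S) w)"
    by (rule sum.reindex_bij_witness[where i = "\<lambda>S. bits n - S" and j = "\<lambda>S. bits n - S"])
       (use even_sets_complement[OF n] in \<open>auto simp: even_sets_def double_diff\<close>)
  then have "2 * (\<Sum>S\<in>?E. acceptance (n + 3) (block \<pi> S) w)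
      = (\<Sum>S\<in>?E. acceptance (n + 3) (block \<pi> S) w + acceptance (n + 3) (block \<pi> (bits n - S)) w)"
    by (simp add: sum.distrib)
  also have "\<dots> \<le> (\<Sum>S\<in>?E. sqnorm (n + 3) w)"
    by (intro sum_mono acceptance_complement[OF \<pi>])
  finally show ?thesis by (simp add: w)
qed

definition sg :: "bool \<Rightarrow> real" where
  "sg b = (if b then -1 else 1)"

text \<open>The signs of \<open>j\<close> and \<open>k\<close> prepare |->|-> on the side and phase
  qubits; tag \<open>False\<close> means that \<open>z\<close> is the name of a vertex, not the
  index of an edge. The support has 4 * 2 ^ n strings of equal weight.\<close>

fun witness :: "nat \<Rightarrow> (bool \<times> bool list) set \<Rightarrow> qstate" where
  "witness n X (j # k # t # z) = (if \<not> t \<and> length z = n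
     then complex_of_real (sg j * sg k * sg ((j, z) \<in> X) / (2 * sqrt (2 ^ n))) else 0)"
| "witness n X u = 0"

lemma sg_square [simp]: "(sg b)\<^sup>2 = 1"
  by (simp add: sg_def)

lemma witness_qstate: "is_qstate (n + 3) (witness n X)"
proof -
  have "witness n X u = 0" if "length u \<noteq> n + 3" for u
    using that by (cases "(n, X, u)" rule: witness.cases) auto
  moreover have "(\<Sum>u\<in>bits (n + 3). (cmod (witness n X u))\<^sup>2) = 1"
  proof -
    have "(\<Sum>u\<in>bits (n + 3). (cmod (witness n X u))\<^sup>2) = (\<Sum>z\<in>bits n. 1 / 2 ^ n)"
      unfolding numeral_3_eq_3 add_Suc_right add_0_right sum_bits_Suc
      sum_bits_Suc[of _ "Suc (Suc n)"] sum_bits_Suc[of _ "Suc n"] sum_bits_Suc[of _ n]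
      by (intro sum.cong refl) (simp add: bits_def norm_divide norm_mult power_divide power_mult_distrib del: of_real_divide of_real_mult)
    then show ?thesis by simp
  qed
  ultimately show ?thesis by (simp add: is_qstate_def bits_def)
qed

text \<open>At an edge index the label cancels the relative sign of the two endpoints, so the four
  terms of the amplitude are equal. Under the other tag all four terms are 0.\<close>

lemma acceptance_witness:
  assumes \<pi>: "\<pi> permutes bits n"
  shows "acceptance (n + 3) (block \<pi> (labels (bits n) X \<pi>)) (witness n X) = 1"
proof -
  let ?f = "block \<pi> (labels (bits n) X \<pi>)"
  have 0: "(cmod (flip_amp ?f (witness n X) (False # z)))\<^sup>2 / 4 = 0" for z
    by (simp add: flip_amp_def Let_def)
  have 1: "(cmod (flip_amp ?f (witness n X) (True # z)))\<^sup>2 / 4 = 1 / 2 ^ n" if z: "z \<in> bits n" for z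
  proof -
    have len: "length z = n" "length (\<pi> z) = n"
      using z permutes_in_image[OF \<pi>] by (auto simp: bits_def)
    define e where "e = sg ((False, z) \<in> X) / (2 * sqrt (2 ^ n))"
    have "z \<in> labels (bits n) X \<pi> \<longleftrightarrow> ((False, z) \<in> X) \<noteq> ((True, \<pi> z) \<in> X)"
      using z by (simp add: labels_def)
    then have "flip_amp ?f (witness n X) (True # z) = complex_of_real (4 * e)"
      using len by (auto simp: flip_amp_def e_def sg_def)
    then have "(cmod (flip_amp ?f (witness n X) (True # z)))\<^sup>2 = (4 * e)\<^sup>2"
      by (simp only: norm_of_real power2_abs)
    also have "\<dots> = 4 / 2 ^ n"
      by (simp add: e_def power_mult_distrib power_divide)
    finally show ?thesis by simp
  qed
  have "acceptance (n + 3) ?f (witness n X) = (\<Sum>r\<in>bits (Suc n). (cmod (flip_amp ?f (witness n X) r))\<^sup>2 / 4)"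
    by (simp add: acceptance_def)
  also have "\<dots> = (\<Sum>z\<in>bits n. 1 / 2 ^ n)"
    unfolding sum_bits_Suc by (intro sum.cong refl) (simp only: 0 1 add_0)
  finally show ?thesis by simp
qed

section \<open>A Turing machine printing the verifier\<close>

definition reach :: "tm \<Rightarrow> nat \<Rightarrow> config \<Rightarrow> config \<Rightarrow> bool" where
  "reach M t x y \<longleftrightarrow> (\<exists>k\<le>t. (tm_step M ^^ k) x = y)"

lemma reach_refl: "reach M t x x"
  unfolding reach_def by (rule exI[of _ 0]) simp

lemma reach_step: "tm_step M x = y \<Longrightarrow> reach M 1 x y"
  unfolding reach_def by (rule exI[of _ 1]) simp

lemma reach_trans [trans]: "reach M s x y \<Longrightarrow> reach M t y z \<Longrightarrow> reach M (s + t) x z"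
  unfolding reach_def
proof clarify
  fix j k assume "j \<le> s" "k \<le> t"
  then show "\<exists>i\<le>s + t. (tm_step M ^^ i) x = (tm_step M ^^ k) ((tm_step M ^^ j) x)"
    by (intro exI[of _ "k + j"]) (simp add: funpow_add)
qed

lemma reach_mono: "reach M s x y \<Longrightarrow> s \<le> t \<Longrightarrow> reach M t x y"
  unfolding reach_def using order_trans by blast

lemma reach_halt:
  assumes "reach M t x (1, l, r)"
  shows "(tm_step M ^^ t) x = (1, l, r)"
proof -
  obtain k where k: "k \<le> t" "(tm_step M ^^ k) x = (1, l, r)"
    using assms by (auto simp: reach_def)
  have "(tm_step M ^^ j) (1, l, r) = (1, l, r)" for j
    by (induction j) (simp_all add: tm_step_def)
  then have "(tm_step M ^^ ((t - k) + k)) x = (1, l, r)"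
    by (simp only: funpow_add o_apply k(2))
  then show ?thesis using k(1) by simp
qed

lemma tape_head_Cons [simp]: "tape_head (a # r) = a"
  by (simp add: tape_head_def)

lemma step_Rgt:
  "tm_trans M s (tape_head r) = (s', w, Rgt) \<Longrightarrow> s \<noteq> 1 \<Longrightarrow> tm_step M (s, l, r) = (s', w # l, tl r)"
  by (simp add: tm_step_def)

lemma step_Stay:
  "tm_trans M s (tape_head r) = (s', w, Stay) \<Longrightarrow> s \<noteq> 1 \<Longrightarrow> tm_step M (s, l, r) = (s', l, w # tl r)"
  by (simp add: tm_step_def)

lemma step_Lft:
  "tm_trans M s (tape_head r) = (s', w, Lft) \<Longrightarrow> s \<noteq> 1 \<Longrightarrow> tm_step M (s, a # l, r) = (s', l, a # w # tl r)"
  by (simp add: tm_step_def)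

lemma scan_right:
  assumes "s \<noteq> 1" "\<And>a. a \<in> set w \<Longrightarrow> tm_trans M s a = (s, g a, Rgt)"
  shows "reach M (length w) (s, l, w @ r) (s, rev (map g w) @ l, r)"
  using assms(2)
proof (induction w arbitrary: l)
  case Nil
  then show ?case by (simp add: reach_refl)
next
  case (Cons a w)
  have "reach M 1 (s, l, (a # w) @ r) (s, g a # l, w @ r)"
    using Cons(2)[of a] assms(1) by (intro reach_step) (simp add: step_Rgt)
  also have "reach M (length w) \<dots> (s, rev (map g w) @ g a # l, r)"
    using Cons by simp
  finally show ?case by simp
qed

lemma scan_left:
  assumes "s \<noteq> 1" "\<And>a. a \<in> set (y # w) \<Longrightarrow> tm_trans M s a = (s, a, Lft)"
  shows "reach M (Suc (length w)) (s, w @ z # l, y # r) (s, l, z # rev w @ y # r)"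
  using assms(2)
proof (induction w arbitrary: y r)
  case Nil
  have "reach M 1 (s, [] @ z # l, y # r) (s, l, z # rev [] @ y # r)"
    using Nil assms(1) by (intro reach_step) (simp add: step_Lft)
  then show ?case by simp
next
  case (Cons a w)
  have "reach M 1 (s, (a # w) @ z # l, y # r) (s, w @ z # l, a # y # r)"
    using Cons(2)[of y] assms(1) by (intro reach_step) (simp add: step_Lft)
  also have "reach M (Suc (length w)) \<dots> (s, l, z # rev w @ a # y # r)"
    using Cons by simp
  finally show ?case by simp
qed

lemma step_scan_left:
  assumes "s \<noteq> 1" "s' \<noteq> 1" "tm_trans M s (tape_head r) = (s', x, Lft)"
    "\<And>a. a \<in> set w \<Longrightarrow> tm_trans M s' a = (s', a, Lft)"
  shows "reach M (Suc (length w)) (s, w @ z # l, r) (s', l, z # rev w @ x # tl r)"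
proof (cases w)
  case Nil
  have "reach M 1 (s, z # l, r) (s', l, z # x # tl r)"
    using assms by (intro reach_step) (simp add: step_Lft)
  then show ?thesis using Nil by simp
next
  case (Cons y v)
  have "reach M 1 (s, y # v @ z # l, r) (s', v @ z # l, y # x # tl r)"
    using assms by (intro reach_step) (simp add: step_Lft)
  also have "reach M (Suc (length v)) \<dots> (s', l, z # rev v @ y # x # tl r)"
    using assms Cons by (intro scan_left) auto
  finally show ?thesis using Cons by simp
qed

section \<open>A small instruction set compiled to transitions\<close>

datatype instr = Write sym | Dup | Loop nat | Jump nat | Finish

text \<open>Sixteen states are reserved per instruction, of which at most eight are used. The shift
  by one instruction keeps 0, 1 and 2 for starting, halting and converting the input.\<close>

definition st :: "nat \<Rightarrow> nat \<Rightarrow> nat" where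
  "st pc k = 16 * (pc + 1) + k"

lemma st_neq [simp]: "st pc k \<noteq> Suc 0" "st pc k \<noteq> 0" "st pc k \<noteq> 2"
  by (simp_all add: st_def)

text \<open>The tape holds a blank, a block of counter cells (\<open>Zero\<close> unmarked, \<open>One\<close> marked), a
  separating blank and the output written so far; between instructions the head is on the first
  blank after the output.  \<open>Loop t\<close> marks the rightmost unmarked counter cell, or unmarks all of
  them and jumps to \<open>t\<close>; \<open>Dup\<close> appends the successor of the last unary number of the output.\<close>

fun instr_trans :: "nat \<Rightarrow> instr \<Rightarrow> nat \<Rightarrow> sym \<Rightarrow> nat \<times> sym \<times> dir" where
  "instr_trans pc (Write s) k a = (st (Suc pc) 0, s, Rgt)"
| "instr_trans pc (Jump t) k a = (st t 0, Blk, Stay)"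
| "instr_trans pc Finish k a =
     (if k = 0 then (st pc 1, Blk, Lft)
      else if a = Blk then (1, Blk, Rgt) else (st pc 1, a, Lft))"
| "instr_trans pc (Loop t) k a =
     (if k = 0 then (st pc 1, Blk, Lft)
      else if k = 1 then (if a = Blk then (st pc 2, Blk, Lft) else (st pc 1, a, Lft))
      else if k = 2 then (case a of One \<Rightarrow> (st pc 2, One, Lft) | Zero \<Rightarrow> (st pc 3, One, Rgt) | Blk \<Rightarrow> (st pc 5, Blk, Rgt))
      else if k = 3 then (if a = Blk then (st pc 4, Blk, Rgt) else (st pc 3, a, Rgt))
      else if k = 4 then (if a = Blk then (st (Suc pc) 0, Blk, Stay) else (st pc 4, a, Rgt))
      else if k = 5 then (if a = Blk then (st pc 6, Blk, Rgt) else (st pc 5, Zero, Rgt))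
      else (if a = Blk then (st t 0, Blk, Stay) else (st pc 6, a, Rgt)))"
| "instr_trans pc Dup k a =
     (if k = 0 then (st pc 1, Blk, Lft)
      else if k = 1 then (st pc 2, a, Lft)
      else if k = 2 then (if a = One then (st pc 2, One, Lft) else (st pc 3, a, Rgt))
      else if k = 3 then (if a = One then (st pc 4, Blk, Rgt) else (st pc 6, a, Rgt))
      else if k = 4 then (if a = Blk then (st pc 5, One, Lft) else (st pc 4, a, Rgt))
      else if k = 5 then (if a = Blk then (st pc 3, One, Rgt) else (st pc 5, a, Lft))
      else if k = 6 then (if a = Blk then (st pc 7, One, Rgt) else (st pc 6, a, Rgt))
      else (st (Suc pc) 0, Zero, Rgt))"

text \<open>The first input cell becomes the blank at the left end, so an input of length n leaves
  only n - 1 counter cells; programs make up for the lost one. The empty input halts at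
  once.\<close>

fun prog_trans :: "instr list \<Rightarrow> nat \<Rightarrow> sym \<Rightarrow> nat \<times> sym \<times> dir" where
  "prog_trans P s a =
     (if s = 0 then (if a = Blk then (1, Blk, Stay) else (2, Blk, Rgt))
      else if s = 2 then (if a = Blk then (st 0 0, Blk, Rgt) else (2, Zero, Rgt))
      else if 16 \<le> s \<and> s div 16 - 1 < length P then instr_trans (s div 16 - 1) (P ! (s div 16 - 1)) (s mod 16) a
      else (1, Blk, Stay))"

definition prog_tm :: "instr list \<Rightarrow> tm" where
  "prog_tm P = TM (16 * (length P + 2)) (prog_trans P)"

lemma prog_trans_st:
  assumes "pc < length P" "k < 16"
  shows "tm_trans (prog_tm P) (st pc k) a = instr_trans pc (P ! pc) k a"
proof -
  have "st pc k div 16 = Suc pc" "st pc k mod 16 = k"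
    using assms(2) by (auto simp: st_def intro!: div_nat_eqI mod_nat_eqI)
  then have "st pc k div 16 - 1 = pc" "st pc k mod 16 = k" "16 \<le> st pc k"
    by (simp_all add: st_def)
  then show ?thesis using assms(1) by (simp add: prog_tm_def)
qed

fun target :: "instr \<Rightarrow> nat" where
  "target (Jump t) = t" | "target (Loop t) = t" | "target _ = 0"

lemma wf_prog_tm:
  assumes "\<And>i. i \<in> set P \<Longrightarrow> target i \<le> length P"
  shows "wf_tm (prog_tm P)"
proof -
  have "fst (instr_trans pc i k a) < 16 * (length P + 2)" if "pc < length P" "target i \<le> length P" for pc i k a
    using that by (cases i; cases a) (auto simp: st_def)
  moreover have "P ! (s div 16 - 1) \<in> set P" if "s div 16 - 1 < length P" for s
    using that by simp
  ultimately show ?thesis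
    using assms by (auto simp: wf_tm_def prog_tm_def st_def)
qed

definition blank :: "sym list \<Rightarrow> bool" where
  "blank r \<longleftrightarrow> set r \<subseteq> {Blk}"

lemma blank_head [simp]: "blank r \<Longrightarrow> tape_head r = Blk"
  by (cases r) (auto simp: blank_def tape_head_def)

lemma blank_tl [simp]: "blank r \<Longrightarrow> blank (tl r)"
  by (cases r) (auto simp: blank_def)

lemma blank_simps [simp]: "blank []" "blank (a # r) \<longleftrightarrow> a = Blk \<and> blank r"
  by (auto simp: blank_def)

text \<open>Listed from right to left like the left part of a configuration: the marked cells are
  the rightmost ones, and the final entry is the blank at the left end of the tape.\<close>

definition counter :: "nat \<Rightarrow> nat \<Rightarrow> sym list" where
  "counter c j = replicate j One @ replicate (c - j) Zero @ [Blk]"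

text \<open>The tape to the right of the output is fixed only up to explicit trailing blanks, hence
  the quantifiers over blank lists.\<close>

definition exec :: "instr list \<Rightarrow> nat \<Rightarrow> nat \<Rightarrow> nat \<times> nat \<times> sym list \<Rightarrow> nat \<times> nat \<times> sym list \<Rightarrow> bool" where
  "exec P c t x y = (case (x, y) of ((pc, j, w), (pc', j', w')) \<Rightarrow>
     \<forall>r. blank r \<longrightarrow> (\<exists>r'. blank r' \<and> reach (prog_tm P) t
       (st pc 0, rev w @ Blk # counter c j, r) (st pc' 0, rev w' @ Blk # counter c j', r')))"

lemma exec_refl: "exec P c t x x"
  unfolding exec_def using reach_refl by (cases x) auto

lemma exec_trans [trans]: "exec P c s x y \<Longrightarrow> exec P c t y z \<Longrightarrow> exec P c (s + t) x z"
  unfolding exec_def by (cases x; cases y; cases z) (fastforce intro: reach_trans)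

lemma exec_mono: "exec P c s x y \<Longrightarrow> s \<le> t \<Longrightarrow> exec P c t x y"
  using reach_mono by (cases x; cases y) (simp add: exec_def, blast)

lemma exec_Write:
  assumes "pc < length P" "P ! pc = Write s"
  shows "exec P c 1 (pc, j, w) (Suc pc, j, w @ [s])"
  unfolding exec_def prod.case
proof (intro allI impI)
  fix r assume "blank r"
  then have "reach (prog_tm P) 1 (st pc 0, rev w @ Blk # counter c j, r) (st (Suc pc) 0, s # rev w @ Blk # counter c j, tl r)"
    using assms by (intro reach_step step_Rgt) (simp_all add: prog_trans_st)
  then show "\<exists>r'. blank r' \<and> reach (prog_tm P) 1 (st pc 0, rev w @ Blk # counter c j, r)
      (st (Suc pc) 0, rev (w @ [s]) @ Blk # counter c j, r')"
    using \<open>blank r\<close> by (intro exI[of _ "tl r"]) simp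
qed

lemma exec_Jump:
  assumes "pc < length P" "P ! pc = Jump t"
  shows "exec P c 1 (pc, j, w) (t, j, w)"
  unfolding exec_def prod.case
proof (intro allI impI)
  fix r assume "blank r"
  then have "reach (prog_tm P) 1 (st pc 0, rev w @ Blk # counter c j, r) (st t 0, rev w @ Blk # counter c j, Blk # tl r)"
    using assms by (intro reach_step step_Stay) (simp_all add: prog_trans_st)
  then show "\<exists>r'. blank r' \<and> reach (prog_tm P) 1 (st pc 0, rev w @ Blk # counter c j, r)
      (st t 0, rev w @ Blk # counter c j, r')"
    using \<open>blank r\<close> by (intro exI[of _ "Blk # tl r"]) simp
qed

lemma exec_Loop_next:
  assumes pc: "pc < length P" "P ! pc = Loop t" and j: "j < c" and w: "Blk \<notin> set w"
  shows "exec P c (2 * length w + 2 * c + 5) (pc, j, w) (Suc pc, Suc j, w)"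
  unfolding exec_def prod.case
proof (intro allI impI)
  fix r assume r: "blank r"
  let ?M = "prog_tm P" and ?l = "replicate (c - Suc j) Zero @ [Blk]" and ?r = "Blk # tl r"
  note trans = prog_trans_st[OF pc(1)] pc(2)
  have cj: "counter c j = replicate j One @ Zero # ?l"
    using j by (simp add: counter_def Suc_diff_Suc[symmetric])
  have cSj: "counter c (Suc j) = replicate j One @ One # ?l"
    by (simp add: counter_def replicate_app_Cons_same)
  have nB: "a \<noteq> Blk" if "a \<in> set w" for a using that w by auto
  have "reach ?M (Suc (length (rev w))) (st pc 0, rev w @ Blk # counter c j, r)
      (st pc 1, counter c j, Blk # rev (rev w) @ ?r)"
    using r nB by (intro step_scan_left) (simp_all add: trans)
  also have "reach ?M (Suc (length (replicate j One))) (st pc 1, counter c j, Blk # rev (rev w) @ ?r)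
      (st pc 2, ?l, Zero # rev (replicate j One) @ Blk # tl (Blk # rev (rev w) @ ?r))"
    unfolding cj by (intro step_scan_left) (simp_all add: trans)
  also have "reach ?M 1 (st pc 2, ?l, Zero # rev (replicate j One) @ Blk # tl (Blk # rev (rev w) @ ?r))
      (st pc 3, One # ?l, replicate j One @ Blk # w @ ?r)"
    by (intro reach_step) (simp add: trans step_Rgt)
  also have "reach ?M (length (replicate j One)) (st pc 3, One # ?l, replicate j One @ Blk # w @ ?r)
      (st pc 3, rev (map id (replicate j One)) @ One # ?l, Blk # w @ ?r)"
    by (intro scan_right) (simp_all add: trans)
  also have "reach ?M 1 (st pc 3, rev (map id (replicate j One)) @ One # ?l, Blk # w @ ?r)
      (st pc 4, Blk # counter c (Suc j), w @ ?r)"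
    unfolding cSj by (intro reach_step) (simp add: trans step_Rgt)
  also have "reach ?M (length w) (st pc 4, Blk # counter c (Suc j), w @ ?r)
      (st pc 4, rev (map id w) @ Blk # counter c (Suc j), ?r)"
    using nB by (intro scan_right) (simp_all add: trans)
  also have "reach ?M 1 (st pc 4, rev (map id w) @ Blk # counter c (Suc j), ?r)
      (st (Suc pc) 0, rev w @ Blk # counter c (Suc j), ?r)"
    by (intro reach_step) (simp add: trans step_Stay)
  finally show "\<exists>r'. blank r' \<and> reach ?M (2 * length w + 2 * c + 5)
      (st pc 0, rev w @ Blk # counter c j, r) (st (Suc pc) 0, rev w @ Blk # counter c (Suc j), r')"
    using r j by (intro exI[of _ ?r] conjI) (auto elim!: reach_mono)
qed

lemma exec_Loop_exit:
  assumes pc: "pc < length P" "P ! pc = Loop t" and w: "Blk \<notin> set w"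
  shows "exec P c (2 * length w + 2 * c + 5) (pc, c, w) (t, 0, w)"
  unfolding exec_def prod.case
proof (intro allI impI)
  fix r assume r: "blank r"
  let ?M = "prog_tm P" and ?r = "Blk # tl r"
  note trans = prog_trans_st[OF pc(1)] pc(2)
  have cc: "counter c c = replicate c One @ Blk # []" by (simp add: counter_def)
  have c0: "counter c 0 = replicate c Zero @ [Blk]" by (simp add: counter_def)
  have nB: "a \<noteq> Blk" if "a \<in> set w" for a using that w by auto
  have "reach ?M (Suc (length (rev w))) (st pc 0, rev w @ Blk # counter c c, r)
      (st pc 1, counter c c, Blk # rev (rev w) @ ?r)"
    using r nB by (intro step_scan_left) (simp_all add: trans)
  also have "reach ?M (Suc (length (replicate c One))) (st pc 1, counter c c, Blk # rev (rev w) @ ?r)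
      (st pc 2, [], Blk # rev (replicate c One) @ Blk # tl (Blk # rev (rev w) @ ?r))"
    unfolding cc by (intro step_scan_left) (simp_all add: trans)
  also have "reach ?M 1 (st pc 2, [], Blk # rev (replicate c One) @ Blk # tl (Blk # rev (rev w) @ ?r))
      (st pc 5, [Blk], replicate c One @ Blk # w @ ?r)"
    by (intro reach_step) (simp add: trans step_Rgt)
  also have "reach ?M (length (replicate c One)) (st pc 5, [Blk], replicate c One @ Blk # w @ ?r)
      (st pc 5, rev (map (\<lambda>_. Zero) (replicate c One)) @ [Blk], Blk # w @ ?r)"
    by (intro scan_right) (simp_all add: trans)
  also have "reach ?M 1 (st pc 5, rev (map (\<lambda>_. Zero) (replicate c One)) @ [Blk], Blk # w @ ?r)
      (st pc 6, Blk # counter c 0, w @ ?r)"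
    unfolding c0 by (intro reach_step) (simp add: trans step_Rgt)
  also have "reach ?M (length w) (st pc 6, Blk # counter c 0, w @ ?r)
      (st pc 6, rev (map id w) @ Blk # counter c 0, ?r)"
    using nB by (intro scan_right) (simp_all add: trans)
  also have "reach ?M 1 (st pc 6, rev (map id w) @ Blk # counter c 0, ?r)
      (st t 0, rev w @ Blk # counter c 0, ?r)"
    by (intro reach_step) (simp add: trans step_Stay)
  finally show "\<exists>r'. blank r' \<and> reach ?M (2 * length w + 2 * c + 5)
      (st pc 0, rev w @ Blk # counter c c, r) (st t 0, rev w @ Blk # counter c 0, r')"
    using r by (intro exI[of _ ?r] conjI) (auto elim!: reach_mono)
qed

text \<open>Invariant of the copying loop of \<open>Dup\<close> after \<open>i\<close> of the
  \<open>k\<close> ones. A round replaces the next one by a blank as a bookmark, appends a one at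
  the far end, returns to the blank and restores it.\<close>

lemma reach_copy_block:
  assumes pc: "pc < length P" "P ! pc = Dup" and B: "blank B"
  shows "i \<le> k \<Longrightarrow> \<exists>B'. blank B' \<and> reach (prog_tm P) (i * (2 * k + 4))
    (st pc 3, l, replicate k One @ Zero # B)
    (st pc 3, replicate i One @ l, replicate (k - i) One @ Zero # replicate i One @ B')"
proof (induction i)
  case 0
  then show ?case using B by (auto intro!: exI[of _ B] reach_refl)
next
  case (Suc i)
  let ?M = "prog_tm P" and ?w = "replicate (k - Suc i) One @ Zero # replicate i One" and ?l = "replicate i One @ l"
  note trans = prog_trans_st[OF pc(1)] pc(2)
  obtain B' where B': "blank B'" and
    "reach ?M (i * (2 * k + 4)) (st pc 3, l, replicate k One @ Zero # B)
      (st pc 3, ?l, replicate (k - i) One @ Zero # replicate i One @ B')"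
    using Suc by auto
  note this(2)
  also have "reach ?M 1 (st pc 3, ?l, replicate (k - i) One @ Zero # replicate i One @ B') (st pc 4, Blk # ?l, ?w @ B')"
    using Suc(2) by (intro reach_step) (cases "k - i", auto simp: trans step_Rgt Suc_diff_Suc)
  also have "reach ?M (length ?w) (st pc 4, Blk # ?l, ?w @ B') (st pc 4, rev (map id ?w) @ Blk # ?l, B')"
    by (intro scan_right) (auto simp: trans)
  also have "reach ?M (Suc (length (rev (map id ?w)))) (st pc 4, rev (map id ?w) @ Blk # ?l, B')
      (st pc 5, ?l, Blk # rev (rev (map id ?w)) @ One # tl B')"
    using B' by (intro step_scan_left) (auto simp: trans)
  also have "reach ?M 1 (st pc 5, ?l, Blk # rev (rev (map id ?w)) @ One # tl B') (st pc 3, One # ?l, ?w @ One # tl B')"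
    by (intro reach_step) (simp add: trans step_Rgt)
  finally have "reach ?M (Suc i * (2 * k + 4)) (st pc 3, l, replicate k One @ Zero # B) (st pc 3, One # ?l, ?w @ One # tl B')"
    using Suc(2) by (auto elim!: reach_mono)
  then show ?case
    using B' by (intro exI[of _ "tl B'"]) (simp add: replicate_app_Cons_same)
qed

text \<open>The condition on \<open>w\<close> lets the leftward search for the start of the last
  number stop in the right place: at the \<open>Zero\<close> that ends the previous number, or at
  the separating blank.\<close>

lemma exec_Dup:
  assumes pc: "pc < length P" "P ! pc = Dup" and w: "w = [] \<or> last w = Zero"
  shows "exec P c (2 * (k + 4)\<^sup>2) (pc, j, w @ replicate k One @ [Zero])
      (Suc pc, j, w @ replicate k One @ [Zero] @ replicate (Suc k) One @ [Zero])"
  unfolding exec_def prod.case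
proof (intro allI impI)
  fix r assume r: "blank r"
  let ?M = "prog_tm P"
  note trans = prog_trans_st[OF pc(1)] pc(2)
  obtain z l where zl: "rev w @ Blk # counter c j = z # l" "z \<noteq> One"
    using w by (cases "rev w") (auto simp: last_rev[symmetric] simp del: last_rev)
  have "reach ?M 1 (st pc 0, Zero # replicate k One @ z # l, r) (st pc 1, replicate k One @ z # l, Zero # Blk # tl r)"
    using r by (intro reach_step) (simp add: trans step_Lft)
  also have "reach ?M (Suc (length (replicate k One))) (st pc 1, replicate k One @ z # l, Zero # Blk # tl r)
      (st pc 2, l, z # rev (replicate k One) @ Zero # tl (Zero # Blk # tl r))"
    by (intro step_scan_left) (simp_all add: trans)
  also have "reach ?M 1 (st pc 2, l, z # rev (replicate k One) @ Zero # tl (Zero # Blk # tl r))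
      (st pc 3, z # l, replicate k One @ Zero # Blk # tl r)"
    using zl(2) by (intro reach_step) (simp add: trans step_Rgt)
  finally have 1: "reach ?M (k + 3) (st pc 0, Zero # replicate k One @ z # l, r) (st pc 3, z # l, replicate k One @ Zero # Blk # tl r)"
    by (auto elim!: reach_mono)
  obtain B where B: "blank B" and 2: "reach ?M (k * (2 * k + 4)) (st pc 3, z # l, replicate k One @ Zero # Blk # tl r)
      (st pc 3, replicate k One @ z # l, Zero # replicate k One @ B)"
    using reach_copy_block[OF pc, of "Blk # tl r" k k "z # l"] r by auto
  have "reach ?M 1 (st pc 3, replicate k One @ z # l, Zero # replicate k One @ B)
      (st pc 6, Zero # replicate k One @ z # l, replicate k One @ B)"
    by (intro reach_step) (simp add: trans step_Rgt)
  also have "reach ?M (length (replicate k One)) (st pc 6, Zero # replicate k One @ z # l, replicate k One @ B)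
      (st pc 6, rev (map id (replicate k One)) @ Zero # replicate k One @ z # l, B)"
    by (intro scan_right) (simp_all add: trans)
  also have "reach ?M 1 (st pc 6, rev (map id (replicate k One)) @ Zero # replicate k One @ z # l, B)
      (st pc 7, One # replicate k One @ Zero # replicate k One @ z # l, tl B)"
    using B by (intro reach_step) (simp add: trans step_Rgt)
  also have "reach ?M 1 (st pc 7, One # replicate k One @ Zero # replicate k One @ z # l, tl B)
      (st (Suc pc) 0, Zero # One # replicate k One @ Zero # replicate k One @ z # l, tl (tl B))"
    by (intro reach_step) (simp add: trans step_Rgt)
  finally have 3: "reach ?M (k + 3) (st pc 3, replicate k One @ z # l, Zero # replicate k One @ B)
      (st (Suc pc) 0, Zero # One # replicate k One @ Zero # replicate k One @ z # l, tl (tl B))"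
    by (auto elim!: reach_mono)
  have "reach ?M (2 * (k + 4)\<^sup>2) (st pc 0, Zero # replicate k One @ z # l, r)
      (st (Suc pc) 0, Zero # One # replicate k One @ Zero # replicate k One @ z # l, tl (tl B))"
    by (rule reach_mono[OF reach_trans[OF reach_trans[OF 1 2] 3]]) (simp add: power2_eq_square algebra_simps)
  then show "\<exists>r'. blank r' \<and> reach ?M (2 * (k + 4)\<^sup>2)
      (st pc 0, rev (w @ replicate k One @ [Zero]) @ Blk # counter c j, r)
      (st (Suc pc) 0, rev (w @ replicate k One @ [Zero] @ replicate (Suc k) One @ [Zero]) @ Blk # counter c j, r')"
    using B by (intro exI[of _ "tl (tl B)"]) (simp add: zl(1) replicate_app_Cons_same)
qed

lemma reach_Finish:
  assumes pc: "pc < length P" "P ! pc = Finish" and w: "Blk \<notin> set w" and r: "blank r"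
  shows "reach (prog_tm P) (length w + 2) (st pc 0, rev w @ Blk # l, r) (1, Blk # l, w @ Blk # tl r)"
proof -
  note trans = prog_trans_st[OF pc(1)] pc(2)
  have nB: "a \<noteq> Blk" if "a \<in> set w" for a using that w by auto
  have "reach (prog_tm P) (Suc (length (rev w))) (st pc 0, rev w @ Blk # l, r) (st pc 1, l, Blk # rev (rev w) @ Blk # tl r)"
    using r nB by (intro step_scan_left) (simp_all add: trans)
  also have "reach (prog_tm P) 1 (st pc 1, l, Blk # rev (rev w) @ Blk # tl r) (1, Blk # l, w @ Blk # tl r)"
    by (intro reach_step) (simp add: trans step_Rgt)
  finally show ?thesis by simp
qed

lemma reach_start:
  "reach (prog_tm P) (n + 2) (0, [], map sym_of_bool (b # x)) (st 0 0, Blk # counter (length x) 0, [])"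
  if "length x \<le> n" for n
proof -
  let ?M = "prog_tm P" and ?x = "map sym_of_bool x"
  have nB: "sym_of_bool b \<noteq> Blk" for b by (simp add: sym_of_bool_def)
  have "reach ?M 1 (0, [], map sym_of_bool (b # x)) (2, [Blk], ?x)"
    using nB by (intro reach_step) (simp add: prog_tm_def step_Rgt)
  also have "(2, [Blk], ?x) = (2, [Blk], ?x @ [])" by simp
  also have "reach ?M (length ?x) (2, [Blk], ?x @ []) (2, rev (map (\<lambda>_. Zero) ?x) @ [Blk], [])"
    by (intro scan_right) (use nB in \<open>auto simp: prog_tm_def\<close>)
  also have "reach ?M 1 (2, rev (map (\<lambda>_. Zero) ?x) @ [Blk], []) (st 0 0, Blk # counter (length x) 0, [])"
    by (intro reach_step) (simp add: prog_tm_def step_Rgt tape_head_def map_replicate_const counter_def)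
  finally show ?thesis using that by (auto elim!: reach_mono)
qed

section \<open>Macros that print lists of unary numbers\<close>

datatype macro = Emit sym | Succ | Count | Range

type_synonym numbers = "nat list \<times> nat \<times> nat"  \<comment> \<open>finished numbers, the last of them, number in progress\<close>

fun macro_sem :: "nat \<Rightarrow> macro \<Rightarrow> numbers \<Rightarrow> numbers" where
  "macro_sem c (Emit s) (ns, k, j) = (if s = One then (ns, k, Suc j) else (ns @ [j], j, 0))"
| "macro_sem c Succ (ns, k, j) = (ns @ [Suc k], Suc k, j)"
| "macro_sem c Count (ns, k, j) = (ns, k, j + c)"
| "macro_sem c Range (ns, k, j) = (ns @ [Suc k..<Suc (k + c)], k + c, j)"

fun macro_ok :: "macro \<Rightarrow> numbers \<Rightarrow> bool" where
  "macro_ok (Emit s) _ \<longleftrightarrow> s \<noteq> Blk"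
| "macro_ok Count _ \<longleftrightarrow> True"
| "macro_ok _ (ns, k, j) \<longleftrightarrow> ns \<noteq> [] \<and> j = 0"

fun macros_ok :: "nat \<Rightarrow> macro list \<Rightarrow> numbers \<Rightarrow> bool" where
  "macros_ok c [] s \<longleftrightarrow> True"
| "macros_ok c (m # ms) s \<longleftrightarrow> macro_ok m s \<and> macros_ok c ms (macro_sem c m s)"

definition unary :: "nat \<Rightarrow> sym list" where
  "unary k = replicate k One @ [Zero]"

fun render :: "numbers \<Rightarrow> sym list" where
  "render (ns, k, j) = concat (map unary ns) @ replicate j One"

fun last_ok :: "numbers \<Rightarrow> bool" where
  "last_ok (ns, k, j) \<longleftrightarrow> (ns \<noteq> [] \<longrightarrow> last ns = k)"

fun compile :: "nat \<Rightarrow> macro list \<Rightarrow> instr list" where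
  "compile b [] = [Finish]"
| "compile b (Emit s # ms) = Write s # compile (Suc b) ms"
| "compile b (Succ # ms) = Dup # compile (Suc b) ms"
| "compile b (Count # ms) = [Loop (b + 3), Write One, Jump b] @ compile (b + 3) ms"
| "compile b (Range # ms) = [Loop (b + 3), Dup, Jump b] @ compile (b + 3) ms"

fun macro_size :: "macro \<Rightarrow> nat" where
  "macro_size Count = 3" | "macro_size Range = 3" | "macro_size _ = 1"

text \<open>One bound for every instruction executed while the output has length at most
  \<open>K\<close>; it is quadratic because of \<open>Dup\<close>.\<close>

definition instr_time :: "nat \<Rightarrow> nat \<Rightarrow> nat" where
  "instr_time c K = 2 * (K + c + 4)\<^sup>2"

lemma instr_time_ge: "1 \<le> instr_time c K" "l \<le> K \<Longrightarrow> 2 * l + 2 * c + 5 \<le> instr_time c K"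
  "l \<le> K \<Longrightarrow> 2 * (l + 4)\<^sup>2 \<le> instr_time c K"
proof -
  show "1 \<le> instr_time c K" by (simp add: instr_time_def)
  show "l \<le> K \<Longrightarrow> 2 * l + 2 * c + 5 \<le> instr_time c K"
    unfolding instr_time_def power2_eq_square by (simp add: algebra_simps)
  show "l \<le> K \<Longrightarrow> 2 * (l + 4)\<^sup>2 \<le> instr_time c K"
    unfolding instr_time_def by (intro mult_left_mono power_mono) auto
qed

lemma last_ok_sem: "last_ok s \<Longrightarrow> macro_ok m s \<Longrightarrow> last_ok (macro_sem c m s)"
  by (cases s; cases m) (auto simp: last_append)

lemma length_render_sem: "length (render s) \<le> length (render (macro_sem c m s))"
  by (cases s; cases m) (auto simp: unary_def)

lemma length_render_fold: "length (render s) \<le> length (render (fold (macro_sem c) ms s))"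
proof (induction ms arbitrary: s)
  case (Cons m ms)
  show ?case unfolding fold_simps by (rule order_trans[OF length_render_sem Cons.IH])
qed simp

lemma Blk_notin_render: "Blk \<notin> set (render s)"
  by (cases s) (auto simp: unary_def)

lemma exec_Succ:
  assumes "pc < length P" "P ! pc = Dup" "ns \<noteq> []" "last ns = k"
    "length (render (ns, k, 0)) \<le> K"
  shows "exec P c (instr_time c K) (pc, j, render (ns, k, 0)) (Suc pc, j, render (ns @ [Suc k], Suc k, 0))"
proof -
  have ns: "ns = butlast ns @ [k]" using assms(3,4) by (metis append_butlast_last_id)
  let ?w = "render (butlast ns, 0, 0)"
  have r: "render (ns, k, 0) = ?w @ replicate k One @ [Zero]"
    by (subst ns) (simp add: unary_def)
  have r': "render (ns @ [Suc k], Suc k, 0) = ?w @ replicate k One @ [Zero] @ replicate (Suc k) One @ [Zero]"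
    by (subst ns) (simp add: unary_def)
  have w: "?w = [] \<or> last ?w = Zero"
    by (cases "butlast ns" rule: rev_cases) (auto simp: unary_def)
  have "k \<le> K" using assms(5) unfolding r by simp
  then show ?thesis
    unfolding r r' by (intro exec_mono[OF exec_Dup[OF assms(1,2) w]] instr_time_ge)
qed

lemma exec_count_loop:
  assumes P: "b + 2 < length P" "P ! b = Loop t" "P ! (b + 1) = Write One" "P ! (b + 2) = Jump b"
    and w: "Blk \<notin> set w" "length w + c \<le> K"
  shows "i \<le> c \<Longrightarrow> exec P c (i * (3 * instr_time c K)) (b, 0, w) (b, i, w @ replicate i One)"
proof (induction i)
  case 0
  then show ?case by (simp add: exec_refl)
next
  case (Suc i)
  let ?w = "w @ replicate i One" and ?t = "instr_time c K"
  have "exec P c (i * (3 * ?t)) (b, 0, w) (b, i, ?w)"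
    using Suc by simp
  also have "exec P c ?t (b, i, ?w) (Suc b, Suc i, ?w)"
    using P w Suc(2) by (intro exec_mono[OF exec_Loop_next] instr_time_ge(2)) auto
  also have "exec P c ?t (Suc b, Suc i, ?w) (Suc (Suc b), Suc i, ?w @ [One])"
    using P by (intro exec_mono[OF exec_Write] instr_time_ge(1)) auto
  also have "exec P c ?t (Suc (Suc b), Suc i, ?w @ [One]) (b, Suc i, ?w @ [One])"
    using P by (intro exec_mono[OF exec_Jump] instr_time_ge(1)) auto
  also have "?w @ [One] = w @ replicate (Suc i) One"
    by (simp add: replicate_append_same)
  finally show ?case by (simp add: algebra_simps)
qed

lemma exec_range_loop:
  assumes P: "b + 2 < length P" "P ! b = Loop t" "P ! (b + 1) = Dup" "P ! (b + 2) = Jump b"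
    and ns: "ns \<noteq> []" "last ns = k" and K: "length (render (ns @ [Suc k..<Suc (k + c)], k + c, 0)) \<le> K"
  shows "i \<le> c \<Longrightarrow> exec P c (i * (3 * instr_time c K)) (b, 0, render (ns, k, 0))
    (b, i, render (ns @ [Suc k..<Suc (k + i)], k + i, 0))"
proof (induction i)
  case 0
  then show ?case by (simp add: exec_refl)
next
  case (Suc i)
  let ?ns = "ns @ [Suc k..<Suc (k + i)]" and ?t = "instr_time c K"
  let ?s = "(?ns, k + i, 0)"
  have "[Suc k..<Suc (k + c)] = [Suc k..<Suc (k + i)] @ [Suc (k + i)..<Suc (k + c)]"
    using Suc(2) upt_add_eq_append[of "Suc k" "Suc (k + i)" "c - i"] by (simp del: upt_Suc)
  then have len: "length (render ?s) \<le> K"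
    using K by simp
  have "exec P c (i * (3 * ?t)) (b, 0, render (ns, k, 0)) (b, i, render ?s)"
    using Suc by simp
  also have "exec P c ?t (b, i, render ?s) (Suc b, Suc i, render ?s)"
    using P len Suc(2) by (intro exec_mono[OF exec_Loop_next] instr_time_ge(2) Blk_notin_render) auto
  also have "exec P c ?t (Suc b, Suc i, render ?s) (Suc (Suc b), Suc i, render (?ns @ [Suc (k + i)], Suc (k + i), 0))"
    using P ns len by (intro exec_Succ) auto
  also have "exec P c ?t (Suc (Suc b), Suc i, render (?ns @ [Suc (k + i)], Suc (k + i), 0))
      (b, Suc i, render (?ns @ [Suc (k + i)], Suc (k + i), 0))"
    using P by (intro exec_mono[OF exec_Jump] instr_time_ge(1)) auto
  finally show ?case by (simp add: algebra_simps)
qed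

text \<open>Macros compose because each begins and ends with an unmarked counter:
  \<open>Loop\<close> resets it on exit.\<close>

lemma exec_macro:
  assumes P: "P = pre @ compile (length pre) (m # ms)" and ok: "macro_ok m s" "last_ok s"
    and K: "length (render (macro_sem c m s)) \<le> K"
  shows "exec P c ((3 * c + 1) * instr_time c K) (length pre, 0, render s)
    (length pre + macro_size m, 0, render (macro_sem c m s))"
proof -
  obtain ns k j where s: "s = (ns, k, j)" by (cases s)
  have len: "length (render s) \<le> K"
    using length_render_sem K by (rule order_trans)
  let ?t = "instr_time c K" and ?b = "length pre"
  have t: "?t \<le> (3 * c + 1) * ?t" by simp
  have exit: "exec P c (c * (3 * ?t) + ?t) (?b, 0, render s) (?b + 3, 0, w)"
    if "exec P c (c * (3 * ?t)) (?b, 0, render s) (?b, c, w)" "?b < length P" "P ! ?b = Loop (?b + 3)"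
      "Blk \<notin> set w" "length w \<le> K" for w
  proof (rule exec_trans[OF that(1)])
    show "exec P c ?t (?b, c, w) (?b + 3, 0, w)"
      using that by (intro exec_mono[OF exec_Loop_exit] instr_time_ge(2)) auto
  qed
  have eq: "c * (3 * ?t) + ?t = (3 * c + 1) * ?t" by (simp add: algebra_simps)
  show ?thesis
  proof (cases m)
    case (Emit a)
    have "a = One \<or> a = Zero" using ok Emit by (cases a) auto
    then have "render (macro_sem c m s) = render s @ [a]"
      using Emit s by (auto simp: unary_def replicate_append_same)
    moreover have "exec P c 1 (?b, 0, render s) (Suc ?b, 0, render s @ [a])"
      using P Emit by (intro exec_Write) auto
    ultimately show ?thesis
      using Emit order_trans[OF instr_time_ge(1) t] by (auto elim: exec_mono)
  next
    case Succ
    have "exec P c ?t (?b, 0, render (ns, k, 0)) (Suc ?b, 0, render (ns @ [Suc k], Suc k, 0))"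
      using P Succ ok s len by (intro exec_Succ) auto
    then show ?thesis
      using exec_mono[OF _ t] Succ ok s by auto
  next
    case Count
    have "length (render s) + c \<le> K" using K Count s by simp
    then have "exec P c (c * (3 * ?t)) (?b, 0, render s) (?b, c, render s @ replicate c One)"
      using P Count by (intro exec_count_loop Blk_notin_render) (auto simp: nth_append)
    from exit[OF this] have "exec P c ((3 * c + 1) * ?t) (?b, 0, render s) (?b + 3, 0, render s @ replicate c One)"
      unfolding eq using P Count K s Blk_notin_render[of s] by auto
    then show ?thesis
      using Count s by (simp add: replicate_add)
  next
    case Range
    have "exec P c (c * (3 * ?t)) (?b, 0, render (ns, k, 0)) (?b, c, render (ns @ [Suc k..<Suc (k + c)], k + c, 0))"
      using P Range ok s K by (intro exec_range_loop) (auto simp: nth_append)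
    then have "exec P c (c * (3 * ?t)) (?b, 0, render s) (?b, c, render (macro_sem c m s))"
      using Range ok s by simp
    from exit[OF this] show ?thesis
      unfolding eq using P Range K Blk_notin_render by simp
  qed
qed

lemma length_compile: "length (compile b ms) = (\<Sum>m\<leftarrow>ms. macro_size m) + 1"
  by (induction b ms rule: compile.induct) auto

lemma exec_macros:
  assumes "P = pre @ compile (length pre) ms" "macros_ok c ms s" "last_ok s"
    "length (render (fold (macro_sem c) ms s)) \<le> K"
  shows "exec P c (length ms * ((3 * c + 1) * instr_time c K)) (length pre, 0, render s)
    (length P - 1, 0, render (fold (macro_sem c) ms s)) \<and> P ! (length P - 1) = Finish"
  using assms
proof (induction ms arbitrary: pre s)
  case Nil
  then show ?case by (simp add: exec_refl)
next
  case (Cons m ms)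
  let ?t = "(3 * c + 1) * instr_time c K"
  have "\<exists>is. compile (length pre) (m # ms) = is @ compile (length (pre @ is)) ms \<and> length is = macro_size m"
  proof (cases m)
    case (Emit a)
    then show ?thesis by (intro exI[of _ "[Write a]"]) simp
  next
    case Succ
    then show ?thesis by (intro exI[of _ "[Dup]"]) simp
  next
    case Count
    then show ?thesis by (intro exI[of _ "[Loop (length pre + 3), Write One, Jump (length pre)]"]) (simp add: numeral_3_eq_3)
  next
    case Range
    then show ?thesis by (intro exI[of _ "[Loop (length pre + 3), Dup, Jump (length pre)]"]) (simp add: numeral_3_eq_3)
  qed
  then obtain "is" where "is": "P = (pre @ is) @ compile (length (pre @ is)) ms" "length is = macro_size m"
    using Cons.prems(1) by auto
  have 1: "exec P c ?t (length pre, 0, render s) (length pre + macro_size m, 0, render (macro_sem c m s))"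
    using Cons.prems order_trans[OF length_render_fold, of c ms "macro_sem c m s" K]
    by (intro exec_macro) auto
  have 2: "exec P c (length ms * ?t) (length (pre @ is), 0, render (macro_sem c m s))
      (length P - 1, 0, render (fold (macro_sem c) ms (macro_sem c m s))) \<and> P ! (length P - 1) = Finish"
    using Cons.prems last_ok_sem by (intro Cons.IH "is"(1)) auto
  from exec_trans[OF 1, of "length ms * ?t"] 2 show ?case
    by (simp add: "is"(2))
qed

lemma target_compile: "i \<in> set (compile b ms) \<Longrightarrow> target i \<le> b + length (compile b ms)"
  by (induction b ms arbitrary: i rule: compile.induct) fastforce+

lemma macros_ok_append: "macros_ok c (xs @ ys) s \<longleftrightarrow> macros_ok c xs s \<and> macros_ok c ys (fold (macro_sem c) xs s)"
  by (induction xs arbitrary: s) auto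

section \<open>The program that prints the circuit\<close>

definition num :: "nat \<Rightarrow> macro list" where
  "num i = replicate i (Emit One) @ [Emit Zero]"

lemma fold_num: "fold (macro_sem c) (num i) (ns, k, j) = (ns @ [j + i], j + i, 0)"
  unfolding num_def by (induction i arbitrary: j) (simp_all)

lemma macros_ok_num: "macros_ok c (num i) s"
  unfolding num_def by (induction i arbitrary: s) simp_all

text \<open>With m = c + 4, the constants 4, 5 and 8 after one or two \<open>Count\<close> complete
  the numbers m, m + 1 and 2 m, and three \<open>Succ\<close> complete a \<open>Range\<close> to m
  consecutive wires. The wires of the first query form a single run from 0 to 2 m - 1, printed by
  two ranges and seven successors.\<close>

definition circuit_macros :: "macro list" where
  "circuit_macros =
     [Count, Count] @ num 8
     @ num 3 @ [Count] @ num 4 @ [Count] @ num 4 @ num 0 @ [Range, Range] @ replicate 7 Succ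
     @ num 3 @ [Count] @ num 4 @ [Count] @ num 4 @ [Count] @ num 4 @ [Range] @ replicate 3 Succ
     @ num 0 @ [Range] @ replicate 3 Succ
     @ num 0 @ [Count] @ num 4 @ num 0 @ [Count] @ num 5
     @ num 3 @ num 2 @ num 1 @ [Count] @ num 4 @ [Count] @ num 5 @ num 0"

definition circuit_numbers :: "nat \<Rightarrow> nat list" where
  "circuit_numbers m = [2 * m] @ [3, m, m] @ ([0..<m] @ [m..<2 * m])
     @ [3, m, m] @ [m..<2 * m] @ [0..<m] @ [0, m, 0, Suc m] @ [3, 2, 1, m, Suc m, 0]"

lemma funpow_Succ: "(macro_sem c Succ ^^ i) (ns, k, j) = (ns @ [Suc k..<Suc (k + i)], k + i, j)"
  by (induction i) simp_all

lemma macros_ok_Succ: "ns \<noteq> [] \<Longrightarrow> macros_ok c (replicate i Succ) (ns, k, 0)"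
  by (induction i arbitrary: ns k) auto

lemma fold_circuit_macros:
  "\<exists>k. fold (macro_sem c) circuit_macros ([], 0, 0) = (circuit_numbers (c + 4), k, 0)"
proof -
  have split: "[i..<j + k] = [i..<j] @ [j..<j + k]" if "i \<le> j" for i j k :: nat
    using that by (rule upt_add_eq_append)
  have 1: "[0..<c + 4] @ [c + 4..<2 * (c + 4)]
      = 0 # [Suc 0..<Suc c] @ [Suc c..<Suc (c + c)] @ [Suc (c + c)..<Suc (c + c + 7)]"
  proof -
    have "[0..<c + 4] @ [c + 4..<2 * (c + 4)] = [0..<Suc (c + c + 7)]"
    proof -
      have "2 * (c + 4) = (c + 4) + (c + 4)" "Suc (c + c + 7) = (c + 4) + (c + 4)" by simp_all
      then show ?thesis by (simp only: split[of 0 "c + 4" "c + 4", OF le0])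
    qed
    also have "\<dots> = 0 # [Suc 0..<Suc (c + c) + 7]"
      by (subst upt_conv_Cons) (simp_all del: upt_Suc)
    also have "[Suc 0..<Suc (c + c) + 7] = [Suc 0..<Suc c + c] @ [Suc (c + c)..<Suc (c + c) + 7]"
      using split[of "Suc 0" "Suc (c + c)" 7] by (simp del: upt_Suc)
    also have "[Suc 0..<Suc c + c] = [Suc 0..<Suc c] @ [Suc c..<Suc c + c]"
      by (rule split) simp
    finally show ?thesis by (simp del: upt_Suc)
  qed
  have 2: "[c + 4..<2 * (c + 4)] = (c + 4) # [Suc (c + 4)..<Suc (c + 4 + c)] @ [Suc (c + 4 + c)..<Suc (c + 4 + c + 3)]"
  proof -
    have "[c + 4..<2 * (c + 4)] = (c + 4) # [Suc (c + 4)..<Suc (c + 4 + c) + 3]"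
      by (subst upt_conv_Cons) (simp_all add: algebra_simps del: upt_Suc)
    also have "[Suc (c + 4)..<Suc (c + 4 + c) + 3] = [Suc (c + 4)..<Suc (c + 4 + c)] @ [Suc (c + 4 + c)..<Suc (c + 4 + c) + 3]"
      by (rule split) simp
    finally show ?thesis by (simp del: upt_Suc)
  qed
  have 3: "[0..<c + 4] = 0 # [Suc 0..<Suc c] @ [Suc c..<Suc (c + 3)]"
  proof -
    have "[0..<c + 4] = 0 # [Suc 0..<Suc c + 3]"
      by (subst upt_conv_Cons) (simp_all add: algebra_simps del: upt_Suc)
    also have "[Suc 0..<Suc c + 3] = [Suc 0..<Suc c] @ [Suc c..<Suc c + 3]"
      by (rule split) simp
    finally show ?thesis by (simp del: upt_Suc)
  qed
  show ?thesis
    unfolding circuit_macros_def circuit_numbers_def 1 unfolding 2 3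
    by (simp add: fold_num funpow_Succ add.commute add.left_commute del: upt_Suc replicate.simps)
qed

lemma circuit_macros_ok: "macros_ok c circuit_macros ([], 0, 0)"
  unfolding circuit_macros_def
  by (simp add: macros_ok_append macros_ok_num macros_ok_Succ fold_num funpow_Succ del: upt_Suc replicate.simps)

lemma unary_nats_render:
  "unary_nats i (map (\<lambda>a. a = One) (unary k @ w)) = (i + k) # unary_nats 0 (map (\<lambda>a. a = One) w)"
  unfolding unary_def by (induction k arbitrary: i) simp_all

lemma unary_nats_concat: "unary_nats 0 (map (\<lambda>a. a = One) (concat (map unary ns))) = ns"
  using unary_nats_render[of 0] by (induction ns) simp_all

lemma decode_gates_Orc:
  "length ins = n \<Longrightarrow> length outs = m \<Longrightarrow>
   decode_gates (3 # n # m # ins @ outs @ rest) = Orc ins outs # decode_gates rest"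
  by (simp add: numeral_3_eq_3)

lemma decode_circuit_numbers:
  "decode_circuit (map (\<lambda>a. a = One) (concat (map unary (circuit_numbers m)))) = (2 * m, verifier_gates m)"
proof -
  have "decode_gates ([3, 2, 1, m, Suc m, 0]) = [Orc [m, Suc m] [0]]"
    using decode_gates_Orc[of "[m, Suc m]" 2 "[0]" 1 "[]"] by simp
  then have "decode_gates ([0, m, 0, Suc m] @ [3, 2, 1, m, Suc m, 0]) = [Hg m, Hg (Suc m), Orc [m, Suc m] [0]]"
    by simp
  then have "decode_gates (3 # m # m # [0..<m] @ [m..<2 * m] @ (3 # m # m # [m..<2 * m] @ [0..<m] @
      ([0, m, 0, Suc m] @ [3, 2, 1, m, Suc m, 0]))) = verifier_gates m"
    by (subst decode_gates_Orc, simp, simp, subst decode_gates_Orc) (simp_all add: verifier_gates_def)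
  then show ?thesis
    unfolding decode_circuit_def unary_nats_concat circuit_numbers_def by simp
qed

text \<open>There are 4 c + 33 numbers, each at most 2 c + 8 and followed by a separator; 297 is 33
  * 9.\<close>

lemma length_render_circuit: "length (render (circuit_numbers (c + 4), k, 0)) \<le> 297 * (c + 1)\<^sup>2"
proof -
  let ?ns = "circuit_numbers (c + 4)"
  have "length (render (?ns, k, 0)) = (\<Sum>i\<leftarrow>?ns. i + 1)"
    by (simp add: length_concat comp_def unary_def)
  also have "\<dots> \<le> (\<Sum>i\<leftarrow>?ns. 2 * c + 9)"
    by (intro sum_list_mono) (auto simp: circuit_numbers_def)
  also have "\<dots> = (4 * c + 33) * (2 * c + 9)"
    by (simp add: sum_list_triv circuit_numbers_def algebra_simps)
  also have "\<dots> \<le> 297 * (c + 1)\<^sup>2"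
    by (simp add: power2_eq_square algebra_simps)
  finally show ?thesis .
qed

definition circuit_tm :: tm where
  "circuit_tm = prog_tm (compile 0 circuit_macros)"

lemma wf_circuit_tm: "wf_tm circuit_tm"
  unfolding circuit_tm_def using target_compile[of _ 0] by (intro wf_prog_tm) simp

definition circuit_time :: nat where
  "circuit_time = 1000000 * (length circuit_macros + 1)"

text \<open>The empty input decodes to a circuit without wires, which accepts with probability
  0.\<close>

lemma circuit_tm_run:
  fixes x :: "bool list"
  defines "t \<equiv> circuit_time * (length x + 1) ^ 5"
  shows "tm_halts_within circuit_tm x t"
    and "decode_circuit (tm_output (tm_run circuit_tm x t))
      = (if x = [] then (0, []) else (2 * (length x + 3), verifier_gates (length x + 3)))"
proof -
  have "\<exists>l r. tm_run circuit_tm x t = (1, l, r) \<and> decode_circuit (tm_output (1, l, r))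
      = (if x = [] then (0, []) else (2 * (length x + 3), verifier_gates (length x + 3)))"
  proof (cases x)
    case Nil
    have "reach circuit_tm 1 (0, [], []) (1, [], [Blk])"
      by (intro reach_step) (simp add: circuit_tm_def prog_tm_def step_Stay tape_head_def)
    then have "reach circuit_tm t (0, [], []) (1, [], [Blk])"
      by (rule reach_mono) (simp add: t_def circuit_time_def)
    from reach_halt[OF this] Nil show ?thesis
      by (simp add: tm_run_def tm_output_def decode_circuit_def)
  next
    case (Cons b y)
    define c where "c = length y"
    define P where "P = compile 0 circuit_macros"
    obtain k where k: "fold (macro_sem c) circuit_macros ([], 0, 0) = (circuit_numbers (c + 4), k, 0)"
      using fold_circuit_macros by blast
    define w where "w = render (circuit_numbers (c + 4), k, 0)"
    define K where "K = 297 * (c + 1)\<^sup>2"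
    define t2 where "t2 = length circuit_macros * ((3 * c + 1) * instr_time c K)"
    have lw: "length w \<le> K" unfolding w_def K_def by (rule length_render_circuit)
    have ex: "exec P c t2 (0, 0, []) (length P - 1, 0, w)" and fin: "P ! (length P - 1) = Finish"
      using exec_macros[of P "[]" circuit_macros c "([], 0, 0)" K] circuit_macros_ok lw
      by (simp_all add: P_def k w_def t2_def)
    have "blank []" by simp
    then obtain r where r: "blank r" "reach (prog_tm P) t2 (st 0 0, Blk # counter c 0, [])
        (st (length P - 1) 0, rev w @ Blk # counter c 0, r)"
      using ex unfolding exec_def prod.case by fastforce
    have P0: "length P - 1 < length P" by (simp add: P_def length_compile)
    have "reach (prog_tm P) (c + 2) (0, [], map sym_of_bool (b # y)) (st 0 0, Blk # counter c 0, [])"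
      unfolding c_def by (rule reach_start) simp
    also note r(2)
    also have "reach (prog_tm P) (length w + 2) (st (length P - 1) 0, rev w @ Blk # counter c 0, r)
        (1, Blk # counter c 0, w @ Blk # tl r)"
      unfolding w_def using P0 fin r by (intro reach_Finish Blk_notin_render)
    finally have "reach circuit_tm (c + 2 + t2 + (length w + 2)) (0, [], map sym_of_bool x) (1, Blk # counter c 0, w @ Blk # tl r)"
      by (simp add: circuit_tm_def P_def Cons)
    moreover have "c + 2 + t2 + (length w + 2) \<le> t"
    proof -
      define n where "n = c + 1"
      have n: "1 \<le> n" by (simp add: n_def)
      \<comment> \<open>Since K + c + 4 is at most 301 times n squared, a macro costs at most 6 *
        301 ^ 2 = 543606 times n ^ 5. The extra 1 in \<open>circuit_time\<close> pays for the start
        and for the final rewinding.\<close>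
      have "instr_time c K \<le> 2 * (301 * n\<^sup>2)\<^sup>2"
        unfolding instr_time_def K_def n_def[symmetric]
        by (intro mult_left_mono power_mono) (auto simp: n_def power2_eq_square)
      then have "(3 * c + 1) * instr_time c K \<le> (3 * n) * (2 * (301 * n\<^sup>2)\<^sup>2)"
        by (intro mult_mono) (auto simp: n_def)
      also have "\<dots> \<le> 1000000 * n ^ 5"
      proof -
        have "n ^ 5 = n * (n * (n * (n * n)))" by (simp add: power_numeral_reduce)
        then have "(3 * n) * (2 * (301 * n\<^sup>2)\<^sup>2) = 543606 * n ^ 5"
          by (simp add: power2_eq_square mult_ac)
        then show ?thesis by simp
      qed
      finally have a: "t2 \<le> length circuit_macros * (1000000 * n ^ 5)"
        unfolding t2_def by (rule mult_left_mono) simp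
      have "n\<^sup>2 \<le> n ^ 5" "n \<le> n ^ 5" using n by (auto intro: power_increasing self_le_power)
      then have "c + 2 + (length w + 2) \<le> 1000000 * n ^ 5"
        using lw n by (simp add: K_def n_def)
      then have "c + 2 + t2 + (length w + 2) \<le> circuit_time * n ^ 5"
        using a by (simp add: circuit_time_def algebra_simps)
      also have "\<dots> \<le> t"
        unfolding t_def by (intro mult_left_mono power_mono) (auto simp: n_def c_def Cons)
      finally show ?thesis .
    qed
    ultimately have "reach circuit_tm t (0, [], map sym_of_bool x) (1, Blk # counter c 0, w @ Blk # tl r)"
      by (rule reach_mono)
    then have run: "tm_run circuit_tm x t = (1, Blk # counter c 0, w @ Blk # tl r)"
      unfolding tm_run_def by (rule reach_halt)
    have nB: "\<And>a. a \<in> set w \<Longrightarrow> a \<noteq> Blk"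
      using Blk_notin_render unfolding w_def by metis
    have "takeWhile (\<lambda>a. a \<noteq> Blk) (w @ Blk # tl r) = w"
      using nB by (simp add: takeWhile_append2)
    then have "tm_output (1, Blk # counter c 0, w @ Blk # tl r) = map (\<lambda>a. a = One) (concat (map unary (circuit_numbers (c + 4))))"
      by (simp add: tm_output_def w_def)
    moreover have "c + 4 = length x + 3" by (simp add: c_def Cons)
    ultimately have "decode_circuit (tm_output (1, Blk # counter c 0, w @ Blk # tl r))
        = (2 * (length x + 3), verifier_gates (length x + 3))"
      by (simp only: decode_circuit_numbers)
    moreover have "x \<noteq> []" by (simp add: Cons)
    ultimately show ?thesis
      using run by (intro exI[of _ "Blk # counter c 0"] exI[of _ "w @ Blk # tl r"]) simp
  qed
  then show "tm_halts_within circuit_tm x t"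
    and "decode_circuit (tm_output (tm_run circuit_tm x t))
      = (if x = [] then (0, []) else (2 * (length x + 3), verifier_gates (length x + 3)))"
    unfolding tm_halts_within_def by auto
qed

section \<open>Product distributions on functions\<close>

type_synonym bfun = "bool list \<Rightarrow> bool list"

definition product_oracle :: "(nat \<Rightarrow> bfun pmf) \<Rightarrow> (nat \<Rightarrow> bfun) measure" where
  "product_oracle Q = Pi\<^sub>M UNIV (\<lambda>m. measure_pmf (Q m))"

text \<open>A query is answered by the block that belongs to its length, which makes the answers at
  different lengths independent.\<close>

definition glue :: "(nat \<Rightarrow> bfun) \<Rightarrow> bfun" where
  "glue \<omega> u = \<omega> (length u) u"

definition oracle_dist :: "(nat \<Rightarrow> bfun pmf) \<Rightarrow> bfun measure" where
  "oracle_dist Q = distr (product_oracle Q) (Pi\<^sub>M UNIV (\<lambda>_. count_space UNIV)) glue"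

lemma prob_space_product_oracle: "prob_space (product_oracle Q)"
  unfolding product_oracle_def by (intro prob_space_PiM prob_space_measure_pmf)

lemma measurable_glue: "glue \<in> measurable (product_oracle Q) (Pi\<^sub>M UNIV (\<lambda>_. count_space UNIV))"
proof (rule measurable_PiM_single')
  fix u :: "bool list"
  have "(\<lambda>\<omega>. \<omega> (length u)) \<in> measurable (product_oracle Q) (measure_pmf (Q (length u)))"
    unfolding product_oracle_def by (rule measurable_component_singleton) simp
  then show "(\<lambda>\<omega>. glue \<omega> u) \<in> measurable (product_oracle Q) (count_space UNIV)"
    unfolding glue_def by (rule measurable_compose) simp
qed simp

lemma dist_oracle_oracle_dist: "dist_oracle (oracle_dist Q)"
  unfolding dist_oracle_def oracle_dist_def
  using prob_space.prob_space_distr[OF prob_space_product_oracle measurable_glue] by simp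

text \<open>An oracle gate evaluates the state at a string that depends on a single value of
  \<open>f\<close>, so only countably many cases arise.\<close>

lemma measurable_apply_gate:
  assumes "\<And>b. (\<lambda>f. \<psi> f b) \<in> borel_measurable (Pi\<^sub>M UNIV (\<lambda>_. count_space UNIV))"
  shows "(\<lambda>f. apply_gate f q g (\<psi> f) b) \<in> borel_measurable (Pi\<^sub>M UNIV (\<lambda>_. count_space (UNIV :: bool list set)))"
proof (cases "valid_gate q g")
  case False
  then show ?thesis using assms by (simp add: apply_gate_def)
next
  case True
  note [measurable] = assms
  show ?thesis
  proof (cases g)
    case (Orc ins outs)
    define M where "M = Pi\<^sub>M (UNIV :: bool list set) (\<lambda>_. count_space (UNIV :: bool list set))"
    define u where "u = map ((!) b) ins"
    have "(\<lambda>f. f u) \<in> measurable M (count_space UNIV)"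
      unfolding M_def by (rule measurable_component_singleton) simp
    then have "(\<lambda>f. map (\<lambda>j. b ! j \<noteq> (\<exists>k<length outs. outs ! k = j \<and> k < length (f u) \<and> f u ! k)) [0..<length b])
        \<in> measurable M (count_space UNIV)"
      by (rule measurable_compose) simp
    then have perm: "(\<lambda>f. oracle_perm f ins outs b) \<in> measurable M (count_space UNIV)"
      by (simp add: oracle_perm_def Let_def u_def)
    have "(\<lambda>f. \<psi> f (oracle_perm f ins outs b)) \<in> borel_measurable M"
      by (rule measurable_compose_countable[OF _ perm]) (use assms in \<open>simp add: M_def\<close>)
    then show ?thesis using True Orc by (simp add: apply_gate_def M_def)
  qed (use True in \<open>simp_all add: apply_gate_def\<close>)
qed

lemma measurable_run_circuit:
  "(\<And>b. (\<lambda>f. \<psi> f b) \<in> borel_measurable (Pi\<^sub>M UNIV (\<lambda>_. count_space UNIV))) \<Longrightarrow>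
   (\<lambda>f. run_circuit f q gs (\<psi> f) b) \<in> borel_measurable (Pi\<^sub>M UNIV (\<lambda>_. count_space (UNIV :: bool list set)))"
  unfolding run_circuit_def
proof (induction gs arbitrary: \<psi> b)
  case (Cons g gs)
  show ?case
    using Cons.IH[of "\<lambda>f. apply_gate f q g (\<psi> f)"] measurable_apply_gate[OF Cons.prems] by simp
qed simp

lemma measurable_acc_prob:
  "(\<lambda>f. acc_prob q (run_circuit f q gs \<psi>)) \<in> borel_measurable (Pi\<^sub>M UNIV (\<lambda>_. count_space (UNIV :: bool list set)))"
proof -
  have [measurable]: "(\<lambda>f. run_circuit f q gs \<psi> b) \<in> borel_measurable (Pi\<^sub>M UNIV (\<lambda>_. count_space (UNIV :: bool list set)))" for b
    by (rule measurable_run_circuit) simp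
  show ?thesis unfolding acc_prob_def by measurable
qed

lemma measurable_product_acc:
  "(\<lambda>\<omega>. acc_prob q (run_circuit (glue \<omega>) q gs \<psi>)) \<in> borel_measurable (product_oracle Q)"
  using measurable_glue measurable_acc_prob by (rule measurable_compose)

lemma integral_oracle_dist:
  "(\<integral>f. acc_prob q (run_circuit f q gs \<psi>) \<partial>oracle_dist Q)
    = (\<integral>\<omega>. acc_prob q (run_circuit (glue \<omega>) q gs \<psi>) \<partial>product_oracle Q)"
  unfolding oracle_dist_def by (rule integral_distr[OF measurable_glue measurable_acc_prob])

lemma sets_product_oracle: "sets (product_oracle Q) = sets (product_oracle Q')"
  unfolding product_oracle_def by (intro sets_PiM_cong) auto

section \<open>Conditioning on one block and ignoring distant ones\<close>

definition others :: "(nat \<Rightarrow> bfun pmf) \<Rightarrow> nat \<Rightarrow> (nat \<Rightarrow> bfun) measure" where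
  "others Q i = Pi\<^sub>M (UNIV - {i}) (\<lambda>m. measure_pmf (Q m))"

lemma prob_space_others: "prob_space (others Q i)"
  unfolding others_def by (intro prob_space_PiM prob_space_measure_pmf)

lemma others_fun_upd: "others (Q(i := P)) i = others Q i"
  unfolding others_def by (intro PiM_cong) auto

lemma measurable_fun_upd_others:
  "(\<lambda>(\<theta>, X). X(i := \<theta>)) \<in> measurable (measure_pmf (Q i) \<Otimes>\<^sub>M others Q i) (product_oracle Q)"
proof -
  have "(\<lambda>(\<theta>, X). X(i := \<theta>)) \<in> measurable (measure_pmf (Q i) \<Otimes>\<^sub>M others Q i) (Pi\<^sub>M (insert i (UNIV - {i})) (\<lambda>m. measure_pmf (Q m)))"
    unfolding others_def case_prod_unfold
    by (rule measurable_fun_upd[where J = "UNIV - {i}"]) auto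
  then show ?thesis by (simp add: product_oracle_def insert_absorb)
qed

text \<open>Fubini for block \<open>i\<close>. The inner measure is the same for every law of block
  \<open>i\<close>, so two settings that differ only there can be compared through one function of
  that block.\<close>

lemma integral_split_coordinate:
  fixes h :: "(nat \<Rightarrow> bfun) \<Rightarrow> real"
  assumes h: "h \<in> borel_measurable (product_oracle Q)" and b: "\<And>\<omega>. 0 \<le> h \<omega>" "\<And>\<omega>. h \<omega> \<le> C"
  shows "(\<integral>\<omega>. h \<omega> \<partial>product_oracle Q) = (\<integral>\<theta>. (\<integral>X. h (X(i := \<theta>)) \<partial>others Q i) \<partial>measure_pmf (Q i))"
proof -
  interpret O: prob_space "others Q i" by (rule prob_space_others)
  interpret P: pair_prob_space "measure_pmf (Q i)" "others Q i" ..
  let ?D = "measure_pmf (Q i) \<Otimes>\<^sub>M others Q i" and ?u = "\<lambda>(\<theta>, X). X(i := \<theta>)"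
  have ins: "insert i (UNIV - {i}) = UNIV" by auto
  have eq: "distr ?D (product_oracle Q) ?u = product_oracle Q"
    using distr_pair_PiM_eq_PiM[of "UNIV - {i}" "\<lambda>m. measure_pmf (Q m)" i]
    by (simp add: ins others_def product_oracle_def prob_space_measure_pmf)
  have "(\<integral>\<omega>. h \<omega> \<partial>product_oracle Q) = (\<integral>\<omega>. h \<omega> \<partial>distr ?D (product_oracle Q) ?u)"
    by (simp add: eq)
  also have "\<dots> = (\<integral>y. h (?u y) \<partial>?D)"
    by (rule integral_distr[OF measurable_fun_upd_others h])
  also have "\<dots> = (\<integral>\<theta>. (\<integral>X. h (X(i := \<theta>)) \<partial>others Q i) \<partial>measure_pmf (Q i))"
  proof -
    have "integrable ?D (\<lambda>y. h (?u y))"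
      by (rule P.integrable_const_bound[where B = C])
         (use b measurable_compose[OF measurable_fun_upd_others h] in auto)
    from P.integral_fst'[OF this] show ?thesis by simp
  qed
  finally show ?thesis .
qed

text \<open>The integral is carried over to the finite product up to \<open>B\<close>, where the
  laws of later blocks do not occur. The identity from there back to all indices is measurable since
  the missing coordinates are constantly \<open>undefined\<close>.\<close>

lemma integral_finite_support:
  fixes h :: "(nat \<Rightarrow> bfun) \<Rightarrow> real"
  assumes h: "h \<in> borel_measurable (product_oracle Q)"
    and dep: "\<And>\<omega> \<omega>'. (\<And>i. i \<le> B \<Longrightarrow> \<omega> i = \<omega>' i) \<Longrightarrow> h \<omega> = h \<omega>'"
    and Q: "\<And>i. i \<le> B \<Longrightarrow> Q i = Q' i"
  shows "(\<integral>\<omega>. h \<omega> \<partial>product_oracle Q) = (\<integral>\<omega>. h \<omega> \<partial>product_oracle Q')"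
proof -
  have red: "(\<integral>\<omega>. h \<omega> \<partial>product_oracle Q) = (\<integral>\<omega>. h \<omega> \<partial>Pi\<^sub>M {..B} (\<lambda>m. measure_pmf (Q m)))"
    if h: "h \<in> borel_measurable (product_oracle Q)" for Q
  proof -
    interpret product_prob_space "\<lambda>m. measure_pmf (Q m)" UNIV
      by (intro product_prob_space.intro product_sigma_finite.intro product_prob_space_axioms.intro
          prob_space_measure_pmf prob_space_imp_sigma_finite)
    let ?J = "Pi\<^sub>M {..B} (\<lambda>m. measure_pmf (Q m))"
    have r: "(\<lambda>x. restrict x {..B}) \<in> measurable (product_oracle Q) ?J"
      unfolding product_oracle_def by (rule measurable_restrict_subset) simp
    have "(\<lambda>x. x) \<in> measurable ?J (product_oracle Q)"
      unfolding product_oracle_def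
    proof (rule measurable_PiM_single')
      fix i :: nat
      show "(\<lambda>x. x i) \<in> measurable ?J (measure_pmf (Q i))"
      proof (cases "i \<le> B")
        case True
        then show ?thesis by (intro measurable_component_singleton) simp
      next
        case False
        have "(\<lambda>x. x i) \<in> measurable ?J (measure_pmf (Q i)) \<longleftrightarrow> (\<lambda>x. undefined) \<in> measurable ?J (measure_pmf (Q i))"
          using False by (intro measurable_cong) (auto simp: space_PiM PiE_def extensional_def)
        then show ?thesis by simp
      qed
    qed simp
    from measurable_compose[OF this h] have hJ: "h \<in> borel_measurable ?J" .
    have "(\<integral>\<omega>. h \<omega> \<partial>product_oracle Q) = (\<integral>\<omega>. h (restrict \<omega> {..B}) \<partial>product_oracle Q)"
      by (intro Bochner_Integration.integral_cong refl dep) simp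
    also have "\<dots> = (\<integral>\<omega>. h \<omega> \<partial>distr (product_oracle Q) ?J (\<lambda>x. restrict x {..B}))"
      by (rule integral_distr[symmetric, OF r hJ])
    also have "distr (product_oracle Q) ?J (\<lambda>x. restrict x {..B}) = ?J"
      unfolding product_oracle_def by (rule distr_PiM_restrict_finite) auto
    finally show ?thesis .
  qed
  have "h \<in> borel_measurable (product_oracle Q')"
    using h measurable_cong_sets[OF sets_product_oracle refl] by blast
  moreover have "Pi\<^sub>M {..B} (\<lambda>m. measure_pmf (Q m)) = Pi\<^sub>M {..B} (\<lambda>m. measure_pmf (Q' m))"
    using Q by (intro PiM_cong) auto
  ultimately show ?thesis using red h by metis
qed

section \<open>The language and its verifiers\<close>

definition coin_fun :: "bool \<Rightarrow> bfun" where
  "coin_fun c u = (case u of [j, k] \<Rightarrow> [c \<and> j \<and> k] | _ \<Rightarrow> [])"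

definition perms :: "nat \<Rightarrow> (bool list \<Rightarrow> bool list) set" where
  "perms n = {\<pi>. \<pi> permutes bits n}"

definition labelled_pmf :: "nat \<Rightarrow> (bool \<times> bool list) set \<Rightarrow> bfun pmf" where
  "labelled_pmf n X = map_pmf (\<lambda>\<pi>. block \<pi> (labels (bits n) X \<pi>)) (pmf_of_set (perms n))"

definition random_pmf :: "nat \<Rightarrow> bfun pmf" where
  "random_pmf n = map_pmf (\<lambda>(\<pi>, S). block \<pi> S) (pmf_of_set (perms n \<times> even_sets (bits n)))"

type_synonym setting = "nat \<Rightarrow> (bool \<times> bool list) set option"

text \<open>The index is the query length. Length 2 is reserved for the random bit; vertices of n
  bits need n + 3 for side, phase and tag. Lengths 0 and 1 are sent to n = 0 by truncated
  subtraction, and \<open>block\<close> fixes strings that short.\<close>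

definition block_pmf :: "setting \<Rightarrow> nat \<Rightarrow> bfun pmf" where
  "block_pmf v m = (if m = 2 then map_pmf coin_fun (bernoulli_pmf (2 / 3))
     else case v m of None \<Rightarrow> random_pmf (m - 3) | Some X \<Rightarrow> labelled_pmf (m - 3) X)"

lemma perms_finite: "finite (perms n)" "perms n \<noteq> {}"
  using finite_permutations[of "bits n"] permutes_id[of "bits n"] unfolding perms_def by (simp, blast)

lemma card_perms: "card (perms n) = fact (2 ^ n)"
  unfolding perms_def using card_permutations[of "bits n" "2 ^ n"] by simp

lemma bits_nonempty: "bits n \<noteq> {}"
proof -
  have "card (bits n) \<noteq> 0" by simp
  then show ?thesis by (metis card.empty)
qed

lemma card_even_bits: "2 * real (card (even_sets (bits n))) = 2 ^ (2 ^ n)"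
  using card_even_sets[of "bits n"] bits_nonempty by simp

lemma even_bits_nonempty: "even_sets (bits n) \<noteq> {}"
proof
  assume "even_sets (bits n) = {}"
  then have "(0::real) = 2 ^ (2 ^ n)" using card_even_bits[of n] by simp
  then show False by simp
qed

lemma integral_labelled:
  "(\<integral>\<theta>. R \<theta> \<partial>measure_pmf (labelled_pmf n X)) = (\<Sum>\<pi>\<in>perms n. R (block \<pi> (labels (bits n) X \<pi>))) / fact (2 ^ n)"
  for R :: "bfun \<Rightarrow> real"
  unfolding labelled_pmf_def by (simp add: integral_pmf_of_set perms_finite card_perms)

lemma integral_random:
  "(\<integral>\<theta>. R \<theta> \<partial>measure_pmf (random_pmf n))
    = (\<Sum>\<pi>\<in>perms n. (\<Sum>S\<in>even_sets (bits n). R (block \<pi> S)) / card (even_sets (bits n))) / fact (2 ^ n)"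
  for R :: "bfun \<Rightarrow> real"
proof -
  have "(\<integral>\<theta>. R \<theta> \<partial>measure_pmf (random_pmf n))
      = (\<Sum>(\<pi>, S)\<in>perms n \<times> even_sets (bits n). R (block \<pi> S)) / card (perms n \<times> even_sets (bits n))"
    unfolding random_pmf_def
    by (simp add: integral_pmf_of_set perms_finite even_bits_nonempty case_prod_unfold)
  then show ?thesis
    by (simp add: sum.cartesian_product[symmetric] card_cartesian_product card_perms
        sum_divide_distrib[symmetric] mult.commute)
qed

lemma set_block_pmf:
  assumes "m \<noteq> 2" "\<theta> \<in> set_pmf (block_pmf v m)"
  shows "\<exists>\<pi> S. \<pi> permutes bits (m - 3) \<and> \<theta> = block \<pi> S"
proof (cases "v m")
  case None
  then have "\<theta> \<in> set_pmf (random_pmf (m - 3))" using assms by (simp add: block_pmf_def)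
  then obtain \<pi> S where "(\<pi>, S) \<in> perms (m - 3) \<times> even_sets (bits (m - 3))" "\<theta> = block \<pi> S"
    unfolding random_pmf_def using perms_finite[of "m - 3"] even_bits_nonempty[of "m - 3"]
    by (auto simp: set_pmf_of_set)
  then show ?thesis by (auto simp: perms_def)
next
  case (Some X)
  then have "\<theta> \<in> set_pmf (labelled_pmf (m - 3) X)" using assms by (simp add: block_pmf_def)
  then show ?thesis
    unfolding labelled_pmf_def using perms_finite[of "m - 3"] by (auto simp: set_pmf_of_set perms_def)
qed

text \<open>The verifier meets two independent blocks, at lengths 2 and n + 3. Fixing the bit leaves
  an average over the other block, which almost surely belongs to some permutation and is therefore
  an involution.\<close>

lemma verifier_expectation:
  assumes "is_qstate (n + 3) w"
  shows "(\<integral>f. acc_prob (2 * (n + 3)) (run_circuit f (2 * (n + 3)) (verifier_gates (n + 3))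
      (init_state (n + 3) (2 * (n + 3)) w)) \<partial>oracle_dist (block_pmf v))
    = 2 / 3 * (\<integral>\<theta>. acceptance (n + 3) \<theta> w \<partial>measure_pmf (block_pmf v (n + 3)))"
proof -
  define m where "m = n + 3"
  have m: "m \<noteq> 2" "2 \<le> m" "m - 3 = n" by (auto simp: m_def)
  let ?Q = "block_pmf v"
  define h where "h \<omega> = acc_prob (2 * m) (run_circuit (glue \<omega>) (2 * m) (verifier_gates m) (init_state m (2 * m) w))" for \<omega>
  have meas: "h \<in> borel_measurable (product_oracle ?Q)"
    unfolding h_def by (rule measurable_product_acc)
  have h0: "0 \<le> h \<omega>" for \<omega> unfolding h_def by (rule acc_prob_nonneg)
  have h1: "h \<omega> \<le> sqnorm (2 * m) (init_state m (2 * m) w)" for \<omega>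
    unfolding h_def using acc_prob_le_sqnorm sqnorm_run_circuit by metis
  have AE_m: "AE X in others ?Q 2. \<exists>\<pi> S. \<pi> permutes bits n \<and> X m = block \<pi> S"
    unfolding others_def
    using m set_block_pmf[of m _ v]
    by (intro AE_PiM_component[where P = "\<lambda>\<theta>. \<exists>\<pi> S. \<pi> permutes bits n \<and> \<theta> = block \<pi> S"])
       (auto simp: prob_space_measure_pmf AE_measure_pmf_iff)
  have val: "h (X(2 := coin_fun c)) = (if c then acceptance m (X m) w else 0)"
    if ex: "\<exists>\<pi> S. \<pi> permutes bits n \<and> X m = block \<pi> S" for X c
  proof -
    obtain \<pi> S where \<pi>: "\<pi> permutes bits n" "X m = block \<pi> S" using ex by blast
    let ?f = "glue (X(2 := coin_fun c))"
    have f: "?f u = block \<pi> S u" if "length u = m" for u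
      using that m \<pi> by (auto simp: glue_def)
    have lens: "length (block \<pi> S u) = m" "block \<pi> S (block \<pi> S u) = u" if "length u = m" for u
      using block_properties[OF \<pi>(1)] that by (auto simp: m_def)
    have "h (X(2 := coin_fun c)) = (if c then (\<Sum>r\<in>{r. length r = m - 2}. (cmod (flip_amp ?f w r))\<^sup>2 / 4) else 0)"
      unfolding h_def
    proof (rule verifier_acceptance[OF m(2)])
      fix j k show "?f [j, k] = [c \<and> j \<and> k]" by (simp add: glue_def coin_fun_def)
    qed (use f lens in auto)
    also have "(\<Sum>r\<in>{r. length r = m - 2}. (cmod (flip_amp ?f w r))\<^sup>2 / 4) = acceptance m (X m) w"
      unfolding acceptance_def bits_def using m f by (intro sum.cong refl) (simp add: flip_amp_def \<pi>)
    finally show ?thesis .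
  qed
  have inner: "(\<integral>X. h (X(2 := coin_fun c)) \<partial>others ?Q 2)
      = (if c then (\<integral>\<theta>. acceptance m \<theta> w \<partial>measure_pmf (?Q m)) else 0)" for c
  proof -
    have comp: "(\<lambda>X. X m) \<in> measurable (others ?Q 2) (measure_pmf (?Q m))"
      unfolding others_def using m by (intro measurable_component_singleton) simp
    have upd: "(\<lambda>X. X(2 := coin_fun c)) \<in> measurable (others ?Q 2) (product_oracle ?Q)"
      using measurable_compose[OF measurable_Pair1' measurable_fun_upd_others[of 2 ?Q]] by simp
    have "(\<integral>X. h (X(2 := coin_fun c)) \<partial>others ?Q 2) = (\<integral>X. (if c then acceptance m (X m) w else 0) \<partial>others ?Q 2)"
    proof (rule integral_cong_AE)
      show "(\<lambda>X. h (X(2 := coin_fun c))) \<in> borel_measurable (others ?Q 2)"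
        using upd meas by (rule measurable_compose)
      show "(\<lambda>X. if c then acceptance m (X m) w else 0) \<in> borel_measurable (others ?Q 2)"
        by (rule measurable_compose[OF comp]) simp
      show "AE X in others ?Q 2. h (X(2 := coin_fun c)) = (if c then acceptance m (X m) w else 0)"
        using AE_m by eventually_elim (rule val)
    qed
    also have "\<dots> = (if c then (\<integral>X. acceptance m (X m) w \<partial>others ?Q 2) else 0)" by simp
    also have "(\<integral>X. acceptance m (X m) w \<partial>others ?Q 2) = (\<integral>\<theta>. acceptance m \<theta> w \<partial>distr (others ?Q 2) (measure_pmf (?Q m)) (\<lambda>X. X m))"
      by (rule integral_distr[symmetric, OF comp]) simp
    also have "distr (others ?Q 2) (measure_pmf (?Q m)) (\<lambda>X. X m) = measure_pmf (?Q m)"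
      unfolding others_def using m by (intro distr_PiM_component) (auto simp: prob_space_measure_pmf)
    finally show ?thesis .
  qed
  have "(\<integral>\<omega>. h \<omega> \<partial>product_oracle ?Q) = (\<integral>\<theta>. (\<integral>X. h (X(2 := \<theta>)) \<partial>others ?Q 2) \<partial>measure_pmf (?Q 2))"
    by (rule integral_split_coordinate[OF meas h0 h1])
  also have "\<dots> = 2 / 3 * (\<integral>\<theta>. acceptance m \<theta> w \<partial>measure_pmf (?Q m))"
  proof -
    have "?Q 2 = map_pmf coin_fun (bernoulli_pmf (2 / 3))" by (simp add: block_pmf_def)
    then show ?thesis by (simp add: inner del: fun_upd_apply)
  qed
  finally show ?thesis
    unfolding integral_oracle_dist h_def m_def .
qed

text \<open>Only the length of an input matters: each length carries one hidden matching
  instance.\<close>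

definition lang :: "setting \<Rightarrow> bool list set" where
  "lang v = {x. x \<noteq> [] \<and> v (length x + 3) \<noteq> None}"

lemma lang_in_QMA: "lang v \<in> QMA_F (oracle_dist (block_pmf v))"
proof -
  define p where "p = [:3, 1 :: nat:]"
  have p: "poly p n = n + 3" for n by (simp add: p_def)
  let ?F = "oracle_dist (block_pmf v)" and ?T = "\<lambda>n. circuit_time * (n + 1) ^ 5"
  have acc: "verifier_acc ?F circuit_tm ?T (poly p (length x)) x w
      = 2 / 3 * (\<integral>\<theta>. acceptance (length x + 3) \<theta> w \<partial>measure_pmf (block_pmf v (length x + 3)))"
    if "x \<noteq> []" "is_qstate (length x + 3) w" for x w
    unfolding verifier_acc_def circuit_tm_run(2) using that verifier_expectation[OF that(2)] by (simp add: p)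
  have yes: "\<exists>w. is_qstate (poly p (length x)) w \<and> verifier_acc ?F circuit_tm ?T (poly p (length x)) x w \<ge> 2 / 3"
    if x: "x \<in> lang v" for x
  proof -
    obtain X where X: "v (length x + 3) = Some X" and x0: "x \<noteq> []" using x by (auto simp: lang_def)
    let ?w = "witness (length x) X"
    have "(\<integral>\<theta>. acceptance (length x + 3) \<theta> ?w \<partial>measure_pmf (block_pmf v (length x + 3)))
        = (\<Sum>\<pi>\<in>perms (length x). acceptance (length x + 3) (block \<pi> (labels (bits (length x)) X \<pi>)) ?w) / fact (2 ^ length x)"
      by (simp add: block_pmf_def X integral_labelled)
    also have "(\<Sum>\<pi>\<in>perms (length x). acceptance (length x + 3) (block \<pi> (labels (bits (length x)) X \<pi>)) ?w) = (\<Sum>\<pi>\<in>perms (length x). 1)"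
      by (intro sum.cong refl acceptance_witness) (simp add: perms_def)
    finally have "verifier_acc ?F circuit_tm ?T (poly p (length x)) x ?w = 2 / 3"
      using acc[OF x0 witness_qstate] by (simp add: card_perms)
    then show ?thesis using witness_qstate[of "length x" X] by (auto simp: p)
  qed
  have no: "verifier_acc ?F circuit_tm ?T (poly p (length x)) x w \<le> 1 / 3"
    if x: "x \<notin> lang v" and w: "is_qstate (poly p (length x)) w" for x w
  proof (cases "x = []")
    case True
    have "{b :: bool list. length b = 0 \<and> b \<noteq> [] \<and> hd b} = {}" by auto
    then have "acc_prob 0 \<psi> = 0" for \<psi> unfolding acc_prob_def by (simp only: sum.empty)
    then show ?thesis
      unfolding verifier_acc_def circuit_tm_run(2) using True by simp
  next
    case False
    then have v: "v (length x + 3) = None" and n: "1 \<le> length x"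
      using x by (auto simp: lang_def Suc_le_eq)
    have w1: "is_qstate (length x + 3) w" using w by (simp add: p)
    then have w2: "sqnorm (length x + 3) w = 1" by (simp add: is_qstate_def sqnorm_def)
    let ?E = "even_sets (bits (length x))"
    have E: "0 < card ?E" using even_bits_nonempty by (simp add: card_gt_0_iff)
    have "(\<integral>\<theta>. acceptance (length x + 3) \<theta> w \<partial>measure_pmf (block_pmf v (length x + 3)))
        = (\<Sum>\<pi>\<in>perms (length x). (\<Sum>S\<in>?E. acceptance (length x + 3) (block \<pi> S) w) / card ?E) / fact (2 ^ length x)"
      by (simp add: block_pmf_def v integral_random)
    also have "\<dots> \<le> (\<Sum>\<pi>\<in>perms (length x). 1 / 2) / fact (2 ^ length x)"
    proof (intro divide_right_mono sum_mono)
      fix \<pi> assume "\<pi> \<in> perms (length x)"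
      then have "2 * (\<Sum>S\<in>?E. acceptance (length x + 3) (block \<pi> S) w) \<le> card ?E"
        using acceptance_random_labels[OF _ n w2] by (simp add: perms_def)
      then show "(\<Sum>S\<in>?E. acceptance (length x + 3) (block \<pi> S) w) / card ?E \<le> 1 / 2"
        using E by (simp add: divide_le_eq)
    qed simp
    also have "\<dots> = 1 / 2" by (simp add: card_perms)
    finally show ?thesis using acc[OF False w1] by simp
  qed
  show ?thesis
    unfolding QMA_F_def using wf_circuit_tm circuit_tm_run(1) yes no
    by (intro CollectI exI[of _ circuit_tm] exI[of _ circuit_time] exI[of _ 5] exI[of _ p]) blast
qed

section \<open>Failure of classical witnesses at one length\<close>

lemma block_pmf_upd: "m \<noteq> 2 \<Longrightarrow> block_pmf (v(m := x)) = (block_pmf v)(m := block_pmf (v(m := x)) m)"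
  by (auto simp: block_pmf_def fun_eq_iff)

lemma pigeonhole_preimage:
  fixes y :: "'a \<Rightarrow> 'b"
  assumes "finite G" "finite Y" "Y \<noteq> {}" "\<And>X. X \<in> G \<Longrightarrow> y X \<in> Y"
  shows "\<exists>b\<in>Y. card G \<le> card Y * card {X \<in> G. y X = b}"
proof (rule ccontr)
  assume "\<not> ?thesis"
  then have less: "card Y * card {X \<in> G. y X = b} < card G" if "b \<in> Y" for b
    using that by (auto simp: not_le)
  have "card Y * card G = (\<Sum>b\<in>Y. card Y * card {X \<in> G. y X = b})"
    using sum.group[OF assms(1,2), of y "\<lambda>_. 1 :: nat"] assms(4)
    by (simp add: sum_distrib_left[symmetric] image_subset_iff)
  also have "\<dots> < (\<Sum>b\<in>Y. card G)"
    using assms less by (intro sum_strict_mono) auto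
  finally show False by simp
qed

text \<open>Some witness \<open>b\<close> serves a fraction of at least 2 ^ -p of the even sets,
  which are half of all sets; hence p + 1 takes the place of p in the density. Once \<open>b\<close>
  and the laws of the other blocks are fixed, the acceptance probability is the mean of a function
  \<open>R\<close> of this block alone with values between 0 and 1, and no bound on the number of
  queries enters.\<close>

lemma classical_witness_fails:
  fixes p q :: nat and gs :: "gate list"
  defines "a \<equiv> \<lambda>v y. (\<integral>f. acc_prob q (run_circuit f q gs (init_state p q (basis_state y))) \<partial>oracle_dist (block_pmf v))"
  assumes large: "800 * (p + 1)\<^sup>2 * (p + 9) \<le> 2 ^ n"
    and no: "\<And>y. length y = p \<Longrightarrow> a (v(n + 3 := None)) y \<le> 1 / 3"
    and yes: "\<And>X. X \<in> even_sets (UNIV \<times> bits n) \<Longrightarrow> \<exists>y. length y = p \<and> a (v(n + 3 := Some X)) y \<ge> 2 / 3"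
  shows False
proof -
  define m where "m = n + 3"
  have m: "m \<noteq> 2" "m - 3 = n" by (auto simp: m_def)
  let ?G = "even_sets (UNIV \<times> bits n) :: (bool \<times> bool list) set set"
  obtain y where y: "\<And>X. X \<in> ?G \<Longrightarrow> length (y X) = p \<and> a (v(m := Some X)) (y X) \<ge> 2 / 3"
    using yes unfolding m_def by metis
  have "\<exists>b\<in>bits p. card ?G \<le> card (bits p) * card {X \<in> ?G. y X = b}"
    using y by (intro pigeonhole_preimage bits_nonempty) (auto simp: bits_def)
  then obtain b where b: "length b = p" "card ?G \<le> 2 ^ p * card {X \<in> ?G. y X = b}"
    by (auto simp: bits_def card_bits)
  define A where "A = {X \<in> ?G. y X = b}"
  define R where "R \<theta> = (\<integral>X. acc_prob q (run_circuit (glue (X(m := \<theta>))) q gs (init_state p q (basis_state b)))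
      \<partial>others (block_pmf v) m)" for \<theta>
  have split: "a (v(m := z)) b = (\<integral>\<theta>. R \<theta> \<partial>measure_pmf (block_pmf (v(m := z)) m))" for z
  proof -
    have "others (block_pmf (v(m := z))) m = others (block_pmf v) m"
      by (subst block_pmf_upd[OF m(1)]) (rule others_fun_upd)
    then show ?thesis
      unfolding a_def R_def integral_oracle_dist
      by (subst integral_split_coordinate[OF measurable_product_acc acc_prob_nonneg acc_prob_basis_le_1, where i = m]) simp
  qed
  have R: "\<bar>R \<theta>\<bar> \<le> 1" for \<theta>
  proof -
    interpret prob_space "others (block_pmf v) m" by (rule prob_space_others)
    have "0 \<le> R \<theta>" unfolding R_def by (intro Bochner_Integration.integral_nonneg acc_prob_nonneg)
    moreover have "R \<theta> \<le> 1"
    \<comment> \<open>A non-integrable integrand would have integral 0, so the bound holds in either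
      case.\<close>
    proof (cases "integrable (others (block_pmf v) m) (\<lambda>X. acc_prob q (run_circuit (glue (X(m := \<theta>))) q gs (init_state p q (basis_state b))))")
      case True
      then show ?thesis
        unfolding R_def by (intro integral_le_const) (auto intro: acc_prob_basis_le_1)
    next
      case False
      then show ?thesis by (simp add: R_def not_integrable_integral_eq)
    qed
    ultimately show ?thesis by simp
  qed
  have A: "A \<subseteq> ?G" by (auto simp: A_def)
  have finA: "finite A" by (rule finite_subset[OF A]) simp
  have "2 * real (card ?G) = 2 ^ (2 * 2 ^ n)"
    using card_even_sets[of "UNIV \<times> bits n :: (bool \<times> bool list) set"] bits_nonempty[of n]
    by (simp add: card_cartesian_product)
  moreover have "real (card ?G) \<le> 2 ^ p * real (card A)"
  proof -
    have "real (card ?G) \<le> real (2 ^ p * card A)"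
      using b(2) unfolding A_def by (simp only: of_nat_le_iff)
    then show ?thesis by simp
  qed
  ultimately have dens: "2 ^ (2 * card (bits n)) \<le> 2 ^ (p + 1) * real (card A)" by simp
  have cA: "real (card A) > 0"
  proof (rule ccontr)
    assume "\<not> real (card A) > 0"
    then have "(2::real) ^ (2 * card (bits n)) \<le> 0" using dens by simp
    moreover have "(0::real) < 2 ^ (2 * card (bits n))" by (rule zero_less_power) simp
    ultimately show False by linarith
  qed
  have yesA: "a (v(m := Some X)) b \<ge> 2 / 3" if "X \<in> A" for X
    using y[of X] that by (auto simp: A_def)
  have "2 / 3 * real (card A) \<le> (\<Sum>X\<in>A. a (v(m := Some X)) b)"
    using sum_mono[of A "\<lambda>_. 2 / 3" "\<lambda>X. a (v(m := Some X)) b"] yesA by (simp add: mult.commute)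
  then have "2 / 3 \<le> (\<Sum>X\<in>A. a (v(m := Some X)) b) / card A"
    using cA by (simp add: le_divide_eq)
  also have "\<dots> = (\<Sum>\<pi>\<in>perms n. (\<Sum>X\<in>A. R (block \<pi> (labels (bits n) X \<pi>))) / card A) / fact (2 ^ n)"
  proof -
    have "a (v(m := Some X)) b = (\<Sum>\<pi>\<in>perms n. R (block \<pi> (labels (bits n) X \<pi>))) / fact (2 ^ n)" for X
      unfolding split using m by (simp add: block_pmf_def integral_labelled)
    then have "(\<Sum>X\<in>A. a (v(m := Some X)) b) / card A
        = (\<Sum>X\<in>A. \<Sum>\<pi>\<in>perms n. R (block \<pi> (labels (bits n) X \<pi>))) / card A / fact (2 ^ n)"
      by (simp add: sum_divide_distrib[symmetric] mult.commute)
    then show ?thesis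
      by (subst (asm) sum.swap) (simp add: sum_divide_distrib)
  qed
  finally have 1: "2 / 3 \<le> (\<Sum>\<pi>\<in>perms n. (\<Sum>X\<in>A. R (block \<pi> (labels (bits n) X \<pi>))) / card A) / fact (2 ^ n)" .
  have 2: "(\<Sum>\<pi>\<in>perms n. (\<Sum>S\<in>even_sets (bits n). R (block \<pi> S)) / card (even_sets (bits n))) / fact (2 ^ n) \<le> 1 / 3"
    using no[OF b(1)] unfolding m_def[symmetric] split using m by (simp add: block_pmf_def integral_random)
  have "800 * (p + 1)\<^sup>2 * ((p + 1) + 8) \<le> card (bits n)"
    using large by (simp add: add.commute)
  note bound = hidden_matching_bound[OF finite_bits' A _ dens this, of "\<lambda>\<pi> S. R (block \<pi> S)", folded perms_def]
  have "\<bar>(\<Sum>\<pi>\<in>perms n. (\<Sum>X\<in>A. R (block \<pi> (labels (bits n) X \<pi>))) / card A) / fact (2 ^ n)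
     - (\<Sum>\<pi>\<in>perms n. (\<Sum>S\<in>even_sets (bits n). R (block \<pi> S)) / card (even_sets (bits n))) / fact (2 ^ n)\<bar> < 1 / 3"
    using bound R by simp
  then show False using 1 2 by linarith
qed

section \<open>Diagonalization\<close>

text \<open>Only the finitely many transitions between the states of a machine matter, so a list of numbers
  determines its behaviour, and the machines of interest are countable.\<close>

definition dec_sym :: "nat \<Rightarrow> sym" where
  "dec_sym i = (if i = 0 then Blk else if i = 1 then Zero else One)"

definition dec_dir :: "nat \<Rightarrow> dir" where
  "dec_dir i = (if i = 0 then Lft else if i = 1 then Rgt else Stay)"

fun enc_sym :: "sym \<Rightarrow> nat" where
  "enc_sym Blk = 0" | "enc_sym Zero = 1" | "enc_sym One = 2"

fun enc_dir :: "dir \<Rightarrow> nat" where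
  "enc_dir Lft = 0" | "enc_dir Rgt = 1" | "enc_dir Stay = 2"

lemma dec_enc [simp]: "dec_sym (enc_sym a) = a" "dec_dir (enc_dir d) = d"
  by (cases a; simp add: dec_sym_def) (cases d; simp add: dec_dir_def)

definition table_tm :: "(nat \<times> nat \<times> nat) list \<Rightarrow> tm" where
  "table_tm tab = TM 0 (\<lambda>s a. case tab ! (3 * s + enc_sym a) of (s', w, d) \<Rightarrow> (s', dec_sym w, dec_dir d))"

text \<open>A well-formed machine never leaves its finite set of states, so a run consults only
  entries of the table. The induction carries this bound on the state along.\<close>

lemma tm_run_table:
  assumes "wf_tm M"
  shows "\<exists>tab. \<forall>x t. tm_run (table_tm tab) x t = tm_run M x t"
proof -
  define g where "g i = (case tm_trans M (i div 3) (dec_sym (i mod 3)) of (s', w, d) \<Rightarrow> (s', enc_sym w, enc_dir d))" for i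
  define tab where "tab = map g [0..<3 * tm_states M]"
  have trans: "tm_trans (table_tm tab) s a = tm_trans M s a" if "s < tm_states M" for s a
  proof -
    have a: "enc_sym a < 3" by (cases a) simp_all
    then have i: "3 * s + enc_sym a < 3 * tm_states M" "(3 * s + enc_sym a) div 3 = s" "(3 * s + enc_sym a) mod 3 = enc_sym a"
      using that by (auto intro!: div_nat_eqI mod_nat_eqI)
    show ?thesis
      using i(1) a by (simp add: table_tm_def tab_def g_def i(2,3) case_prod_unfold)
  qed
  have "tm_run (table_tm tab) x t = tm_run M x t \<and> fst (tm_run M x t) < tm_states M" for x t
  proof (induction t)
    case 0
    then show ?case using assms by (simp add: tm_run_def wf_tm_def)
  next
    case (Suc t)
    obtain s l r where c: "tm_run M x t = (s, l, r)" by (cases "tm_run M x t")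
    have s: "s < tm_states M" using Suc c by simp
    have wf: "fst (tm_trans M s a) < tm_states M" for a using assms s by (simp add: wf_tm_def)
    have Suc': "tm_run N x (Suc t) = tm_step N (tm_run N x t)" for N by (simp add: tm_run_def)
    show ?case
      unfolding Suc' using Suc c s wf[of "tape_head r"]
      by (auto simp: tm_step_def trans split: prod.splits dir.splits list.splits)
  qed
  then show ?thesis by blast
qed

type_synonym code = "(nat \<times> nat \<times> nat) list \<times> nat \<times> nat \<times> nat list"

text \<open>A code holds the transition table, the two constants of the time bound and the
  coefficients of the witness length. The conditions on the machine itself are left out, which only
  enlarges the countable set of candidates to be defeated.\<close>

definition solves :: "setting \<Rightarrow> code \<Rightarrow> bool" where
  "solves v e \<longleftrightarrow> (case e of (tab, c, k, ns) \<Rightarrow>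
     let acc = (\<lambda>x y. verifier_acc (oracle_dist (block_pmf v)) (table_tm tab) (\<lambda>n. c * (n + 1) ^ k)
                 (poly (Poly ns) (length x)) x (basis_state y)) in
     (\<forall>x\<in>lang v. \<exists>y. length y = poly (Poly ns) (length x) \<and> acc x y \<ge> 2 / 3) \<and>
     (\<forall>x. x \<notin> lang v \<longrightarrow> (\<forall>y. length y = poly (Poly ns) (length x) \<longrightarrow> acc x y \<le> 1 / 3)))"

lemma in_QCMA_solves:
  assumes "lang v \<in> QCMA_F (oracle_dist (block_pmf v))"
  shows "\<exists>e. solves v e"
proof -
  obtain M c k p where M: "wf_tm M"
    and yes: "\<forall>x\<in>lang v. \<exists>y. length y = poly p (length x) \<and>
        verifier_acc (oracle_dist (block_pmf v)) M (\<lambda>n. c * (n + 1) ^ k) (poly p (length x)) x (basis_state y) \<ge> 2 / 3"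
    and no: "\<forall>x. x \<notin> lang v \<longrightarrow> (\<forall>y. length y = poly p (length x) \<longrightarrow>
        verifier_acc (oracle_dist (block_pmf v)) M (\<lambda>n. c * (n + 1) ^ k) (poly p (length x)) x (basis_state y) \<le> 1 / 3)"
    using assms unfolding QCMA_F_def by blast
  obtain tab where "\<forall>x t. tm_run (table_tm tab) x t = tm_run M x t"
    using tm_run_table[OF M] by blast
  moreover have "Poly (coeffs p) = p" by simp
  ultimately have "solves v (tab, c, k, coeffs p)"
    using yes no by (simp add: solves_def verifier_acc_def)
  then show ?thesis ..
qed

section \<open>Defeating one candidate, then all of them\<close>

lemma poly_nat_bound:
  fixes p :: "nat poly"
  shows "\<exists>C d. \<forall>n\<ge>1. poly p n \<le> C * n ^ d"
proof (induction p)
  case 0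
  then show ?case by (intro exI[of _ 0]) simp
next
  case (pCons a p)
  then obtain C d where C: "\<And>n. n \<ge> 1 \<Longrightarrow> poly p n \<le> C * n ^ d" by blast
  have "poly (pCons a p) n \<le> (a + C) * n ^ Suc d" if n: "n \<ge> 1" for n
  proof -
    have "a \<le> a * n ^ Suc d" using n by simp
    moreover have "n * poly p n \<le> n * (C * n ^ d)" using C[OF n] by (rule mult_left_mono) simp
    ultimately have "a + n * poly p n \<le> a * n ^ Suc d + n * (C * n ^ d)"
      by (rule add_mono)
    also have "\<dots> = (a + C) * n ^ Suc d"
      by (simp add: algebra_simps)
    finally show ?thesis by simp
  qed
  then show ?case by blast
qed

lemma exponential_beats_poly:
  fixes p :: "nat poly"
  shows "\<exists>n\<ge>b. 1 \<le> n \<and> 800 * (poly p n + 1)\<^sup>2 * (poly p n + 9) \<le> 2 ^ n"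
proof -
  define r where "r = smult 800 ((p + 1)\<^sup>2 * (p + [:9:]))"
  have r: "poly r n = 800 * (poly p n + 1)\<^sup>2 * (poly p n + 9)" for n
    by (simp add: r_def power2_eq_square algebra_simps)
  obtain C d where C: "\<And>n. n \<ge> 1 \<Longrightarrow> poly r n \<le> C * n ^ d"
    using poly_nat_bound by blast
  have "eventually (\<lambda>n::nat. real C * real n ^ d \<le> 2 ^ n) at_top"
    by real_asymp
  then have "eventually (\<lambda>n. n \<ge> max b 1 \<and> real C * real n ^ d \<le> 2 ^ n) at_top"
    using eventually_ge_at_top by (rule eventually_conj[rotated])
  then obtain n where n: "n \<ge> max b 1" "real C * real n ^ d \<le> 2 ^ n"
    by (auto simp: eventually_at_top_linorder)
  have "real (C * n ^ d) \<le> real (2 ^ n)" using n(2) by simp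
  then have "C * n ^ d \<le> 2 ^ n" by (simp only: of_nat_le_iff)
  then have "poly r n \<le> 2 ^ n" using C[of n] n(1) by simp
  then show ?thesis using n(1) by (intro exI[of _ n]) (simp add: r)
qed

text \<open>Whatever the setting is elsewhere, no candidate is right on the input of n ones both
  with random labels and with every hidden set at length m. Its circuit on that input makes no query
  longer than \<open>B\<close>, so an error there is decided by the setting up to \<open>B\<close>
  and survives all changes beyond.\<close>

lemma solver_fails_somewhere:
  "\<exists>m z B. b < m \<and> m \<le> B \<and> (\<forall>v'. (\<forall>i\<le>B. v' i = (v(m := z)) i) \<longrightarrow> \<not> solves v' e)"
proof -
  obtain tab c k ns where e: "e = (tab, c, k, ns)" by (cases e)
  define p where "p = Poly ns"
  obtain n where n: "n \<ge> b" "1 \<le> n" "800 * (poly p n + 1)\<^sup>2 * (poly p n + 9) \<le> 2 ^ n"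
    using exponential_beats_poly by blast
  define m where "m = n + 3"
  define x where "x = replicate n True"
  have x: "length x = n" "x \<noteq> []" using n(2) by (auto simp: x_def)
  obtain q gs where qgs: "decode_circuit (tm_output (tm_run (table_tm tab) x (c * (n + 1) ^ k))) = (q, gs)"
    by (cases "decode_circuit (tm_output (tm_run (table_tm tab) x (c * (n + 1) ^ k)))")
  define a where "a v y = (\<integral>f. acc_prob q (run_circuit f q gs (init_state (poly p n) q (basis_state y))) \<partial>oracle_dist (block_pmf v))" for v y
  have acc: "verifier_acc (oracle_dist (block_pmf v)) (table_tm tab) (\<lambda>n. c * (n + 1) ^ k) (poly p n) x (basis_state y) = a v y" for v y
    unfolding verifier_acc_def a_def x(1) qgs by simp
  define B where "B = m + Max (insert 0 (gate_in_length ` set gs))"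
  have B: "gate_in_length g \<le> B" if "g \<in> set gs" for g
    unfolding B_def by (rule trans_le_add2, rule Max_ge) (use that in auto)
  have dep: "a v y = a v' y" if "\<forall>i\<le>B. v i = v' i" for v v' y
    unfolding a_def integral_oracle_dist
  proof (rule integral_finite_support[OF measurable_product_acc, where B = B])
    fix \<omega> \<omega>' :: "nat \<Rightarrow> bfun" assume *: "\<And>i. i \<le> B \<Longrightarrow> \<omega> i = \<omega>' i"
    have "run_circuit (glue \<omega>) q gs \<psi> = run_circuit (glue \<omega>') q gs \<psi>" for \<psi>
      by (rule run_circuit_cong[where B = B]) (use * B in \<open>auto simp: glue_def\<close>)
    then show "acc_prob q (run_circuit (glue \<omega>) q gs (init_state (poly p n) q (basis_state y)))
        = acc_prob q (run_circuit (glue \<omega>') q gs (init_state (poly p n) q (basis_state y)))" by simp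
  next
    fix i assume "i \<le> B"
    then show "block_pmf v i = block_pmf v' i" using that by (simp add: block_pmf_def)
  qed
  have "(\<exists>y. length y = poly p n \<and> a (v(m := None)) y > 1 / 3) \<or>
      (\<exists>X. \<forall>y. length y = poly p n \<longrightarrow> a (v(m := Some X)) y < 2 / 3)"
  proof (rule ccontr)
    assume c: "\<not> ?thesis"
    show False
    proof (rule classical_witness_fails[where p = "poly p n" and n = n and q = q and gs = gs and v = v])
      show "800 * (poly p n + 1)\<^sup>2 * (poly p n + 9) \<le> 2 ^ n" by (rule n(3))
    qed (use c in \<open>auto simp: a_def[symmetric] m_def[symmetric] not_less\<close>)
  qed
  then obtain z where z: "\<not> (if z = None then \<forall>y. length y = poly p n \<longrightarrow> a (v(m := z)) y \<le> 1 / 3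
      else \<exists>y. length y = poly p n \<and> a (v(m := z)) y \<ge> 2 / 3)"
  proof (elim disjE exE)
    fix y assume "length y = poly p n \<and> a (v(m := None)) y > 1 / 3"
    then show thesis by (intro that[of None]) (auto simp: not_le)
  next
    fix X assume "\<forall>y. length y = poly p n \<longrightarrow> a (v(m := Some X)) y < 2 / 3"
    then show thesis by (intro that[of "Some X"]) (auto simp: not_le)
  qed
  have "\<not> solves v' e" if v': "\<forall>i\<le>B. v' i = (v(m := z)) i" for v'
  proof
    assume s: "solves v' e"
    have av: "a v' y = a (v(m := z)) y" for y using v' by (rule dep)
    have "v' m = z" using v' by (simp add: B_def)
    then have xl: "x \<in> lang v' \<longleftrightarrow> z \<noteq> None" using x by (simp add: lang_def m_def)
    have "x \<in> lang v' \<Longrightarrow> \<exists>y. length y = poly p n \<and> a v' y \<ge> 2 / 3"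
      "x \<notin> lang v' \<Longrightarrow> length y = poly p n \<Longrightarrow> a v' y \<le> 1 / 3" for y
      using s unfolding solves_def e prod.case Let_def p_def[symmetric] acc[symmetric] x(1)[symmetric] by blast+
    then show False using z xl av by auto
  qed
  moreover have "b < m" "m \<le> B" using n(1) by (auto simp: m_def B_def)
  ultimately show ?thesis by blast
qed

text \<open>Stage \<open>e\<close> alters the current function at one point beyond the bound
  \<open>b e\<close> and then freezes it up to the next bound, so no later stage can undo what an
  earlier one achieved.\<close>

lemma diagonal:
  fixes D :: "nat \<Rightarrow> (nat \<Rightarrow> 'a) \<Rightarrow> bool"
  assumes step: "\<And>e v b. \<exists>m z B. b < m \<and> m \<le> B \<and> (\<forall>v'. (\<forall>i\<le>B. v' i = (v(m := z)) i) \<longrightarrow> D e v')"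
  shows "\<exists>v. \<forall>e. D e v"
proof -
  define good where "good e v b t \<longleftrightarrow> (case t of (m, z, B) \<Rightarrow> b < m \<and> m \<le> B \<and>
      (\<forall>v'. (\<forall>i\<le>B. v' i = (v(m := z)) i) \<longrightarrow> D e v'))" for e v b and t :: "nat \<times> 'a \<times> nat"
  define T where "T e v b = (SOME t. good e v b t)" for e v b
  have T: "good e v b (T e v b)" for e v b
  proof -
    obtain m z B where "good e v b (m, z, B)"
      using step[of b v e] unfolding good_def by auto
    then show ?thesis unfolding T_def by (rule someI)
  qed
  define M where "M e v b = fst (T e v b)" for e v b
  define Z where "Z e v b = fst (snd (T e v b))" for e v b
  define C where "C e v b = snd (snd (T e v b))" for e v b
  have MZC: "b < M e v b \<and> M e v b \<le> C e v b \<and>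
      (\<forall>v'. (\<forall>i\<le>C e v b. v' i = (v(M e v b := Z e v b)) i) \<longrightarrow> D e v')" for e v b
    using T[of e v b] by (simp add: good_def M_def Z_def C_def case_prod_unfold)
  define next_stage where "next_stage e s = (case s of (v, b) \<Rightarrow> (v(M e v b := Z e v b), C e v b))" for e and s :: "(nat \<Rightarrow> 'a) \<times> nat"
  define s where "s = rec_nat (undefined, 0) next_stage"
  have s_Suc: "s (Suc e) = next_stage e (s e)" for e by (simp add: s_def)
  define v where "v e = fst (s e)" for e
  define b where "b e = snd (s e)" for e
  have v_Suc: "v (Suc e) = (v e)(M e (v e) (b e) := Z e (v e) (b e))" and b_Suc: "b (Suc e) = C e (v e) (b e)" for e
    by (simp_all add: v_def b_def s_Suc next_stage_def case_prod_unfold)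
  have M: "b e < M e (v e) (b e)" "M e (v e) (b e) \<le> b (Suc e)" for e
    using MZC[of "b e" e "v e"] by (auto simp: b_Suc)
  have b_less: "b e < b (Suc e)" for e using M[of e] by linarith
  have b_mono: "b i \<le> b j" if "i \<le> j" for i j
    by (rule lift_Suc_mono_le[of b, OF less_imp_le[OF b_less] that])
  have b_ge: "e \<le> b e" for e
  proof (induction e)
    case (Suc e)
    then show ?case using b_less[of e] by linarith
  qed simp
  have stable: "v j i = v e i" if "e \<le> j" "i \<le> b e" for e j i
    using that(1)
  proof (induction j rule: dec_induct)
    case (step j)
    have "i < M j (v j) (b j)" using M(1)[of j] b_mono[OF step(1)] that(2) by linarith
    then show ?case using step by (simp add: v_Suc)
  qed simp
  \<comment> \<open>The bounds grow strictly, so i \<le> \<open>b (Suc i)\<close> and the value at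
    \<open>i\<close> is final by stage \<open>Suc i\<close>.\<close>
  define w where "w i = v (Suc i) i" for i
  have agree: "w i = v e i" if "i \<le> b e" for e i
  proof (cases "e \<le> Suc i")
    case True
    then show ?thesis using stable[OF True that] by (simp add: w_def)
  next
    case False
    have "i \<le> b (Suc i)" using b_ge[of "Suc i"] by simp
    then show ?thesis using stable[of "Suc i" e i] False by (simp add: w_def)
  qed
  have "D e w" for e
  proof -
    have "\<forall>i\<le>C e (v e) (b e). w i = ((v e)(M e (v e) (b e) := Z e (v e) (b e))) i"
      using agree[of _ "Suc e"] unfolding v_Suc b_Suc by blast
    then show ?thesis using MZC[of "b e" e "v e"] by blast
  qed
  then show ?thesis by blast
qed

theorem theorem6p2:
  shows "\<exists>F. dist_oracle F \<and> (\<exists>L. L \<in> QMA_F F \<and> L \<notin> QCMA_F F)"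
proof -
  obtain v where v: "\<forall>i. \<not> solves v (from_nat i)"
    using diagonal[of "\<lambda>i v. \<not> solves v (from_nat i)", OF solver_fails_somewhere] by blast
  have "\<not> solves v e" for e
    using v[rule_format, of "to_nat e"] by simp
  then have "lang v \<notin> QCMA_F (oracle_dist (block_pmf v))"
    using in_QCMA_solves by blast
  then show ?thesis
    using dist_oracle_oracle_dist lang_in_QMA by blast
qed

end
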